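(* Let $m\ge1$ be an integer. The possible growth types (that is, $\simeq$-classes) of conjugator length functions of cocompact lattices in $\mathsf H(\mathbb R)^m$ are exactly $\{n^2,n^3,\ldots,n^{m+1}\}$: for every cocompact lattice $\Gamma$ in $\mathsf H(\mathbb R)^m$ there is $j\in\{2,\ldots,m+1\}$ with $\operatorname{CL}_\Gamma(n)\simeq n^j$, and for every $j\in\{2,\ldots,m+1\}$ there is a cocompact lattice $\Gamma$ in $\mathsf H(\mathbb R)^m$ with $\operatorname{CL}_\Gamma(n)\simeq n^j$. In particular, conjugator length is not a quasi-isometry invariant for nilpotent groups: there exist quasi-isometric finitely generated nilpotent groups $\Gamma_1,\Gamma_2$ with $\operatorname{CL}_{\Gamma_1}\not\simeq\operatorname{CL}_{\Gamma_2}$.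
   Context: $\mathsf H(\mathbb R)$ is the 3-dimensional real Heisenberg group and $\mathsf H(\mathbb R)^m$ is its $m$-th direct power. Here $\mathbb N=\{1,2,\ldots\}$. Let $G$ be a finitely generated group with a word norm $|\cdot|$ (with respect to a finite generating set). For conjugate $u,v\in G$, let $\operatorname{CL}(u,v)$ be the minimal length $|x|$ of an element $x\in G$ with $x^{-1}ux=v$. The conjugator length function of $G$ is $\operatorname{CL}_G(n)=\max\{\operatorname{CL}(u,v)\mid u,v\in G\text{ conjugate},\ |u|,|v|\le n\}$. For $f,g\colon\mathbb N\to[0,\infty)$ write $f\preceq g$ if there is an integer $C\ge1$ with $f(n)\le C\,g(Cn+C)+C$ for all $n\in\mathbb N$, and $f\simeq g$ if $f\preceq g\preceq f$. Up to $\simeq$, $\operatorname{CL}_G$ does not depend on the finite generating set. *)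

theory Defs
  imports "HOL-Analysis.Analysis" "HOL-Algebra.Algebra"
begin

section \<open>Word norms and conjugator length\<close>

definition finite_generating_set :: "('a, 'b) monoid_scheme \<Rightarrow> 'a set \<Rightarrow> bool" where
  "finite_generating_set G S \<longleftrightarrow> finite S \<and> S \<subseteq> carrier G \<and> generate G S = carrier G"

definition finitely_generated_group :: "('a, 'b) monoid_scheme \<Rightarrow> bool" where
  "finitely_generated_group G \<longleftrightarrow> group G \<and> (\<exists>S. finite_generating_set G S)"

definition word_norm :: "('a, 'b) monoid_scheme \<Rightarrow> 'a set \<Rightarrow> 'a \<Rightarrow> nat" where
  "word_norm G S g = (LEAST k. \<exists>ws. length ws = k \<and> set ws \<subseteq> S \<union> m_inv G ` S \<and>
     foldr (\<otimes>\<^bsub>G\<^esub>) ws \<one>\<^bsub>G\<^esub> = g)"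

definition conjugates :: "('a, 'b) monoid_scheme \<Rightarrow> 'a \<Rightarrow> 'a \<Rightarrow> 'a \<Rightarrow> bool" where
  "conjugates G x u v \<longleftrightarrow> x \<in> carrier G \<and> inv\<^bsub>G\<^esub> x \<otimes>\<^bsub>G\<^esub> u \<otimes>\<^bsub>G\<^esub> x = v"

definition conjugator_length :: "('a, 'b) monoid_scheme \<Rightarrow> 'a set \<Rightarrow> 'a \<Rightarrow> 'a \<Rightarrow> nat" where
  "conjugator_length G S u v = (LEAST k. \<exists>x. conjugates G x u v \<and> word_norm G S x = k)"

text \<open>If \<open>S\<close> is a finite generating set of the group \<open>G\<close>, balls are finite and
  \<open>(\<one>, \<one>)\<close> is always an admissible pair, so the maximum below is over a finite
  nonempty set.\<close>

definition conjugator_length_function :: "('a, 'b) monoid_scheme \<Rightarrow> 'a set \<Rightarrow> nat \<Rightarrow> nat" where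
  "conjugator_length_function G S n =
     Max {conjugator_length G S u v | u v. u \<in> carrier G \<and> v \<in> carrier G \<and>
            (\<exists>x. conjugates G x u v) \<and> word_norm G S u \<le> n \<and> word_norm G S v \<le> n}"

section \<open>Growth types\<close>

text \<open>The natural numbers start at 1 here: the value of a growth function at 0 is irrelevant.\<close>

definition growth_le :: "(nat \<Rightarrow> real) \<Rightarrow> (nat \<Rightarrow> real) \<Rightarrow> bool" (infix \<open>\<preceq>\<^sub>g\<close> 50) where
  "f \<preceq>\<^sub>g g \<longleftrightarrow> (\<exists>C::nat. C \<ge> 1 \<and> (\<forall>n\<ge>1. f n \<le> real C * g (C * n + C) + real C))"

definition growth_equiv :: "(nat \<Rightarrow> real) \<Rightarrow> (nat \<Rightarrow> real) \<Rightarrow> bool" (infix \<open>\<simeq>\<^sub>g\<close> 50) where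
  "f \<simeq>\<^sub>g g \<longleftrightarrow> f \<preceq>\<^sub>g g \<and> g \<preceq>\<^sub>g f"

text \<open>The growth type of the conjugator length function does not depend on the finite
  generating set, so it may be tested on all of them; finite generation rules out
  vacuous truth.\<close>

definition conjugator_length_growth :: "('a, 'b) monoid_scheme \<Rightarrow> (nat \<Rightarrow> real) \<Rightarrow> bool" where
  "conjugator_length_growth G f \<longleftrightarrow> finitely_generated_group G \<and>
     (\<forall>S. finite_generating_set G S \<longrightarrow> (\<lambda>n. real (conjugator_length_function G S n)) \<simeq>\<^sub>g f)"

section \<open>Quasi-isometry and nilpotency\<close>

definition word_dist :: "('a, 'b) monoid_scheme \<Rightarrow> 'a set \<Rightarrow> 'a \<Rightarrow> 'a \<Rightarrow> real" where
  "word_dist G S g h = real (word_norm G S (inv\<^bsub>G\<^esub> g \<otimes>\<^bsub>G\<^esub> h))"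

definition quasi_isometry ::
  "'a set \<Rightarrow> ('a \<Rightarrow> 'a \<Rightarrow> real) \<Rightarrow> 'b set \<Rightarrow> ('b \<Rightarrow> 'b \<Rightarrow> real) \<Rightarrow> ('a \<Rightarrow> 'b) \<Rightarrow> bool" where
  "quasi_isometry A dA B dB f \<longleftrightarrow> f \<in> A \<rightarrow> B \<and>
     (\<exists>K C. K \<ge> 1 \<and> C \<ge> 0 \<and>
        (\<forall>x\<in>A. \<forall>y\<in>A. dA x y / K - C \<le> dB (f x) (f y) \<and> dB (f x) (f y) \<le> K * dA x y + C) \<and>
        (\<forall>b\<in>B. \<exists>x\<in>A. dB (f x) b \<le> C))"

text \<open>All word metrics on a finitely generated group are bi-Lipschitz equivalent, so again the
  choice of the finite generating sets does not matter.\<close>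

definition quasi_isometric_groups ::
  "('a, 'c) monoid_scheme \<Rightarrow> ('b, 'd) monoid_scheme \<Rightarrow> bool" where
  "quasi_isometric_groups G H \<longleftrightarrow> finitely_generated_group G \<and> finitely_generated_group H \<and>
     (\<forall>S T. finite_generating_set G S \<and> finite_generating_set H T \<longrightarrow>
        (\<exists>f. quasi_isometry (carrier G) (word_dist G S) (carrier H) (word_dist H T) f))"

primrec lower_central_series :: "('a, 'b) monoid_scheme \<Rightarrow> nat \<Rightarrow> 'a set" where
  "lower_central_series G 0 = carrier G"
| "lower_central_series G (Suc i) = generate G
     (\<Union>a \<in> lower_central_series G i. \<Union>b \<in> carrier G. {a \<otimes>\<^bsub>G\<^esub> b \<otimes>\<^bsub>G\<^esub> inv\<^bsub>G\<^esub> a \<otimes>\<^bsub>G\<^esub> inv\<^bsub>G\<^esub> b})"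

definition nilpotent_group :: "('a, 'b) monoid_scheme \<Rightarrow> bool" where
  "nilpotent_group G \<longleftrightarrow> group G \<and> (\<exists>c. lower_central_series G c = {\<one>\<^bsub>G\<^esub>})"

section \<open>Powers of the Heisenberg group and their lattices\<close>

type_synonym heis = "real \<times> real \<times> real"

text \<open>The triple \<open>(x, y, z)\<close> stands for the upper unitriangular matrix with rows
  \<open>(1, x, z)\<close>, \<open>(0, 1, y)\<close>, \<open>(0, 0, 1)\<close>; see \<open>heis_matrix_mult\<close> and
  \<open>range_heis_matrix\<close> below.\<close>

definition heisenberg :: "heis monoid" where
  "heisenberg = \<lparr>carrier = UNIV,
     mult = (\<lambda>(x, y, z) (x', y', z'). (x + x', y + y', z + z' + x * y')),
     one = (0, 0, 0)\<rparr>"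

definition heisenberg_power :: "nat \<Rightarrow> (nat \<Rightarrow> heis) monoid" where
  "heisenberg_power m = product_group {..<m} (\<lambda>_. heisenberg)"

definition heisenberg_power_topology :: "nat \<Rightarrow> (nat \<Rightarrow> heis) topology" where
  "heisenberg_power_topology m = product_topology (\<lambda>_. euclidean) {..<m}"

text \<open>The topology \<open>Y\<close> is the quotient topology on \<open>G/\<Gamma>\<close>: a quotient map
  determines the topology of its target.\<close>

definition cocompact_lattice ::
  "('a, 'b) monoid_scheme \<Rightarrow> 'a topology \<Rightarrow> 'a set \<Rightarrow> bool" where
  "cocompact_lattice G T \<Gamma> \<longleftrightarrow> subgroup \<Gamma> G \<and>
     subtopology T \<Gamma> = discrete_topology \<Gamma> \<and>
     (\<exists>Y. quotient_map T Y (\<lambda>g. g <#\<^bsub>G\<^esub> \<Gamma>) \<and> compact_space Y)"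

abbreviation lattice_group :: "nat \<Rightarrow> (nat \<Rightarrow> heis) set \<Rightarrow> (nat \<Rightarrow> heis) monoid" where
  "lattice_group m \<Gamma> \<equiv> (heisenberg_power m)\<lparr>carrier := \<Gamma>\<rparr>"

definition heis_matrix :: "heis \<Rightarrow> real^3^3" where
  "heis_matrix = (\<lambda>(x, y, z). vector [vector [1, x, z], vector [0, 1, y], vector [0, 0, 1]])"

lemma heis_matrix_mult: "heis_matrix (g \<otimes>\<^bsub>heisenberg\<^esub> h) = heis_matrix g ** heis_matrix h"
  by (cases g; cases h)
     (simp add: heis_matrix_def heisenberg_def matrix_matrix_mult_def vec_eq_iff forall_3 sum_3
       algebra_simps)

lemma inj_heis_matrix: "inj heis_matrix"
  by (auto simp: inj_def heis_matrix_def vec_eq_iff forall_3)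

lemma range_heis_matrix:
  "range heis_matrix = {A. (\<forall>i. A $ i $ i = 1) \<and> A $ 2 $ 1 = 0 \<and> A $ 3 $ 1 = 0 \<and> A $ 3 $ 2 = 0}"
proof -
  have "A = heis_matrix (A $ 1 $ 2, A $ 2 $ 3, A $ 1 $ 3)"
    if "\<forall>i. A $ i $ i = 1" "A $ 2 $ 1 = 0" "A $ 3 $ 1 = 0" "A $ 3 $ 2 = 0" for A :: "real^3^3"
    using that by (simp add: heis_matrix_def vec_eq_iff forall_3)
  moreover have "heis_matrix g $ i $ i = 1" "heis_matrix g $ 2 $ 1 = 0"
    "heis_matrix g $ 3 $ 1 = 0" "heis_matrix g $ 3 $ 2 = 0" for g i
    using exhaust_3[of i] by (auto simp: heis_matrix_def split: prod.splits)
  ultimately show ?thesis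
    by (auto simp del: split_paired_All)
qed

lemma group_heisenberg: "group heisenberg"
proof (rule groupI)
  fix g assume "g \<in> carrier heisenberg"
  obtain x y z where "g = (x, y, z)" by (cases g)
  then have "(- x, - y, x * y - z) \<otimes>\<^bsub>heisenberg\<^esub> g = \<one>\<^bsub>heisenberg\<^esub>"
    by (simp add: heisenberg_def)
  then show "\<exists>h\<in>carrier heisenberg. h \<otimes>\<^bsub>heisenberg\<^esub> g = \<one>\<^bsub>heisenberg\<^esub>"
    by (rule bexI) (simp add: heisenberg_def)
qed (auto simp: heisenberg_def algebra_simps)

lemma group_heisenberg_power: "group (heisenberg_power m)"
  by (simp add: heisenberg_power_def group_heisenberg)

lemma topspace_heisenberg_power: "topspace (heisenberg_power_topology m) = carrier (heisenberg_power m)"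
  by (simp add: heisenberg_power_topology_def heisenberg_power_def heisenberg_def)

end

theory Submission
  imports Defs "HOL-Library.Function_Algebras"
    "HOL-Computational_Algebra.Polynomial_Factorial"
begin

text \<open>
  Write an element of the \<open>m\<close>-th power of the real Heisenberg group as a pair \<open>(w, z)\<close> with
  \<open>w\<^sub>i = x\<^sub>i + \<i> y\<^sub>i\<close> a complex vector and \<open>z\<^sub>i\<close> the symmetrised central coordinate
  \<open>z\<^sub>i - x\<^sub>i y\<^sub>i / 2\<close>. The product becomes \<open>(w + w', z + z' + \<omega>(w, w') / 2)\<close>, where
  \<open>\<omega>(w, w')\<^sub>i = Im (cnj w\<^sub>i \<cdot> w'\<^sub>i)\<close> (\<open>symp\<close> below), and conjugating \<open>u\<close> by \<open>x\<close> adds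
  \<open>\<omega>(w\<^sub>u, w\<^sub>x)\<close> to the central coordinate and changes nothing else. For a cocompact lattice let
  \<open>L\<close> be its projection to the vectors \<open>w\<close> and \<open>\<Lambda>\<close> its central part. An element with
  \<open>\<bar>w\<bar> \<le> r\<close> and \<open>\<bar>z\<bar> \<le> r\<^sup>2\<close> has word norm \<open>O(r)\<close> when \<open>r \<ge> 1\<close>, and conversely
  (\<open>word_norm_upper_bound\<close>, \<open>word_norm_lower_bound\<close>). Hence the question is this: given \<open>u\<close> in
  \<open>L\<close> of size \<open>n\<close> and \<open>z\<close> in \<open>\<omega>(u, L)\<close> of size \<open>n\<^sup>2\<close>, how large is the smallest \<open>w\<close> in \<open>L\<close>
  with \<open>\<omega>(u, w) = z\<close>?

  The smallest real solution has coordinates of modulus \<open>\<bar>z\<^sub>i\<bar> / \<bar>u\<^sub>i\<bar>\<close>, so what matters is how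
  small a nonzero coordinate of \<open>u\<close> can be. The decisive fact is that \<open>\<Lambda>\<close> and \<open>L\<close> are modules
  over a large ring: the vectors \<open>a\<close> of reals that preserve both under coordinatewise
  multiplication form a lattice in \<open>\<real>\<^sup>m\<close> (\<open>multipliers_rel_dense\<close>). For a nowhere vanishing \<open>g\<close> in
  \<open>L\<close> the real kernel of \<open>\<omega>(g, \<cdot>)\<close> is \<open>{a g}\<close>, which contains a lattice of elements of \<open>L\<close>
  because \<open>\<omega>(g, L)\<close> is discrete; and each \<open>a\<close> with \<open>a g\<close> in \<open>L\<close> maps \<open>\<omega>(g, L)\<close>, which has finite
  index in \<open>\<Lambda>\<close>, into \<open>\<Lambda>\<close>. So the ring is an order in a product of totally real number fields.
  Its idempotents partition the coordinates into blocks, one for each field. Minkowski's theorem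
  in a block with \<open>k\<close> coordinates shows that a nonzero coordinate of \<open>u\<close> in that block is at
  least of order \<open>n\<close> to the power \<open>-(k - 1)\<close>, and that this order is attained. With \<open>k\<close> the size
  of the largest block, the conjugator length function therefore grows like \<open>n\<close> to the power
  \<open>k + 1\<close> (\<open>short_conjugators\<close>, \<open>long_conjugators\<close>). This proves the first claim, as
  \<open>1 \<le> k \<le> m\<close>.

  Each \<open>k\<close> occurs: the polynomial \<open>x (x - 4) \<dots> (x - 4 (k - 1)) - 1\<close> is irreducible with \<open>k\<close> real roots, and
  the Heisenberg group over \<open>\<int>[x]\<close> modulo this polynomial, times \<open>m - k\<close> integral Heisenberg
  groups, is a cocompact lattice whose largest block has size \<open>k\<close>. Finally the estimate of
  the word norm makes a nearest point map between any two cocompact lattices a quasi-isometry, so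
  for \<open>m = 2\<close> a lattice of type \<open>n\<^sup>2\<close> and one of type \<open>n\<^sup>3\<close> are quasi-isometric.

  Lattices enter only through two properties: they are relatively dense, and
  their bounded parts are finite. Bases, determinants and covolumes are replaced by
  rounding a real vector to the lattice and by counting.
\<close>

section \<open>Relatively dense groups of vectors\<close>

text \<open>Vectors are functions on the natural numbers of which only the first \<open>m\<close> values matter,
  so that the dimension is an ordinary number. Elements of lattices are required to vanish
  beyond \<open>m\<close> (\<open>supported\<close>), which makes equality of lattice vectors a statement about \<open>m\<close>
  coordinates; the real vectors that are approximated by them may be arbitrary.\<close>

text \<open>Coordinatewise multiplication of a real vector with a real or complex one. It serves as the product of the ring
  of multipliers, as its action on lattices and, with a constant vector on the left, as multiplication by a scalar.\<close>

definition scale :: "(nat \<Rightarrow> real) \<Rightarrow> (nat \<Rightarrow> 'v::real_vector) \<Rightarrow> nat \<Rightarrow> 'v" (infixr \<open>\<star>\<close> 75)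
  where "a \<star> w = (\<lambda>i. a i *\<^sub>R w i)"

definition const_vec :: "'v \<Rightarrow> nat \<Rightarrow> 'v" where "const_vec c = (\<lambda>_. c)"

lemma const_vec_apply [simp]: "const_vec c i = c"
  by (simp add: const_vec_def)

definition supported :: "nat \<Rightarrow> (nat \<Rightarrow> 'v::zero) \<Rightarrow> bool"
  where "supported m v \<longleftrightarrow> (\<forall>i\<ge>m. v i = 0)"

definition bounded_by :: "nat \<Rightarrow> real \<Rightarrow> (nat \<Rightarrow> 'v::real_normed_vector) \<Rightarrow> bool"
  where "bounded_by m r v \<longleftrightarrow> (\<forall>i<m. norm (v i) \<le> r)"

definition add_subgroup :: "'g::ab_group_add set \<Rightarrow> bool"
  where "add_subgroup D \<longleftrightarrow> 0 \<in> D \<and> (\<forall>a\<in>D. \<forall>b\<in>D. a - b \<in> D)"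

definition rel_dense :: "nat \<Rightarrow> (nat \<Rightarrow> 'v::real_normed_vector) set \<Rightarrow> bool"
  where "rel_dense m D \<longleftrightarrow> (\<exists>R. \<forall>x. \<exists>d\<in>D. bounded_by m R (x - d))"

definition loc_finite :: "nat \<Rightarrow> (nat \<Rightarrow> 'v::real_normed_vector) set \<Rightarrow> bool"
  where "loc_finite m D \<longleftrightarrow> (\<forall>R. finite {d \<in> D. bounded_by m R d})"

lemma scale_apply [simp]: "(a \<star> w) i = a i *\<^sub>R w i"
  by (simp add: scale_def)

lemma scale_0_left [simp]: "0 \<star> w = 0"
  by (rule ext) simp

lemma scale_assoc: "a \<star> (b \<star> w) = (a \<star> b) \<star> w"
  by (rule ext) simp

lemma scale_diff_left: "(a - b) \<star> w = a \<star> w - b \<star> w"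
  by (rule ext) (simp add: algebra_simps)

lemma scale_diff_right: "a \<star> (v - w) = a \<star> v - a \<star> w"
  by (rule ext) (simp add: algebra_simps)

lemma supported_scale: "supported m a \<Longrightarrow> supported m (a \<star> w)"
  by (simp add: supported_def)

lemma supported_scale_right: "supported m w \<Longrightarrow> supported m (a \<star> w)"
  by (simp add: supported_def)

lemma supported_0: "supported m 0"
  by (simp add: supported_def)

lemma supported_diff: "supported m v \<Longrightarrow> supported m w \<Longrightarrow> supported m (v - w)"
  for v w :: "nat \<Rightarrow> 'v::group_add"
  by (simp add: supported_def)

lemma supported_eqI:
  assumes "supported m v" "supported m w" "\<And>i. i < m \<Longrightarrow> v i = w i"
  shows "v = w"
  using assms by (intro ext) (metis not_le supported_def)

lemma bounded_by_mono: "bounded_by m r v \<Longrightarrow> r \<le> s \<Longrightarrow> bounded_by m s v"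
  by (auto simp: bounded_by_def intro: order_trans)

lemma bounded_byD: "bounded_by m r v \<Longrightarrow> i < m \<Longrightarrow> norm (v i) \<le> r"
  by (simp add: bounded_by_def)

lemma bounded_by_add: "bounded_by m r v \<Longrightarrow> bounded_by m s w \<Longrightarrow> bounded_by m (r + s) (v + w)"
  by (auto simp: bounded_by_def intro: norm_triangle_mono)

lemma bounded_by_diff: "bounded_by m r v \<Longrightarrow> bounded_by m s w \<Longrightarrow> bounded_by m (r + s) (v - w)"
  unfolding bounded_by_def
  by (metis add_mono minus_apply norm_triangle_ineq4 order_trans)

lemma bounded_by_scale:
  assumes "bounded_by m r a" "bounded_by m s w" "0 \<le> r"
  shows "bounded_by m (r * s) (a \<star> w)"
  using assms by (auto simp: bounded_by_def intro!: mult_mono)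

lemma bounded_by_exists: "\<exists>r\<ge>1. bounded_by m r v"
proof -
  have "norm (v i) \<le> 1 + (\<Sum>j<m. norm (v j))" if "i < m" for i
    using member_le_sum[of i "{..<m}" "\<lambda>j. norm (v j)"] that by simp
  then show ?thesis
    by (intro exI[of _ "1 + (\<Sum>j<m. norm (v j))"]) (auto simp: bounded_by_def sum_nonneg)
qed

lemma add_subgroup_0: "add_subgroup D \<Longrightarrow> 0 \<in> D"
  and add_subgroup_diff: "add_subgroup D \<Longrightarrow> a \<in> D \<Longrightarrow> b \<in> D \<Longrightarrow> a - b \<in> D"
  by (auto simp: add_subgroup_def)

lemma add_subgroup_add: "add_subgroup D \<Longrightarrow> a \<in> D \<Longrightarrow> b \<in> D \<Longrightarrow> a + b \<in> D"
  unfolding add_subgroup_def by (metis diff_0 diff_minus_eq_add)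

lemma add_subgroup_multiple:
  assumes "add_subgroup D" "d \<in> D"
  shows "const_vec (real n) \<star> d \<in> D"
proof (induction n)
  case 0
  have "const_vec (real 0) \<star> d = 0" by (rule ext) simp
  then show ?case using add_subgroup_0[OF assms(1)] by metis
next
  case (Suc n)
  have "const_vec (real (Suc n)) \<star> d = const_vec (real n) \<star> d + d"
    by (rule ext) (simp add: algebra_simps)
  then show ?case using Suc assms add_subgroup_add by metis
qed

lemma add_subgroup_image:
  assumes "add_subgroup D" "\<And>a b. f (a - b) = f a - f b"
  shows "add_subgroup (f ` D)"
  unfolding add_subgroup_def
proof (intro conjI ballI)
  have "f 0 = 0" using assms(2)[of 0 0] by simp
  then show "0 \<in> f ` D" using imageI[OF add_subgroup_0[OF assms(1)], of f] by simp
  fix u v assume "u \<in> f ` D" "v \<in> f ` D"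
  then obtain a b where "a \<in> D" "b \<in> D" "u - v = f (a - b)" using assms(2) by force
  then show "u - v \<in> f ` D" using add_subgroup_diff[OF assms(1)] by simp
qed

lemma rel_denseE:
  assumes "rel_dense m D"
  obtains R where "R \<ge> 1" "\<And>x. \<exists>d\<in>D. bounded_by m R (x - d)"
proof -
  obtain R where R: "\<And>x. \<exists>d\<in>D. bounded_by m R (x - d)"
    using assms unfolding rel_dense_def by blast
  show thesis
  proof (rule that[of "max 1 R"])
    show "\<exists>d\<in>D. bounded_by m (max 1 R) (x - d)" for x
      using R[of x] by (meson bounded_by_mono max.cobounded2)
  qed simp
qed

lemma rel_dense_multiple:
  assumes "rel_dense m D" "M \<ge> (1::nat)" "\<And>d. d \<in> D \<Longrightarrow> const_vec (real M) \<star> d \<in> D'"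
  shows "rel_dense m D'"
proof -
  obtain R where R: "\<And>x. \<exists>d\<in>D. bounded_by m R (x - d)"
    using rel_denseE[OF assms(1)] by metis
  have "\<exists>d'\<in>D'. bounded_by m (real M * R) (x - d')" for x
  proof -
    obtain d where d: "d \<in> D" "bounded_by m R (const_vec (1 / real M) \<star> x - d)"
      using R by blast
    have "norm (x i - real M *\<^sub>R d i) \<le> real M * R" if "i < m" for i
    proof -
      have "x i - real M *\<^sub>R d i = real M *\<^sub>R ((const_vec (1 / real M) \<star> x - d) i)"
        using assms(2) by (simp add: algebra_simps)
      then show ?thesis
        using bounded_byD[OF d(2) that] by (simp add: mult_left_mono)
    qed
    then show ?thesis
      using assms(3)[OF d(1)] by (intro bexI) (auto simp: bounded_by_def)
  qed
  then show ?thesis unfolding rel_dense_def by blast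
qed

lemma loc_finite_subset: "loc_finite m D \<Longrightarrow> D' \<subseteq> D \<Longrightarrow> loc_finite m D'"
  unfolding loc_finite_def
proof
  fix R
  assume fin: "\<forall>R. finite {d \<in> D. bounded_by m R d}" and "D' \<subseteq> D"
  then have "{d \<in> D'. bounded_by m R d} \<subseteq> {d \<in> D. bounded_by m R d}" by blast
  then show "finite {d \<in> D'. bounded_by m R d}"
    using fin[THEN spec[where x = R]] by (rule finite_subset)
qed

lemma loc_finiteD: "loc_finite m D \<Longrightarrow> finite {d \<in> D. bounded_by m R d}"
  unfolding loc_finite_def by (erule allE[where x = R])

text \<open>The subgroup has finite index, so a fixed multiple of the whole group lies in it. Writing \<open>j d = d' +
  r\<close> with \<open>d'\<close> in the subgroup, the remainders \<open>r\<close> belong to a finite set; two remainders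
  agree for some \<open>j < j'\<close> up to the size of that set, and \<open>(j' - j) d\<close> is then in the subgroup.
  This replaces every argument that would compare ranks of lattices.\<close>

lemma finite_index_multiple:
  fixes D D' :: "(nat \<Rightarrow> 'v::real_normed_vector) set"
  assumes D: "add_subgroup D" "loc_finite m D"
    and D': "add_subgroup D'" "D' \<subseteq> D"
    and close: "\<And>d. d \<in> D \<Longrightarrow> \<exists>d'\<in>D'. bounded_by m R (d - d')"
  obtains M :: nat where "M \<ge> 1" "\<And>d. d \<in> D \<Longrightarrow> const_vec (real M) \<star> d \<in> D'"
proof -
  define \<Phi> where "\<Phi> = {d \<in> D. bounded_by m R d}"
  have fin: "finite \<Phi>" unfolding \<Phi>_def by (rule loc_finiteD[OF D(2)])
  have "const_vec (real (fact (card \<Phi>))) \<star> d \<in> D'" if d: "d \<in> D" for d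
  proof -
    define f where "f j = (SOME d'. d' \<in> D' \<and> bounded_by m R (const_vec (real j) \<star> d - d'))" for j
    have f: "f j \<in> D'" "bounded_by m R (const_vec (real j) \<star> d - f j)" for j
      using someI_ex[OF close[OF add_subgroup_multiple[OF D(1) d], unfolded Bex_def]]
      unfolding f_def by (rule conjunct1, rule conjunct2)
    define r where "r j = const_vec (real j) \<star> d - f j" for j
    have "r j \<in> \<Phi>" for j
    proof -
      have "r j \<in> D"
        unfolding r_def using f(1)[of j] D'(2)
        by (intro add_subgroup_diff[OF D(1)] add_subgroup_multiple[OF D(1) d]) auto
      then show ?thesis using f(2)[of j] unfolding \<Phi>_def r_def by blast
    qed
    then have "r ` {..card \<Phi>} \<subseteq> \<Phi>" by blast
    then have "card (r ` {..card \<Phi>}) < card {..card \<Phi>}"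
      using card_mono[OF fin] by (metis card_atMost le_imp_less_Suc)
    then have "\<not> inj_on r {..card \<Phi>}" by (rule pigeonhole)
    then obtain j j' where jj: "j \<le> card \<Phi>" "j' \<le> card \<Phi>" "j < j'" "r j = r j'"
      unfolding inj_on_def by (metis atMost_iff linorder_neqE_nat)
    have "const_vec (real (j' - j)) \<star> d = f j' - f j"
    proof
      fix i
      have "real j *\<^sub>R d i - f j i = real j' *\<^sub>R d i - f j' i"
        using fun_cong[OF jj(4), of i] by (simp add: r_def)
      then show "(const_vec (real (j' - j)) \<star> d) i = (f j' - f j) i"
        using jj(3) by (simp add: of_nat_diff algebra_simps)
    qed
    then have in_D': "const_vec (real (j' - j)) \<star> d \<in> D'"
      using f D'(1) by (simp add: add_subgroup_diff)
    have "(j' - j) dvd fact (card \<Phi>)"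
      using jj by (intro dvd_fact) auto
    then obtain q where q: "fact (card \<Phi>) = (j' - j) * q" by (auto elim: dvdE)
    have "const_vec (real (fact (card \<Phi>))) \<star> d
        = const_vec (real q) \<star> (const_vec (real (j' - j)) \<star> d)"
      unfolding q by (rule ext) (simp add: mult.commute)
    then show ?thesis using add_subgroup_multiple[OF D'(1) in_D', of q] by (simp only:)
  qed
  then show thesis using that[of "fact (card \<Phi>)"] fact_ge_1 by blast
qed

text \<open>Rounding the coordinates down to multiples of \<open>\<epsilon>\<close> is injective on the group, as two vectors
  with the same value differ by less than \<open>\<epsilon>\<close> in each coordinate.\<close>

lemma loc_finite_real:
  fixes D :: "(nat \<Rightarrow> real) set"
  assumes D: "add_subgroup D" "\<And>d. d \<in> D \<Longrightarrow> supported m d"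
    and eps: "\<epsilon> > 0" "\<And>d. d \<in> D \<Longrightarrow> (\<And>i. i < m \<Longrightarrow> \<bar>d i\<bar> < \<epsilon>) \<Longrightarrow> d = 0"
  shows "loc_finite m D"
  unfolding loc_finite_def
proof
  fix R
  define f where "f d = (\<lambda>i\<in>{..<m}. \<lfloor>d i / \<epsilon>\<rfloor>)" for d :: "nat \<Rightarrow> real"
  have "inj_on f {d \<in> D. bounded_by m R d}"
  proof (rule inj_onI)
    fix d d' assume d: "d \<in> {d \<in> D. bounded_by m R d}" "d' \<in> {d \<in> D. bounded_by m R d}"
      and eq: "f d = f d'"
    have "\<bar>(d - d') i\<bar> < \<epsilon>" if "i < m" for i
    proof -
      have "\<lfloor>d i / \<epsilon>\<rfloor> = \<lfloor>d' i / \<epsilon>\<rfloor>"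
        using fun_cong[OF eq, of i] that by (simp add: f_def)
      then have "\<bar>d i / \<epsilon> - d' i / \<epsilon>\<bar> < 1" by linarith
      then have "\<bar>(d - d') i / \<epsilon>\<bar> < 1" by (simp add: diff_divide_distrib)
      then show ?thesis using eps(1) by (simp add: abs_divide)
    qed
    then have "d - d' = 0" using d D(1) by (intro eps(2)) (auto simp: add_subgroup_def)
    then show "d = d'" by simp
  qed
  moreover have "f ` {d \<in> D. bounded_by m R d} \<subseteq> (\<Pi>\<^sub>E i\<in>{..<m}. {\<lfloor>- R / \<epsilon>\<rfloor>..\<lfloor>R / \<epsilon>\<rfloor>})"
  proof -
    have "\<lfloor>- R / \<epsilon>\<rfloor> \<le> \<lfloor>d i / \<epsilon>\<rfloor> \<and> \<lfloor>d i / \<epsilon>\<rfloor> \<le> \<lfloor>R / \<epsilon>\<rfloor>" if "bounded_by m R d" "i < m" for d i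
    proof -
      have "\<bar>d i\<bar> \<le> R" using bounded_byD[OF that] by simp
      then have "- R \<le> d i" "d i \<le> R" by auto
      then show ?thesis using eps(1) by (intro conjI floor_mono divide_right_mono) auto
    qed
    then show ?thesis by (auto simp: f_def)
  qed
  ultimately show "finite {d \<in> D. bounded_by m R d}"
    by (meson finite_PiE finite_atLeastAtMost_int finite_imageD finite_lessThan finite_subset)
qed

section \<open>The symplectic form and the ring of multipliers\<close>

definition symp :: "(nat \<Rightarrow> complex) \<Rightarrow> (nat \<Rightarrow> complex) \<Rightarrow> nat \<Rightarrow> real"
  where "symp u v = (\<lambda>i. Im (cnj (u i) * v i))"

lemma symp_apply: "symp u v i = Im (cnj (u i) * v i)"
  by (simp add: symp_def)

lemma symp_diff_right: "symp u (v - w) = symp u v - symp u w"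
  by (rule ext) (simp add: symp_apply algebra_simps)

lemma symp_diff_left: "symp (u - v) w = symp u w - symp v w"
  by (rule ext) (simp add: symp_apply algebra_simps)

lemma symp_scale_left: "symp (a \<star> u) v = a \<star> symp u v"
  by (rule ext) (simp add: symp_apply algebra_simps)

lemma symp_scale_right: "symp u (a \<star> v) = a \<star> symp u v"
  by (rule ext) (simp add: symp_apply algebra_simps)

lemma norm_symp_le: "\<bar>symp u v i\<bar> \<le> cmod (u i) * cmod (v i)"
  unfolding symp_apply by (metis abs_Im_le_cmod complex_mod_cnj norm_mult)

lemma bounded_by_symp:
  assumes "bounded_by m r u" "bounded_by m s v" "0 \<le> r"
  shows "bounded_by m (r * s) (symp u v)"
  unfolding bounded_by_def
proof (intro allI impI)
  fix i assume "i < m"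
  have "norm (symp u v i) \<le> cmod (u i) * cmod (v i)" using norm_symp_le by simp
  also have "\<dots> \<le> r * s"
    using bounded_byD[OF assms(1) \<open>i < m\<close>] bounded_byD[OF assms(2) \<open>i < m\<close>] assms(3)
    by (intro mult_mono) auto
  finally show "norm (symp u v i) \<le> r * s" .
qed

text \<open>The shortest real solution \<open>w\<close> of \<open>\<omega>(u, w) = t\<close> in one coordinate.\<close>

lemma Im_cnj_mult_ii:
  assumes "u \<noteq> 0"
  shows "Im (cnj u * (\<i> * of_real t / cnj u)) = t" "cmod (\<i> * of_real t / cnj u) = \<bar>t\<bar> / cmod u"
  using assms by (simp_all add: norm_divide norm_mult)

lemma Im_cnj_mult_0_imp_real_multiple:
  assumes "u \<noteq> 0" "Im (cnj u * v) = 0"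
  shows "v = Re (v / u) *\<^sub>R u"
proof -
  have "Im (v / u) = 0"
    using assms by (simp add: complex_div_cnj[of v u] mult.commute)
  then have "v / u = of_real (Re (v / u))" by (simp add: complex_eq_iff)
  then show ?thesis using assms(1) by (simp add: scaleR_conv_of_real field_simps)
qed

text \<open>Two complex numbers that are independent over the reals detect every third one through the symplectic
  form.\<close>

lemma frame_nondegenerate:
  assumes "Im (cnj d * b) = 0" "Im (cnj d * b') = 0" "Im (cnj b * b') \<noteq> 0"
  shows "d = 0"
proof -
  have 1: "Re d * Im b = Im d * Re b" "Re d * Im b' = Im d * Re b'"
    and 3: "Re b * Im b' - Im b * Re b' \<noteq> 0"
    using assms by (auto simp: algebra_simps)
  have "Re d * (Re b * Im b' - Im b * Re b') = Re b * (Re d * Im b') - Re b' * (Re d * Im b)"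
    "Im d * (Re b * Im b' - Im b * Re b') = Im b' * (Im d * Re b) - Im b * (Im d * Re b')"
    by (simp_all add: algebra_simps)
  then have "Re d * (Re b * Im b' - Im b * Re b') = Re b * (Im d * Re b') - Re b' * (Im d * Re b)"
    "Im d * (Re b * Im b' - Im b * Re b') = Im b' * (Re d * Im b) - Im b * (Re d * Im b')"
    unfolding 1 by simp_all
  then have "Re d * (Re b * Im b' - Im b * Re b') = 0" "Im d * (Re b * Im b' - Im b * Re b') = 0"
    by (simp_all only: mult_ac diff_self)
  then show ?thesis using 3 by (simp add: complex_eq_iff)
qed

lemma frame_coordinates:
  fixes w b b' :: complex
  assumes "Im (cnj b * b') \<noteq> 0"
  defines "\<Delta> \<equiv> Im (cnj b * b')"
  shows "w = (Im (cnj w * b') / \<Delta>) *\<^sub>R b + (Im (cnj b * w) / \<Delta>) *\<^sub>R b'"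
proof -
  have "\<Delta> *\<^sub>R w = Im (cnj w * b') *\<^sub>R b + Im (cnj b * w) *\<^sub>R b'"
    by (simp add: \<Delta>_def complex_eq_iff algebra_simps)
  then have "w = (1 / \<Delta>) *\<^sub>R (Im (cnj w * b') *\<^sub>R b + Im (cnj b * w) *\<^sub>R b')"
    using assms by (metis divide_self_if divideR_right scaleR_one scaleR_scaleR times_divide_eq_left mult_1)
  then show ?thesis by (simp add: scaleR_add_right)
qed

text \<open>The abstract situation: \<open>L\<close> is the projection of a Heisenberg lattice and \<open>\<Lambda>\<close>
  its centre. Closure under the symplectic form makes \<open>L\<close> discrete and \<open>\<Lambda>\<close> relatively
  dense.\<close>

locale lattice_pair =
  fixes m :: nat and L :: "(nat \<Rightarrow> complex) set" and \<Lambda> :: "(nat \<Rightarrow> real) set"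
  assumes L_subgroup: "add_subgroup L" and L_supported: "\<And>w. w \<in> L \<Longrightarrow> supported m w"
    and \<Lambda>_subgroup: "add_subgroup \<Lambda>" and \<Lambda>_supported: "\<And>z. z \<in> \<Lambda> \<Longrightarrow> supported m z"
    and symp_closed: "\<And>u v. u \<in> L \<Longrightarrow> v \<in> L \<Longrightarrow> symp u v \<in> \<Lambda>"
    and L_rel_dense: "rel_dense m L" and \<Lambda>_loc_finite: "loc_finite m \<Lambda>"
begin

text \<open>Lattice vectors near \<open>(3R, \<dots>, 3R)\<close> and \<open>(3R\<i>, \<dots>, 3R\<i>)\<close> are
  independent over the reals in each coordinate when \<open>R\<close> is the radius of approximation. Such a pair stands in
  for generic elements of \<open>L\<close>.\<close>

lemma frame_exists: "\<exists>b b'. b \<in> L \<and> b' \<in> L \<and> (\<forall>i<m. symp b b' i \<noteq> 0)"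
proof -
  obtain R where R: "R \<ge> 1" "\<And>x. \<exists>d\<in>L. bounded_by m R (x - d)"
    using rel_denseE[OF L_rel_dense] by blast
  obtain b where b: "b \<in> L" "bounded_by m R (const_vec (of_real (3 * R)) - b)"
    using R(2) by blast
  obtain b' where b': "b' \<in> L" "bounded_by m R (const_vec (\<i> * of_real (3 * R)) - b')"
    using R(2) by blast
  have "symp b b' i \<noteq> 0" if "i < m" for i
  proof -
    have n: "cmod (of_real (3 * R) - b i) \<le> R" "cmod (\<i> * of_real (3 * R) - b' i) \<le> R"
      using bounded_byD[OF b(2) that] bounded_byD[OF b'(2) that] by simp_all
    have re: "\<bar>3 * R - Re (b i)\<bar> \<le> R" "\<bar>Im (b i)\<bar> \<le> R"
      using abs_Re_le_cmod[of "of_real (3 * R) - b i"] abs_Im_le_cmod[of "of_real (3 * R) - b i"] n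
      by simp_all
    have im: "\<bar>3 * R - Im (b' i)\<bar> \<le> R" "\<bar>Re (b' i)\<bar> \<le> R"
      using abs_Re_le_cmod[of "\<i> * of_real (3 * R) - b' i"]
        abs_Im_le_cmod[of "\<i> * of_real (3 * R) - b' i"] n by simp_all
    have "(2 * R) * (2 * R) \<le> Re (b i) * Im (b' i)"
      using re im R(1) by (intro mult_mono) auto
    moreover have "\<bar>Im (b i) * Re (b' i)\<bar> \<le> R * R"
      unfolding abs_mult using re im R(1) by (intro mult_mono) auto
    moreover have "R * R > 0" using R(1) by simp
    ultimately have "Re (b i) * Im (b' i) - Im (b i) * Re (b' i) > 0" by linarith
    then show ?thesis by (simp add: symp_apply)
  qed
  then show ?thesis using b b' by blast
qed

definition b1 :: "nat \<Rightarrow> complex"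
  where "b1 = (SOME b. \<exists>b'. b \<in> L \<and> b' \<in> L \<and> (\<forall>i<m. symp b b' i \<noteq> 0))"

definition b2 :: "nat \<Rightarrow> complex"
  where "b2 = (SOME b'. b1 \<in> L \<and> b' \<in> L \<and> (\<forall>i<m. symp b1 b' i \<noteq> 0))"

lemma frame: "b1 \<in> L" "b2 \<in> L" "i < m \<Longrightarrow> symp b1 b2 i \<noteq> 0"
proof -
  have "\<exists>b'. b1 \<in> L \<and> b' \<in> L \<and> (\<forall>i<m. symp b1 b' i \<noteq> 0)"
    using someI_ex[OF frame_exists] unfolding b1_def .
  then have "b1 \<in> L \<and> b2 \<in> L \<and> (\<forall>i<m. symp b1 b2 i \<noteq> 0)"
    unfolding b2_def by (rule someI_ex)
  then show "b1 \<in> L" "b2 \<in> L" "i < m \<Longrightarrow> symp b1 b2 i \<noteq> 0" by blast+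
qed

lemma frame_nonzero: "\<forall>i<m. b1 i \<noteq> 0" "\<forall>i<m. b2 i \<noteq> 0"
  using frame(3) unfolding symp_apply by force+

text \<open>A bounded \<open>w\<close> is determined by the pair \<open>\<omega>(w, b1)\<close>, \<open>\<omega>(w,
  b2)\<close> of bounded elements of \<open>\<Lambda>\<close>, of which there are finitely many.\<close>

lemma L_loc_finite: "loc_finite m L"
  unfolding loc_finite_def
proof
  fix R
  obtain s1 where s1: "bounded_by m s1 b1" using bounded_by_exists by blast
  obtain s2 where s2: "bounded_by m s2 b2" using bounded_by_exists by blast
  define B where "B s = {z \<in> \<Lambda>. bounded_by m (max 0 R * s) z}" for s
  define f where "f w = (symp w b1, symp w b2)" for w
  have "inj_on f {w \<in> L. bounded_by m R w}"
  proof (rule inj_onI)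
    fix w w' assume w: "w \<in> {w \<in> L. bounded_by m R w}" "w' \<in> {w \<in> L. bounded_by m R w}"
      and eq: "f w = f w'"
    have "symp (w - w') b1 = 0" "symp (w - w') b2 = 0"
      using eq by (simp_all add: f_def symp_diff_left)
    then have "(w - w') i = 0" if "i < m" for i
      using frame(3)[OF that] frame_nondegenerate[of "(w - w') i" "b1 i" "b2 i"]
      by (metis symp_apply zero_fun_apply)
    then show "w = w'"
      using w L_supported by (intro supported_eqI[of m]) auto
  qed
  moreover have "f ` {w \<in> L. bounded_by m R w} \<subseteq> B s1 \<times> B s2"
  proof
    fix p assume "p \<in> f ` {w \<in> L. bounded_by m R w}"
    then obtain w where w: "w \<in> L" "bounded_by m R w" "p = f w" by blast
    have w0: "bounded_by m (max 0 R) w" using w(2) by (rule bounded_by_mono) simp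
    have "symp w b1 \<in> B s1" "symp w b2 \<in> B s2"
      unfolding B_def
      using bounded_by_symp[OF w0 s1] bounded_by_symp[OF w0 s2] symp_closed w(1) frame by simp_all
    then show "p \<in> B s1 \<times> B s2" by (simp add: w(3) f_def)
  qed
  moreover have "finite (B s1 \<times> B s2)"
    unfolding B_def by (intro finite_cartesian_product loc_finiteD[OF \<Lambda>_loc_finite])
  ultimately show "finite {w \<in> L. bounded_by m R w}"
    by (rule inj_on_finite)
qed

lemma symp_solve:
  assumes g: "\<forall>i<m. g i \<noteq> 0"
  shows "\<exists>w. \<forall>i<m. symp g w i = z i"
proof (intro exI allI impI)
  show "symp g (\<lambda>i. \<i> * of_real (z i) / cnj (g i)) i = z i" if "i < m" for i
    using Im_cnj_mult_ii g that by (simp add: symp_apply)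
qed

text \<open>Over the reals \<open>\<omega>(g, \<cdot>)\<close> is onto; rounding a real solution to \<open>L\<close> changes
  the value by a bounded amount.\<close>

lemma symp_image_close:
  assumes g: "g \<in> L" "\<forall>i<m. g i \<noteq> 0"
  obtains R where "\<And>z. \<exists>w\<in>L. bounded_by m R (z - symp g w)"
proof -
  obtain R where R: "R \<ge> 1" "\<And>x. \<exists>d\<in>L. bounded_by m R (x - d)"
    using rel_denseE[OF L_rel_dense] by blast
  obtain s where s: "s \<ge> 1" "bounded_by m s g" using bounded_by_exists by blast
  have "\<exists>w\<in>L. bounded_by m (s * R) (z - symp g w)" for z
  proof -
    obtain x where x: "\<forall>i<m. symp g x i = z i" using symp_solve[OF g(2), of z] ..
    obtain w where w: "w \<in> L" "bounded_by m R (x - w)" using R(2) by blast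
    have "bounded_by m (s * R) (symp g (x - w))"
      using bounded_by_symp[OF s(2) w(2)] s(1) by simp
    then have "bounded_by m (s * R) (z - symp g w)"
      using x by (simp add: bounded_by_def symp_diff_right)
    then show ?thesis using w(1) by blast
  qed
  then show thesis by (rule that)
qed

lemma \<Lambda>_rel_dense: "rel_dense m \<Lambda>"
proof -
  obtain R where R: "\<And>z. \<exists>w\<in>L. bounded_by m R (z - symp b1 w)"
    using symp_image_close[OF frame(1) frame_nonzero(1)] by blast
  have "\<exists>d\<in>\<Lambda>. bounded_by m R (x - d)" for x
    using R[of x] symp_closed[OF frame(1)] by blast
  then show ?thesis unfolding rel_dense_def by blast
qed

lemma add_subgroup_symp_image: "add_subgroup (symp g ` L)"
  by (rule add_subgroup_image[where f = "symp g", OF L_subgroup symp_diff_right])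

lemma symp_image_index:
  assumes g: "g \<in> L" "\<forall>i<m. g i \<noteq> 0"
  obtains M :: nat where "M \<ge> 1" "\<And>z. z \<in> \<Lambda> \<Longrightarrow> const_vec (real M) \<star> z \<in> symp g ` L"
proof -
  obtain R where R: "\<And>z. \<exists>w\<in>L. bounded_by m R (z - symp g w)"
    using symp_image_close[OF g] by blast
  have close: "\<exists>d'\<in>symp g ` L. bounded_by m R (d - d')" if "d \<in> \<Lambda>" for d
    using R[of d] by blast
  have sub: "symp g ` L \<subseteq> \<Lambda>" using symp_closed[OF g(1)] by blast
  show thesis
    using finite_index_multiple[OF \<Lambda>_subgroup \<Lambda>_loc_finite add_subgroup_symp_image sub close]
      that by blast
qed

definition line_mult :: "(nat \<Rightarrow> complex) \<Rightarrow> (nat \<Rightarrow> real) set"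
  where "line_mult g = {a. supported m a \<and> a \<star> g \<in> L}"

definition center_mult :: "(nat \<Rightarrow> real) set"
  where "center_mult = {a. supported m a \<and> (\<forall>z\<in>\<Lambda>. a \<star> z \<in> \<Lambda>)}"

definition multipliers :: "(nat \<Rightarrow> real) set"
  where "multipliers = {a. supported m a \<and> (\<forall>z\<in>\<Lambda>. a \<star> z \<in> \<Lambda>) \<and> (\<forall>w\<in>L. a \<star> w \<in> L)}"

text \<open>The real kernel of \<open>\<omega>(g, \<cdot>)\<close> consists of the real multiples \<open>x g\<close>. A
  lattice vector near \<open>x g\<close> has a bounded value under \<open>\<omega>(g, \<cdot>)\<close>, hence one of finitely
  many; subtracting a fixed lattice vector with the same value gives a lattice vector in the kernel that is still near
  \<open>x g\<close>.\<close>

lemma line_mult_rel_dense: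
  assumes g: "g \<in> L" "\<forall>i<m. g i \<noteq> 0"
  shows "rel_dense m (line_mult g)"
proof -
  obtain R where R: "R \<ge> 1" "\<And>x. \<exists>d\<in>L. bounded_by m R (x - d)"
    using rel_denseE[OF L_rel_dense] by blast
  obtain s where s: "s \<ge> 1" "bounded_by m s g" using bounded_by_exists by blast
  obtain t where t: "t \<ge> 1" "bounded_by m t (\<lambda>i. 1 / cmod (g i))" using bounded_by_exists by blast
  define \<Phi> where "\<Phi> = {z \<in> \<Lambda>. bounded_by m (s * R) z}"
  have fin: "finite \<Phi>" unfolding \<Phi>_def by (rule loc_finiteD[OF \<Lambda>_loc_finite])
  define p where "p z = (SOME w. w \<in> L \<and> symp g w = z)" for z
  have p: "p (symp g w) \<in> L" "symp g (p (symp g w)) = symp g w" if "w \<in> L" for w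
  proof -
    have "p (symp g w) \<in> L \<and> symp g (p (symp g w)) = symp g w"
      unfolding p_def by (rule someI[of _ w]) (use that in simp)
    then show "p (symp g w) \<in> L" "symp g (p (symp g w)) = symp g w" by auto
  qed
  define K where "K = (\<Sum>z\<in>\<Phi>. (\<Sum>i<m. cmod (p z i)))"
  have K: "bounded_by m K (p z)" if "z \<in> \<Phi>" for z
    unfolding bounded_by_def
  proof (intro allI impI)
    fix i assume "i < m"
    have "cmod (p z i) \<le> (\<Sum>i<m. cmod (p z i))"
      using \<open>i < m\<close> by (intro member_le_sum) auto
    also have "\<dots> \<le> K" unfolding K_def
      using that fin by (intro member_le_sum) (auto intro: sum_nonneg)
    finally show "cmod (p z i) \<le> K" .
  qed
  have "\<exists>a\<in>line_mult g. bounded_by m ((R + K) * t) (x - a)" for x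
  proof -
    obtain w where w: "w \<in> L" "bounded_by m R (x \<star> g - w)" using R(2) by blast
    have "symp g (x \<star> g) = 0"
      unfolding symp_scale_right by (rule ext) (simp add: symp_apply)
    then have "symp g w = 0 - symp g (x \<star> g - w)"
      by (simp add: symp_diff_right)
    moreover have "bounded_by m (s * R) (symp g (x \<star> g - w))"
      using bounded_by_symp[OF s(2) w(2)] s(1) by simp
    ultimately have "bounded_by m (s * R) (symp g w)"
      by (simp add: bounded_by_def)
    then have in_\<Phi>: "symp g w \<in> \<Phi>" unfolding \<Phi>_def using symp_closed[OF g(1) w(1)] by blast
    define w' where "w' = w - p (symp g w)"
    have w'L: "w' \<in> L" unfolding w'_def using p(1)[OF w(1)] w(1) L_subgroup by (intro add_subgroup_diff)
    have "symp g w' = 0"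
      using p(2)[OF w(1)] by (simp add: w'_def symp_diff_right)
    then have ker: "Im (cnj (g i) * w' i) = 0" for i by (metis symp_apply zero_fun_apply)
    define a where "a = (\<lambda>i. if i < m then Re (w' i / g i) else 0)"
    have ag: "a \<star> g = w'"
    proof (rule supported_eqI[of m])
      show "supported m (a \<star> g)" by (simp add: a_def supported_def)
      show "supported m w'" using w'L by (rule L_supported)
      show "(a \<star> g) i = w' i" if "i < m" for i
        using Im_cnj_mult_0_imp_real_multiple[OF _ ker] g(2) that by (simp add: a_def)
    qed
    then have "a \<in> line_mult g" using w'L by (simp add: line_mult_def a_def supported_def)
    moreover have "bounded_by m ((R + K) * t) (x - a)"
      unfolding bounded_by_def
    proof (intro allI impI)
      fix i assume i: "i < m"
      have "(x - a) i *\<^sub>R g i = (x \<star> g - w) i + p (symp g w) i"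
        using fun_cong[OF ag, of i] by (simp add: w'_def algebra_simps)
      then have "\<bar>(x - a) i\<bar> * cmod (g i) \<le> R + K"
        using bounded_byD[OF w(2) i] bounded_byD[OF K[OF in_\<Phi>] i]
        by (metis norm_scaleR norm_triangle_mono)
      then have "\<bar>(x - a) i\<bar> \<le> (R + K) * (1 / cmod (g i))"
        using g(2) i by (simp add: field_simps)
      also have "\<dots> \<le> (R + K) * t"
      proof (rule mult_left_mono)
        show "1 / cmod (g i) \<le> t" using bounded_byD[OF t(2) i] by simp
        have "0 \<le> K" unfolding K_def by (intro sum_nonneg) simp
        then show "0 \<le> R + K" using R(1) by simp
      qed
      finally show "norm ((x - a) i) \<le> (R + K) * t" by simp
    qed
    ultimately show ?thesis by blast
  qed
  then show ?thesis unfolding rel_dense_def by blast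
qed

text \<open>From \<open>a \<omega>(g, v) = \<omega>(a g, v)\<close> it follows that \<open>a\<close> maps \<open>\<omega>(g,
  L)\<close>, a subgroup of finite index in \<open>\<Lambda>\<close>, into \<open>\<Lambda>\<close>.\<close>

lemma line_mult_subset_center_mult:
  assumes g: "g \<in> L" "\<forall>i<m. g i \<noteq> 0"
  obtains M :: nat where "M \<ge> 1" "\<And>a. a \<in> line_mult g \<Longrightarrow> const_vec (real M) \<star> a \<in> center_mult"
proof -
  obtain M :: nat where M: "M \<ge> 1" "\<And>z. z \<in> \<Lambda> \<Longrightarrow> const_vec (real M) \<star> z \<in> symp g ` L"
    using symp_image_index[OF g] by blast
  have "const_vec (real M) \<star> a \<in> center_mult" if a: "a \<in> line_mult g" for a
  proof -
    have a': "supported m a" "a \<star> g \<in> L" using a by (auto simp: line_mult_def)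
    have "(const_vec (real M) \<star> a) \<star> z \<in> \<Lambda>" if z: "z \<in> \<Lambda>" for z
    proof -
      obtain v where v: "v \<in> L" "const_vec (real M) \<star> z = symp g v" using M(2)[OF z] by blast
      have "(const_vec (real M) \<star> a) \<star> z = a \<star> (const_vec (real M) \<star> z)"
        by (rule ext) simp
      also have "\<dots> = symp (a \<star> g) v" unfolding v(2) symp_scale_left ..
      finally show ?thesis using symp_closed[OF a'(2) v(1)] by metis
    qed
    then show ?thesis using supported_scale_right[OF a'(1)] by (simp add: center_mult_def)
  qed
  then show thesis using that M(1) by blast
qed

lemma add_subgroup_line_mult: "g \<in> L \<Longrightarrow> add_subgroup (line_mult g)"
  unfolding add_subgroup_def line_mult_def
  by (auto simp: scale_diff_left supported_diff supported_0 add_subgroup_0[OF L_subgroup]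
      intro: add_subgroup_diff[OF L_subgroup])

lemma add_subgroup_center_mult: "add_subgroup center_mult"
  unfolding add_subgroup_def center_mult_def
  by (auto simp: scale_diff_left supported_diff supported_0 add_subgroup_0[OF \<Lambda>_subgroup]
      intro: add_subgroup_diff[OF \<Lambda>_subgroup])

lemma center_mult_rel_dense: "rel_dense m center_mult"
proof -
  obtain M :: nat where "M \<ge> 1" "\<And>a. a \<in> line_mult b1 \<Longrightarrow> const_vec (real M) \<star> a \<in> center_mult"
    using line_mult_subset_center_mult[OF frame(1) frame_nonzero(1)] by blast
  then show ?thesis using rel_dense_multiple[OF line_mult_rel_dense[OF frame(1) frame_nonzero(1)]] by blast
qed

lemma center_mult_loc_finite: "loc_finite m center_mult"
  unfolding loc_finite_def
proof
  fix R
  define l where "l = symp b1 b2"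
  have l: "l \<in> \<Lambda>" "\<And>i. i < m \<Longrightarrow> l i \<noteq> 0" using symp_closed frame by (auto simp: l_def)
  obtain s where s: "s \<ge> 1" "bounded_by m s l" using bounded_by_exists by blast
  have "inj_on (\<lambda>a. a \<star> l) {a \<in> center_mult. bounded_by m R a}"
  proof (rule inj_onI)
    fix a a' assume a: "a \<in> {a \<in> center_mult. bounded_by m R a}"
      "a' \<in> {a \<in> center_mult. bounded_by m R a}" and eq: "a \<star> l = a' \<star> l"
    have "a i = a' i" if "i < m" for i
      using fun_cong[OF eq, of i] l(2)[OF that] by simp
    then show "a = a'" using a by (intro supported_eqI[of m]) (auto simp: center_mult_def)
  qed
  moreover have "(\<lambda>a. a \<star> l) ` {a \<in> center_mult. bounded_by m R a} \<subseteq>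
      {z \<in> \<Lambda>. bounded_by m (max 0 R * s) z}"
  proof
    fix p assume "p \<in> (\<lambda>a. a \<star> l) ` {a \<in> center_mult. bounded_by m R a}"
    then obtain a where a: "a \<in> center_mult" "bounded_by m R a" "p = a \<star> l" by blast
    have "bounded_by m (max 0 R) a" using a(2) by (rule bounded_by_mono) simp
    then have "bounded_by m (max 0 R * s) p" unfolding a(3) using s by (intro bounded_by_scale) auto
    moreover have "p \<in> \<Lambda>" using a(1,3) l(1) by (simp add: center_mult_def)
    ultimately show "p \<in> {z \<in> \<Lambda>. bounded_by m (max 0 R * s) z}" by blast
  qed
  moreover have "finite {z \<in> \<Lambda>. bounded_by m (max 0 R * s) z}"
    by (rule loc_finiteD[OF \<Lambda>_loc_finite])
  ultimately show "finite {a \<in> center_mult. bounded_by m R a}"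
    by (rule inj_on_finite)
qed

lemma center_mult_mult: "a \<in> center_mult \<Longrightarrow> a' \<in> center_mult \<Longrightarrow> a \<star> a' \<in> center_mult"
  by (auto simp: center_mult_def scale_assoc[symmetric] supported_scale)

text \<open>Both groups are lattices in the same real space, and up to a multiple one contains the other; so they are
  commensurable.\<close>

lemma center_mult_multiple_line_mult:
  assumes g: "g \<in> L" "\<forall>i<m. g i \<noteq> 0"
  obtains M :: nat where "M \<ge> 1" "\<And>a. a \<in> center_mult \<Longrightarrow> const_vec (real M) \<star> a \<in> line_mult g"
proof -
  obtain N :: nat where N: "N \<ge> 1" "\<And>a. a \<in> line_mult g \<Longrightarrow> const_vec (real N) \<star> a \<in> center_mult"
    using line_mult_subset_center_mult[OF g] by blast
  have sub: "add_subgroup (line_mult g \<inter> center_mult)"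
    using add_subgroup_line_mult[OF g(1)] add_subgroup_center_mult by (auto simp: add_subgroup_def)
  have "rel_dense m (line_mult g \<inter> center_mult)"
    using N add_subgroup_multiple[OF add_subgroup_line_mult[OF g(1)]]
    by (intro rel_dense_multiple[OF line_mult_rel_dense[OF g] N(1)]) blast
  then obtain R where R: "\<And>x. \<exists>a\<in>line_mult g \<inter> center_mult. bounded_by m R (x - a)"
    using rel_denseE by metis
  obtain M :: nat where "M \<ge> 1" "\<And>a. a \<in> center_mult \<Longrightarrow> const_vec (real M) \<star> a \<in> line_mult g \<inter> center_mult"
    using finite_index_multiple[OF add_subgroup_center_mult center_mult_loc_finite sub _ R] by blast
  then show thesis using that by blast
qed

text \<open>Up to multiples, \<open>a b1\<close> and \<open>a b2\<close> are in \<open>L\<close> for each \<open>a\<close>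
  that preserves \<open>\<Lambda>\<close>. The sums of such vectors form a module over the ring of these \<open>a\<close> of
  finite index in \<open>L\<close>; since the module is preserved by \<open>a\<close>, a multiple of \<open>a\<close>
  preserves \<open>L\<close>.\<close>

lemma center_mult_multiple_multipliers:
  obtains M :: nat where "M \<ge> 1" "\<And>a. a \<in> center_mult \<Longrightarrow> const_vec (real M) \<star> a \<in> multipliers"
proof -
  obtain M1 :: nat where M1: "M1 \<ge> 1" "\<And>a. a \<in> center_mult \<Longrightarrow> const_vec (real M1) \<star> a \<in> line_mult b1"
    using center_mult_multiple_line_mult[OF frame(1) frame_nonzero(1)] by blast
  obtain M2 :: nat where M2: "M2 \<ge> 1" "\<And>a. a \<in> center_mult \<Longrightarrow> const_vec (real M2) \<star> a \<in> line_mult b2"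
    using center_mult_multiple_line_mult[OF frame(2) frame_nonzero(2)] by blast
  define M where "M = M1 * M2"
  have M: "(const_vec (real M) \<star> a) \<star> b1 \<in> L" "(const_vec (real M) \<star> a) \<star> b2 \<in> L"
    if a: "a \<in> center_mult" for a
  proof -
    have "(const_vec (real M) \<star> a) \<star> b1 = const_vec (real M2) \<star> ((const_vec (real M1) \<star> a) \<star> b1)"
      "(const_vec (real M) \<star> a) \<star> b2 = const_vec (real M1) \<star> ((const_vec (real M2) \<star> a) \<star> b2)"
      by (rule ext, simp add: M_def mult_ac)+
    then show "(const_vec (real M) \<star> a) \<star> b1 \<in> L" "(const_vec (real M) \<star> a) \<star> b2 \<in> L"
      using M1(2)[OF a] M2(2)[OF a] add_subgroup_multiple[OF L_subgroup]
      unfolding line_mult_def by auto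
  qed
  define D where "D = {(const_vec (real M) \<star> a) \<star> b1 + (const_vec (real M) \<star> a') \<star> b2 | a a'.
    a \<in> center_mult \<and> a' \<in> center_mult}"
  have D_sub: "D \<subseteq> L" unfolding D_def using M add_subgroup_add[OF L_subgroup] by blast
  have D_group: "add_subgroup D"
    unfolding add_subgroup_def
  proof (intro conjI ballI)
    have "0 = (const_vec (real M) \<star> 0) \<star> b1 + (const_vec (real M) \<star> 0) \<star> b2" by (rule ext) simp
    then show "0 \<in> D" unfolding D_def using add_subgroup_0[OF add_subgroup_center_mult] by blast
    fix u v assume "u \<in> D" "v \<in> D"
    then obtain a a' c c' where ac: "a \<in> center_mult" "a' \<in> center_mult" "c \<in> center_mult" "c' \<in> center_mult"
      and u: "u = (const_vec (real M) \<star> a) \<star> b1 + (const_vec (real M) \<star> a') \<star> b2"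
      and v: "v = (const_vec (real M) \<star> c) \<star> b1 + (const_vec (real M) \<star> c') \<star> b2"
      unfolding D_def by blast
    have "u - v = (const_vec (real M) \<star> (a - c)) \<star> b1 + (const_vec (real M) \<star> (a' - c')) \<star> b2"
      unfolding u v by (rule ext) (simp add: algebra_simps)
    then show "u - v \<in> D"
      unfolding D_def using ac add_subgroup_diff[OF add_subgroup_center_mult] by blast
  qed
  obtain R where R: "\<And>x. \<exists>a\<in>center_mult. bounded_by m R (x - a)"
    using rel_denseE[OF center_mult_rel_dense] by metis
  obtain s1 where s1: "s1 \<ge> 1" "bounded_by m s1 b1" using bounded_by_exists by blast
  obtain s2 where s2: "s2 \<ge> 1" "bounded_by m s2 b2" using bounded_by_exists by blast
  have Mpos: "real M > 0" using M1(1) M2(1) by (simp add: M_def)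
  have close: "\<exists>d\<in>D. bounded_by m (real M * max 0 R * s1 + real M * max 0 R * s2) (x - d)"
    if "x \<in> L" for x
  proof -
    define p where "p = (\<lambda>i. Im (cnj (x i) * b2 i) / symp b1 b2 i / real M)"
    define q where "q = (\<lambda>i. Im (cnj (b1 i) * x i) / symp b1 b2 i / real M)"
    obtain a where a: "a \<in> center_mult" "bounded_by m R (p - a)" using R by blast
    obtain a' where a': "a' \<in> center_mult" "bounded_by m R (q - a')" using R by blast
    define d where "d = (const_vec (real M) \<star> a) \<star> b1 + (const_vec (real M) \<star> a') \<star> b2"
    have "d \<in> D" unfolding D_def d_def using a(1) a'(1) by blast
    moreover have "bounded_by m (real M * max 0 R * s1 + real M * max 0 R * s2) (x - d)"
      unfolding bounded_by_def
    proof (intro allI impI)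
      fix i assume i: "i < m"
      have "x i = (real M * p i) *\<^sub>R b1 i + (real M * q i) *\<^sub>R b2 i"
        using frame_coordinates[of "b1 i" "b2 i" "x i"] frame(3)[OF i] Mpos
        by (simp add: p_def q_def symp_apply)
      then have eq: "(x - d) i = (real M * (p - a) i) *\<^sub>R b1 i + (real M * (q - a') i) *\<^sub>R b2 i"
        by (simp add: d_def algebra_simps)
      have "\<bar>real M * (p - a) i\<bar> \<le> real M * max 0 R" "\<bar>real M * (q - a') i\<bar> \<le> real M * max 0 R"
        using bounded_byD[OF a(2) i] bounded_byD[OF a'(2) i] Mpos by (auto simp: abs_mult)
      then have "cmod ((real M * (p - a) i) *\<^sub>R b1 i) \<le> real M * max 0 R * s1"
        "cmod ((real M * (q - a') i) *\<^sub>R b2 i) \<le> real M * max 0 R * s2"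
        unfolding norm_scaleR using bounded_byD[OF s1(2) i] bounded_byD[OF s2(2) i] Mpos
        by (auto intro!: mult_mono)
      then show "norm ((x - d) i) \<le> real M * max 0 R * s1 + real M * max 0 R * s2"
        unfolding eq by (rule norm_triangle_mono)
    qed
    ultimately show ?thesis by blast
  qed
  obtain N :: nat where N: "N \<ge> 1" "\<And>w. w \<in> L \<Longrightarrow> const_vec (real N) \<star> w \<in> D"
    using finite_index_multiple[OF L_subgroup L_loc_finite D_group D_sub close] by blast
  have "const_vec (real N) \<star> a \<in> multipliers" if a: "a \<in> center_mult" for a
  proof -
    have "(const_vec (real N) \<star> a) \<star> w \<in> L" if w: "w \<in> L" for w
    proof -
      obtain c c' where c: "c \<in> center_mult" "c' \<in> center_mult"
        and eq: "const_vec (real N) \<star> w = (const_vec (real M) \<star> c) \<star> b1 + (const_vec (real M) \<star> c') \<star> b2"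
        using N(2)[OF w] unfolding D_def by blast
      have "(const_vec (real N) \<star> a) \<star> w = a \<star> (const_vec (real N) \<star> w)"
        by (rule ext) simp
      also have "\<dots> = (const_vec (real M) \<star> (a \<star> c)) \<star> b1 + (const_vec (real M) \<star> (a \<star> c')) \<star> b2"
        unfolding eq by (rule ext) (simp add: algebra_simps)
      finally show ?thesis
        using M center_mult_mult a c add_subgroup_add[OF L_subgroup] by metis
    qed
    moreover have "const_vec (real N) \<star> a \<in> center_mult"
      using a by (rule add_subgroup_multiple[OF add_subgroup_center_mult])
    ultimately show ?thesis by (auto simp: multipliers_def center_mult_def)
  qed
  then show thesis using that N(1) by blast
qed

lemma multipliers_rel_dense: "rel_dense m multipliers"
  using center_mult_multiple_multipliers rel_dense_multiple[OF center_mult_rel_dense] by metis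

lemma multipliers_loc_finite: "loc_finite m multipliers"
  by (rule loc_finite_subset[OF center_mult_loc_finite]) (auto simp: multipliers_def center_mult_def)

lemma add_subgroup_multipliers: "add_subgroup multipliers"
  unfolding add_subgroup_def multipliers_def
  by (auto simp: scale_diff_left supported_diff supported_0 add_subgroup_0[OF L_subgroup]
      add_subgroup_0[OF \<Lambda>_subgroup] intro: add_subgroup_diff[OF \<Lambda>_subgroup] add_subgroup_diff[OF L_subgroup])

lemma multipliers_mult: "a \<in> multipliers \<Longrightarrow> a' \<in> multipliers \<Longrightarrow> a \<star> a' \<in> multipliers"
  by (auto simp: multipliers_def scale_assoc[symmetric] supported_scale)

lemma multipliers_supported: "a \<in> multipliers \<Longrightarrow> supported m a"
  by (simp add: multipliers_def)

end

section \<open>Small vectors in boxes\<close>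

text \<open>Minkowski's theorem for boxes, up to the constant. Round each point of the grid \<open>{0, 3R, \<dots>,
  3RT}\<close>, taken in every coordinate of \<open>B\<close>, to \<open>D\<close>: this gives \<open>(T + 1)\<close> to the
  power \<open>card B\<close> distinct vectors in a cube of side \<open>3RT + 2R\<close>. Cut the cube into boxes with sides
  \<open>r i\<close>. If their volume is large there are at most \<open>T\<close> to the power \<open>card B\<close> of them,
  so that two of the vectors share a box, and their difference is the required vector.\<close>

lemma minkowski_box:
  fixes D :: "(nat \<Rightarrow> real) set"
  assumes D: "add_subgroup D" and B: "finite B" "B \<noteq> {}" and R: "R > 0"
    and close: "\<And>x. \<exists>d\<in>D. (\<forall>i. i \<notin> B \<longrightarrow> d i = 0) \<and> (\<forall>i\<in>B. \<bar>x i - d i\<bar> \<le> R)"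
  shows "\<exists>C>0. \<forall>r. (\<forall>i\<in>B. r i > 0) \<longrightarrow> C \<le> (\<Prod>i\<in>B. r i) \<longrightarrow>
    (\<exists>d\<in>D. d \<noteq> 0 \<and> (\<forall>i. i \<notin> B \<longrightarrow> d i = 0) \<and> (\<forall>i\<in>B. \<bar>d i\<bar> \<le> r i))"
proof (intro exI[of _ "(5 * R) ^ card B"] conjI allI impI)
  show "(5 * R) ^ card B > 0" using R by simp
  fix r assume r: "\<forall>i\<in>B. r i > 0" and vol: "(5 * R) ^ card B \<le> (\<Prod>i\<in>B. r i)"
  \<comment> \<open>large enough that \<open>r i \<le> R T\<close> for every side and \<open>2 R \<le> R T\<close>\<close>
  obtain T :: nat where T: "real T \<ge> 2 + (\<Sum>i\<in>B. r i) / R" using real_arch_simple by blast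
  have sum0: "(\<Sum>i\<in>B. r i) / R \<ge> 0" using r R by (intro divide_nonneg_pos sum_nonneg) (auto intro: less_imp_le)
  have T2: "real T \<ge> 2" using T sum0 by linarith
  have rT: "r i \<le> R * real T" if "i \<in> B" for i
  proof -
    have "r i \<le> (\<Sum>i\<in>B. r i)" using that B r by (intro member_le_sum) (auto intro: less_imp_le)
    also have "\<dots> = ((\<Sum>i\<in>B. r i) / R) * R" using R by simp
    also have "\<dots> \<le> real T * R" using T R by (intro mult_right_mono) auto
    finally show ?thesis by (simp add: mult.commute)
  qed
  define G where "G = B \<rightarrow>\<^sub>E {0..T}"
  define d where "d g = (SOME d. d \<in> D \<and> (\<forall>i. i \<notin> B \<longrightarrow> d i = 0) \<and>
    (\<forall>i\<in>B. \<bar>3 * R * real (g i) - d i\<bar> \<le> R))" for g :: "nat \<Rightarrow> nat"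
  have d: "d g \<in> D" "\<forall>i. i \<notin> B \<longrightarrow> d g i = 0" "\<forall>i\<in>B. \<bar>3 * R * real (g i) - d g i\<bar> \<le> R" for g
  proof -
    have "\<exists>d. d \<in> D \<and> (\<forall>i. i \<notin> B \<longrightarrow> d i = 0) \<and> (\<forall>i\<in>B. \<bar>3 * R * real (g i) - d i\<bar> \<le> R)"
      using close[of "\<lambda>i. 3 * R * real (g i)"] by blast
    from someI_ex[OF this]
    have "d g \<in> D \<and> (\<forall>i. i \<notin> B \<longrightarrow> d g i = 0) \<and> (\<forall>i\<in>B. \<bar>3 * R * real (g i) - d g i\<bar> \<le> R)"
      unfolding d_def .
    then show "d g \<in> D" "\<forall>i. i \<notin> B \<longrightarrow> d g i = 0" "\<forall>i\<in>B. \<bar>3 * R * real (g i) - d g i\<bar> \<le> R"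
      by blast+
  qed
  define c where "c g = (\<lambda>i\<in>B. \<lfloor>(d g i + R) / r i\<rfloor>)" for g
  define K where "K i = \<lfloor>(3 * R * real T + 2 * R) / r i\<rfloor>" for i
  have "c ` G \<subseteq> (\<Pi>\<^sub>E i\<in>B. {0..K i})"
  proof
    fix y assume "y \<in> c ` G"
    then obtain g where g: "g \<in> G" "y = c g" by blast
    have "0 \<le> \<lfloor>(d g i + R) / r i\<rfloor> \<and> \<lfloor>(d g i + R) / r i\<rfloor> \<le> K i" if i: "i \<in> B" for i
    proof -
      have gi: "real (g i) \<le> real T" using g(1) i by (auto simp: G_def PiE_def Pi_def)
      have "\<bar>3 * R * real (g i) - d g i\<bar> \<le> R" using d(3) i by blast
      moreover have "3 * R * real (g i) \<le> 3 * R * real T" using gi R by (intro mult_left_mono) auto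
      moreover have "0 \<le> 3 * R * real (g i)" using R by simp
      ultimately have "0 \<le> d g i + R" "d g i + R \<le> 3 * R * real T + 2 * R" by linarith+
      then show ?thesis using r i unfolding K_def
        by (auto intro!: floor_mono divide_right_mono simp: less_imp_le)
    qed
    then show "y \<in> (\<Pi>\<^sub>E i\<in>B. {0..K i})" by (auto simp: g(2) c_def)
  qed
  then have "card (c ` G) \<le> card (\<Pi>\<^sub>E i\<in>B. {0..K i})"
    using B(1) by (intro card_mono finite_PiE) auto
  also have "\<dots> = (\<Prod>i\<in>B. nat (K i + 1))" using B(1) by (simp add: card_PiE)
  finally have "real (card (c ` G)) \<le> (\<Prod>i\<in>B. real (nat (K i + 1)))"
    by (metis of_nat_le_iff of_nat_prod)
  also have "\<dots> \<le> (\<Prod>i\<in>B. (5 * R * real T) / r i)"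
  proof (rule prod_mono)
    fix i assume i: "i \<in> B"
    then have ri: "r i > 0" using r by blast
    have "R * 2 \<le> R * real T" using T2 R by (intro mult_left_mono) auto
    then have "3 * R * real T + 2 * R + r i \<le> 5 * R * real T"
      using rT[OF i] by (simp add: algebra_simps)
    then have "(3 * R * real T + 2 * R + r i) / r i \<le> (5 * R * real T) / r i"
      using ri by (intro divide_right_mono) auto
    moreover have "(3 * R * real T + 2 * R + r i) / r i = (3 * R * real T + 2 * R) / r i + 1"
      using ri by (simp add: add_divide_distrib)
    moreover have "0 \<le> (3 * R * real T + 2 * R) / r i" using ri R by simp
    then have "0 \<le> K i" unfolding K_def by simp
    then have "real (nat (K i + 1)) = of_int (K i) + 1" by simp
    moreover have "of_int (K i) \<le> (3 * R * real T + 2 * R) / r i" unfolding K_def by (rule of_int_floor_le)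
    ultimately show "0 \<le> real (nat (K i + 1)) \<and> real (nat (K i + 1)) \<le> 5 * R * real T / r i"
      by linarith
  qed
  also have "\<dots> = (5 * R) ^ card B * real T ^ card B / (\<Prod>i\<in>B. r i)"
    by (simp add: prod_dividef power_mult_distrib)
  also have "\<dots> \<le> real T ^ card B"
  proof -
    have pos: "(\<Prod>i\<in>B. r i) > 0" using r by (intro prod_pos) auto
    have "(5 * R) ^ card B * real T ^ card B \<le> (\<Prod>i\<in>B. r i) * real T ^ card B"
      using vol by (intro mult_right_mono) auto
    then show ?thesis using pos by (simp add: pos_divide_le_eq mult.commute)
  qed
  also have "\<dots> < (real T + 1) ^ card B"
    using B by (intro power_strict_mono) (auto simp: card_gt_0_iff)
  also have "\<dots> = real (card G)" unfolding G_def using B(1) by (simp add: card_PiE add.commute)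
  finally have "card (c ` G) < card G" by simp
  then have "\<not> inj_on c G" by (rule pigeonhole)
  then obtain g g' where g: "g \<in> G" "g' \<in> G" "g \<noteq> g'" "c g = c g'" unfolding inj_on_def by blast
  obtain j where j: "j \<in> B" "g j \<noteq> g' j"
    using g(1-3) PiE_ext[of g B "\<lambda>_. {0..T}" g'] unfolding G_def by blast
  have "d g - d g' \<in> D" using d(1) by (intro add_subgroup_diff[OF D]) auto
  moreover have "d g - d g' \<noteq> 0"
  proof
    assume "d g - d g' = 0"
    then have "d g j = d g' j" by simp
    moreover have "\<bar>3 * R * real (g j) - d g j\<bar> \<le> R" "\<bar>3 * R * real (g' j) - d g' j\<bar> \<le> R"
      using d(3) j(1) by blast+
    ultimately have "\<bar>3 * R * real (g j) - 3 * R * real (g' j)\<bar> \<le> 2 * R" by linarith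
    moreover have "3 * R * real (g j) - 3 * R * real (g' j) = 3 * R * (real (g j) - real (g' j))"
      by (simp add: algebra_simps)
    ultimately have "3 * R * \<bar>real (g j) - real (g' j)\<bar> \<le> 2 * R" using R by (simp add: abs_mult)
    moreover have "\<bar>real (g j) - real (g' j)\<bar> \<ge> 1" using j(2) by linarith
    then have "3 * R * 1 \<le> 3 * R * \<bar>real (g j) - real (g' j)\<bar>" using R by (intro mult_left_mono) auto
    ultimately show False using R by linarith
  qed
  moreover have "(d g - d g') i = 0" if "i \<notin> B" for i using d(2) that by simp
  moreover have "\<bar>(d g - d g') i\<bar> \<le> r i" if i: "i \<in> B" for i
  proof -
    have ri: "r i > 0" using r i by blast
    have "\<lfloor>(d g i + R) / r i\<rfloor> = \<lfloor>(d g' i + R) / r i\<rfloor>"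
      using fun_cong[OF g(4), of i] i by (simp add: c_def)
    then have "\<bar>(d g i + R) / r i - (d g' i + R) / r i\<bar> < 1" by linarith
    moreover have "(d g i + R) / r i - (d g' i + R) / r i = (d g - d g') i / r i"
      by (simp add: diff_divide_distrib[symmetric])
    ultimately have "\<bar>(d g - d g') i / r i\<bar> < 1" by metis
    then show ?thesis using ri by (simp add: abs_divide)
  qed
  ultimately show "\<exists>d\<in>D. d \<noteq> 0 \<and> (\<forall>i. i \<notin> B \<longrightarrow> d i = 0) \<and> (\<forall>i\<in>B. \<bar>d i\<bar> \<le> r i)"
    by blast
qed

section \<open>Blocks of coordinates\<close>

definition ind :: "nat \<Rightarrow> nat set \<Rightarrow> nat \<Rightarrow> real"
  where "ind N D = (\<lambda>i. if i \<in> D then real N else 0)"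

lemma ind_apply: "ind N D i = (if i \<in> D then real N else 0)"
  by (simp add: ind_def)

context lattice_pair
begin

text \<open>The idempotents of the algebra generated by the multipliers over the rationals are indicator vectors.
  \<open>D\<close> is called rational if its indicator vector is one of them, up to the denominator \<open>N\<close>.\<close>

definition rational :: "nat set \<Rightarrow> bool"
  where "rational D \<longleftrightarrow> D \<subseteq> {..<m} \<and> (\<exists>N\<ge>1. ind N D \<in> multipliers)"

lemma ind_all: "ind N {..<m} \<in> multipliers"
proof -
  have 1: "ind 1 {..<m} \<star> z = z" if "supported m z" for z :: "nat \<Rightarrow> 'v::real_normed_vector"
    using that by (intro supported_eqI[of m]) (auto simp: supported_def ind_apply)
  have "ind 1 {..<m} \<in> multipliers"
    unfolding multipliers_def
    by (auto simp: 1 \<Lambda>_supported L_supported simp del: One_nat_def) (simp add: supported_def ind_apply)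
  then have "const_vec (real N) \<star> ind 1 {..<m} \<in> multipliers"
    by (rule add_subgroup_multiple[OF add_subgroup_multipliers])
  moreover have "const_vec (real N) \<star> ind 1 {..<m} = ind N {..<m}"
    by (rule ext) (simp add: ind_apply)
  ultimately show ?thesis by simp
qed

lemma rational_all: "rational {..<m}"
  unfolding rational_def using ind_all[of 1] by blast

lemma rational_Int: assumes "rational D" "rational D'" shows "rational (D \<inter> D')"
proof -
  obtain N N' where N: "N \<ge> 1" "ind N D \<in> multipliers" "N' \<ge> 1" "ind N' D' \<in> multipliers"
    using assms unfolding rational_def by blast
  have "ind N D \<star> ind N' D' = ind (N * N') (D \<inter> D')" by (rule ext) (simp add: ind_apply)
  then have "ind (N * N') (D \<inter> D') \<in> multipliers" using multipliers_mult[OF N(2,4)] by simp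
  moreover have "N * N' \<ge> 1" using N by simp
  ultimately show ?thesis using assms unfolding rational_def by blast
qed

lemma ind_Compl: assumes "ind N D \<in> multipliers" "D \<subseteq> {..<m}" shows "ind N ({..<m} - D) \<in> multipliers"
proof -
  have "ind N ({..<m} - D) = ind N {..<m} - ind N D"
    using assms(2) by (intro ext) (auto simp: ind_apply)
  then show ?thesis using add_subgroup_diff[OF add_subgroup_multipliers ind_all assms(1)] by metis
qed

lemma rational_Compl: "rational D \<Longrightarrow> rational ({..<m} - D)"
  unfolding rational_def using ind_Compl by blast

lemma rational_Un: assumes "rational D" "rational D'" shows "rational (D \<union> D')"
proof -
  have "D \<union> D' = {..<m} - (({..<m} - D) \<inter> ({..<m} - D'))"
    using assms unfolding rational_def by blast
  then show ?thesis using rational_Compl rational_Int assms by metis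
qed

lemma rational_Inter:
  assumes "finite \<D>" "\<D> \<noteq> {}" "\<And>D. D \<in> \<D> \<Longrightarrow> rational D"
  shows "rational (\<Inter>\<D>)"
  using assms by (induction rule: finite_ne_induct) (auto intro: rational_Int)

text \<open>There are finitely many rational sets, so they have a common denominator.\<close>

lemma rational_uniform: "\<exists>N\<ge>1. \<forall>D. rational D \<longrightarrow> ind N D \<in> multipliers"
proof -
  define f where "f D = (SOME N. N \<ge> 1 \<and> ind N D \<in> multipliers)" for D
  have f: "f D \<ge> 1 \<and> ind (f D) D \<in> multipliers" if "rational D" for D
    unfolding f_def by (rule someI_ex) (use that in \<open>simp add: rational_def\<close>)
  have fin: "finite {D. rational D}"
    by (rule finite_subset[of _ "Pow {..<m}"]) (auto simp: rational_def)
  define N where "N = (\<Prod>D | rational D. f D)"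
  have "N \<ge> 1" unfolding N_def using f by (intro prod_ge_1) auto
  moreover have "ind N D \<in> multipliers" if D: "rational D" for D
  proof -
    have "f D dvd N" unfolding N_def using fin D by (intro dvd_prodI) auto
    then obtain q where "N = f D * q" by (auto elim: dvdE)
    then have "ind N D = const_vec (real q) \<star> ind (f D) D"
      by (intro ext) (simp add: ind_apply mult.commute)
    then show ?thesis using f[OF D] add_subgroup_multiple[OF add_subgroup_multipliers] by metis
  qed
  ultimately show ?thesis by blast
qed

text \<open>The algebra has no nilpotents: multiplication by \<open>e\<close> is injective on the part supported where
  \<open>e\<close> does not vanish, hence surjective up to finite index, and \<open>M e = e\<^sup>2 f\<close> for some
  multiplier \<open>f\<close> and \<open>M > 0\<close>. Then \<open>e f\<close> is \<open>M\<close> times the indicator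
  vector of the support.\<close>

lemma rational_supp_multiplier:
  assumes e: "e \<in> multipliers"
  shows "rational {i. e i \<noteq> 0}"
proof -
  define D where "D = {i. e i \<noteq> 0}"
  have De: "D \<subseteq> {..<m}" using multipliers_supported[OF e] by (auto simp: D_def supported_def not_le[symmetric])
  define P where "P = {a \<in> multipliers. \<forall>i. e i = 0 \<longrightarrow> a i = 0}"
  define Q where "Q = (\<lambda>f. (e \<star> e) \<star> f) ` multipliers"
  have P: "add_subgroup P" using add_subgroup_multipliers by (auto simp: add_subgroup_def P_def)
  have P_lf: "loc_finite m P"
    by (rule loc_finite_subset[OF multipliers_loc_finite]) (auto simp: P_def)
  have Q: "add_subgroup Q"
    unfolding Q_def
    by (rule add_subgroup_image[where f = "\<lambda>f. (e \<star> e) \<star> f", OF add_subgroup_multipliers scale_diff_right])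
  have "(e \<star> e) \<star> f \<in> P" if "f \<in> multipliers" for f
    unfolding P_def using multipliers_mult[OF multipliers_mult[OF e e] that] by simp
  then have QP: "Q \<subseteq> P" unfolding Q_def by blast
  obtain R where R: "R \<ge> 1" "\<And>x. \<exists>a\<in>multipliers. bounded_by m R (x - a)"
    using rel_denseE[OF multipliers_rel_dense] by blast
  obtain s where s: "s \<ge> 1" "bounded_by m s e" using bounded_by_exists by blast
  have close: "\<exists>q\<in>Q. bounded_by m (s * s * R) (a - q)" if a: "a \<in> P" for a
  proof -
    obtain f where f: "f \<in> multipliers" "bounded_by m R ((\<lambda>i. a i / (e i * e i)) - f)" using R(2) by blast
    have "bounded_by m (s * s * R) (a - (e \<star> e) \<star> f)"
      unfolding bounded_by_def
    proof (intro allI impI)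
      fix i assume i: "i < m"
      have "(a - (e \<star> e) \<star> f) i = (e i * e i) * ((\<lambda>i. a i / (e i * e i)) - f) i"
        using a by (cases "e i = 0") (auto simp: P_def algebra_simps)
      also have "\<bar>\<dots>\<bar> = (\<bar>e i\<bar> * \<bar>e i\<bar>) * \<bar>((\<lambda>i. a i / (e i * e i)) - f) i\<bar>"
        by (simp only: abs_mult)
      also have "\<dots> \<le> s * s * R"
        using bounded_byD[OF s(2) i] bounded_byD[OF f(2) i] s(1) by (intro mult_mono) auto
      finally show "norm ((a - (e \<star> e) \<star> f) i) \<le> s * s * R" by simp
    qed
    then show ?thesis using f(1) unfolding Q_def by blast
  qed
  obtain M :: nat where M: "M \<ge> 1" "\<And>a. a \<in> P \<Longrightarrow> const_vec (real M) \<star> a \<in> Q"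
    using finite_index_multiple[OF P P_lf Q QP close] by blast
  have "e \<in> P" using e by (simp add: P_def)
  then obtain f where f: "f \<in> multipliers" "const_vec (real M) \<star> e = (e \<star> e) \<star> f"
    using M(2) unfolding Q_def by blast
  have "e \<star> f = ind M D"
  proof
    fix i
    have "real M * e i = e i * e i * f i" using fun_cong[OF f(2), of i] by simp
    then show "(e \<star> f) i = ind M D i" by (cases "e i = 0") (auto simp: ind_apply D_def)
  qed
  then have "ind M D \<in> multipliers" using multipliers_mult[OF e f(1)] by simp
  then show ?thesis using M(1) De unfolding rational_def D_def by blast
qed

text \<open>Up to finite index \<open>\<Lambda>\<close> is the free module over the multipliers that is generated by the
  nowhere vanishing vector \<open>\<omega>(b1, b2)\<close>.\<close>

lemma rational_supp_center:
  assumes z: "z \<in> \<Lambda>"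
  shows "rational {i. z i \<noteq> 0}"
proof -
  define l where "l = symp b1 b2"
  have l: "l \<in> \<Lambda>" "\<forall>i<m. l i \<noteq> 0" using symp_closed frame by (auto simp: l_def)
  define Q where "Q = (\<lambda>f. f \<star> l) ` multipliers"
  have Q: "add_subgroup Q"
    unfolding Q_def
    by (rule add_subgroup_image[where f = "\<lambda>f. f \<star> l", OF add_subgroup_multipliers scale_diff_left])
  have QL: "Q \<subseteq> \<Lambda>" unfolding Q_def multipliers_def using l(1) by blast
  obtain R where R: "R \<ge> 1" "\<And>x. \<exists>a\<in>multipliers. bounded_by m R (x - a)"
    using rel_denseE[OF multipliers_rel_dense] by blast
  obtain s where s: "s \<ge> 1" "bounded_by m s l" using bounded_by_exists by blast
  have close: "\<exists>q\<in>Q. bounded_by m (R * s) (a - q)" if a: "a \<in> \<Lambda>" for a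
  proof -
    obtain f where f: "f \<in> multipliers" "bounded_by m R ((\<lambda>i. a i / l i) - f)" using R(2) by blast
    have "bounded_by m (R * s) (((\<lambda>i. a i / l i) - f) \<star> l)"
      using f(2) s(2) R(1) by (intro bounded_by_scale) auto
    moreover have "(((\<lambda>i. a i / l i) - f) \<star> l) i = (a - f \<star> l) i" if "i < m" for i
      using l(2) that by (simp add: algebra_simps)
    ultimately have "bounded_by m (R * s) (a - f \<star> l)" by (simp add: bounded_by_def)
    then show ?thesis using f(1) unfolding Q_def by blast
  qed
  obtain M :: nat where M: "M \<ge> 1" "\<And>a. a \<in> \<Lambda> \<Longrightarrow> const_vec (real M) \<star> a \<in> Q"
    using finite_index_multiple[OF \<Lambda>_subgroup \<Lambda>_loc_finite Q QL close] by blast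
  obtain f where f: "f \<in> multipliers" "const_vec (real M) \<star> z = f \<star> l"
    using M(2)[OF z] unfolding Q_def by blast
  have "z i \<noteq> 0 \<longleftrightarrow> f i \<noteq> 0" for i
  proof (cases "i < m")
    case True
    then show ?thesis using fun_cong[OF f(2), of i] l(2) M(1) by auto
  next
    case False
    then show ?thesis
      using \<Lambda>_supported[OF z] multipliers_supported[OF f(1)] by (simp add: supported_def)
  qed
  then show ?thesis using rational_supp_multiplier[OF f(1)] by simp
qed

lemma rational_supp_lattice:
  assumes u: "u \<in> L"
  shows "rational {i. u i \<noteq> 0}"
proof -
  have "u i \<noteq> 0 \<longleftrightarrow> symp u b1 i \<noteq> 0 \<or> symp u b2 i \<noteq> 0" for i
  proof (cases "i < m")
    case True
    show ?thesis
      using frame_nondegenerate[of "u i" "b1 i" "b2 i"] frame(3)[OF True] by (auto simp: symp_apply)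
  next
    case False
    then show ?thesis using L_supported[OF u] by (simp add: supported_def symp_apply)
  qed
  then have "{i. u i \<noteq> 0} = {i. symp u b1 i \<noteq> 0} \<union> {i. symp u b2 i \<noteq> 0}" by blast
  then show ?thesis
    using rational_Un rational_supp_center symp_closed[OF u] frame(1,2) by metis
qed

text \<open>The smallest rational set that contains \<open>i\<close>: the set of real places of the number field that acts on
  the coordinate \<open>i\<close>.\<close>

definition block :: "nat \<Rightarrow> nat set"
  where "block i = \<Inter>{D. rational D \<and> i \<in> D}"

definition max_block :: nat
  where "max_block = Max ((\<lambda>i. card (block i)) ` {..<m})"

lemma block:
  assumes "i < m"
  shows "rational (block i)" "i \<in> block i" "rational D \<Longrightarrow> i \<in> D \<Longrightarrow> block i \<subseteq> D"
    "block i \<subseteq> {..<m}" "finite (block i)"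
proof -
  have "{D. rational D \<and> i \<in> D} \<subseteq> Pow {..<m}" by (auto simp: rational_def)
  then have fin: "finite {D. rational D \<and> i \<in> D}" by (rule finite_subset) simp
  moreover have "{..<m} \<in> {D. rational D \<and> i \<in> D}" using rational_all assms by simp
  ultimately show 1: "rational (block i)" unfolding block_def by (intro rational_Inter) auto
  show "i \<in> block i" "rational D \<Longrightarrow> i \<in> D \<Longrightarrow> block i \<subseteq> D" by (auto simp: block_def)
  show "block i \<subseteq> {..<m}" using 1 by (simp add: rational_def)
  then show "finite (block i)" by (rule finite_subset) simp
qed

lemma card_block_le: "i < m \<Longrightarrow> card (block i) \<le> max_block"
  unfolding max_block_def by (intro Max_ge) auto

lemma card_block_ge_1: "i < m \<Longrightarrow> 1 \<le> card (block i)"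
  using block(2,5)[of i] by (metis One_nat_def Suc_leI card_gt_0_iff empty_iff)

lemma max_block_attained: assumes "m \<ge> 1" shows "\<exists>i<m. card (block i) = max_block"
proof -
  have "max_block \<in> (\<lambda>i. card (block i)) ` {..<m}"
    unfolding max_block_def using assms by (intro Max_in) (auto simp: lessThan_empty_iff)
  then show ?thesis by auto
qed

lemma max_block_bounds: assumes "m \<ge> 1" shows "1 \<le> max_block" "max_block \<le> m"
proof -
  obtain i where i: "i < m" "card (block i) = max_block" using max_block_attained[OF assms] by blast
  show "1 \<le> max_block" using card_block_ge_1[OF i(1)] i(2) by simp
  show "max_block \<le> m" using card_mono[OF _ block(4)[OF i(1)]] i(2) by simp
qed

text \<open>A nonzero element of a field does not vanish at any real place. Otherwise the support, a rational set, would cut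
  the block.\<close>

lemma multiplier_supp_block:
  assumes i: "i < m" and e: "e \<in> multipliers" "e \<noteq> 0" "\<And>j. j \<notin> block i \<Longrightarrow> e j = 0"
  shows "e i \<noteq> 0"
proof
  assume 0: "e i = 0"
  have "rational (block i \<inter> ({..<m} - {j. e j \<noteq> 0}))"
    using rational_Int rational_Compl block(1)[OF i] rational_supp_multiplier[OF e(1)] by blast
  moreover have "i \<in> block i \<inter> ({..<m} - {j. e j \<noteq> 0})" using 0 i block(2) by blast
  ultimately have "block i \<subseteq> {..<m} - {j. e j \<noteq> 0}" using block(3)[OF i] by blast
  then have "e j = 0" for j using e(3)[of j] by (cases "j \<in> block i") auto
  then have "e = 0" by (intro ext) simp
  then show False using e(2) by contradiction
qed

lemma block_minkowski:
  assumes i: "i < m"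
  shows "\<exists>C>0. \<forall>r. (\<forall>j\<in>block i. r j > 0) \<longrightarrow> C \<le> (\<Prod>j\<in>block i. r j) \<longrightarrow>
    (\<exists>e\<in>multipliers. e \<noteq> 0 \<and> (\<forall>j. j \<notin> block i \<longrightarrow> e j = 0) \<and> (\<forall>j\<in>block i. \<bar>e j\<bar> \<le> r j))"
proof -
  obtain N where N: "N \<ge> 1" "ind N (block i) \<in> multipliers"
    using block(1)[OF i] unfolding rational_def by blast
  obtain R where R: "R \<ge> 1" "\<And>x. \<exists>a\<in>multipliers. bounded_by m R (x - a)"
    using rel_denseE[OF multipliers_rel_dense] by blast
  show ?thesis
  proof (rule minkowski_box[OF add_subgroup_multipliers block(5)[OF i]])
    show "block i \<noteq> {}" using block(2)[OF i] by blast
    show "real N * R > 0" using N R by simp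
    fix x :: "nat \<Rightarrow> real"
    obtain f where f: "f \<in> multipliers" "bounded_by m R ((\<lambda>j. x j / real N) - f)" using R(2) by blast
    have "\<bar>x j - (ind N (block i) \<star> f) j\<bar> \<le> real N * R" if j: "j \<in> block i" for j
    proof -
      have "x j - (ind N (block i) \<star> f) j = real N * ((\<lambda>j. x j / real N) - f) j"
        using N(1) j by (simp add: ind_apply algebra_simps)
      moreover have "j < m" using block(4)[OF i] j by blast
      ultimately show ?thesis
        using bounded_byD[OF f(2)] by (simp add: abs_mult mult_left_mono)
    qed
    moreover have "(ind N (block i) \<star> f) j = 0" if "j \<notin> block i" for j
      using that by (simp add: ind_apply)
    ultimately show "\<exists>d\<in>multipliers. (\<forall>j. j \<notin> block i \<longrightarrow> d j = 0) \<and>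
        (\<forall>j\<in>block i. \<bar>x j - d j\<bar> \<le> real N * R)"
      using multipliers_mult[OF N(2) f(1)] by blast
  qed
qed

lemma center_gap: "\<exists>\<delta>>0. \<forall>z\<in>\<Lambda>. (\<forall>i<m. \<bar>z i\<bar> \<le> \<delta>) \<longrightarrow> z = 0"
proof -
  define F where "F = {z \<in> \<Lambda>. bounded_by m 1 z} - {0}"
  have fin: "finite F" unfolding F_def by (rule finite_Diff) (rule loc_finiteD[OF \<Lambda>_loc_finite])
  define q where "q z = (\<Sum>i<m. \<bar>z i\<bar>)" for z :: "nat \<Rightarrow> real"
  have qpos: "q z > 0" if z: "z \<in> F" for z
  proof -
    have "\<exists>i<m. z i \<noteq> 0"
    proof (rule ccontr)
      assume "\<not> (\<exists>i<m. z i \<noteq> 0)"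
      then have "z = 0" using z \<Lambda>_supported supported_0 by (intro supported_eqI[of m]) (auto simp: F_def)
      then show False using z by (simp add: F_def)
    qed
    then obtain i where "i < m" "z i \<noteq> 0" by blast
    then have "0 < \<bar>z i\<bar>" "\<bar>z i\<bar> \<le> q z" unfolding q_def
      by (auto intro!: member_le_sum[of i "{..<m}" "\<lambda>i. \<bar>z i\<bar>"])
    then show ?thesis by linarith
  qed
  define \<mu> where "\<mu> = Min (insert 1 (q ` F))"
  have \<mu>: "\<mu> > 0" "\<mu> \<le> 1" "\<And>z. z \<in> F \<Longrightarrow> \<mu> \<le> q z" using fin qpos by (auto simp: \<mu>_def)
  have "z = 0" if z: "z \<in> \<Lambda>" "\<forall>i<m. \<bar>z i\<bar> \<le> \<mu> / (real m + 1)" for z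
  proof (rule ccontr)
    assume "z \<noteq> 0"
    have "\<mu> / (real m + 1) \<le> 1" using \<mu> by simp
    then have "bounded_by m 1 z" using z(2) unfolding bounded_by_def by (auto intro: order_trans)
    then have "z \<in> F" using z(1) \<open>z \<noteq> 0\<close> by (simp add: F_def)
    then have "\<mu> \<le> q z" by (rule \<mu>(3))
    also have "\<dots> \<le> (\<Sum>i<m. \<mu> / (real m + 1))" unfolding q_def using z(2) by (intro sum_mono) simp
    also have "\<dots> < \<mu>" using \<mu>(1) by (simp add: field_simps)
    finally show False by simp
  qed
  moreover have "\<mu> / (real m + 1) > 0" using \<mu>(1) by simp
  ultimately show ?thesis by blast
qed

text \<open>The norm of \<open>z\<close> on the block \<open>B\<close> of \<open>i\<close>, that is the product of the
  \<open>\<bar>z\<^sub>j\<bar>\<close> over the block, is bounded away from \<open>0\<close>. If it were tiny, the box with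
  sides \<open>\<delta> / \<bar>z\<^sub>j\<bar>\<close> would contain a nonzero multiplier \<open>e\<close>, and \<open>e
  z\<close> would be a nonzero element of \<open>\<Lambda>\<close> below the gap \<open>\<delta>\<close> of
  \<open>\<Lambda>\<close>. As the other \<open>card B - 1\<close> factors are at most \<open>n\<close>, the factor at
  \<open>i\<close> cannot be too small.\<close>

lemma center_coordinate_lower_bound:
  "\<exists>c>0. \<forall>z\<in>\<Lambda>. \<forall>n\<ge>1. bounded_by m n z \<longrightarrow>
     (\<forall>i<m. z i \<noteq> 0 \<longrightarrow> c / n ^ (max_block - 1) \<le> \<bar>z i\<bar>)"
proof -
  obtain \<delta> where \<delta>: "\<delta> > 0" "\<And>z. z \<in> \<Lambda> \<Longrightarrow> (\<forall>i<m. \<bar>z i\<bar> \<le> \<delta>) \<Longrightarrow> z = 0"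
    using center_gap by blast
  have "\<exists>c>0. \<forall>z\<in>\<Lambda>. \<forall>n\<ge>1. bounded_by m n z \<longrightarrow> z i \<noteq> 0 \<longrightarrow> c / n ^ (max_block - 1) \<le> \<bar>z i\<bar>"
    if i: "i < m" for i
  proof -
    define B where "B = block i"
    obtain C where C: "C > 0" "\<And>r. (\<forall>j\<in>B. r j > 0) \<Longrightarrow> C \<le> (\<Prod>j\<in>B. r j) \<Longrightarrow>
        (\<exists>e\<in>multipliers. e \<noteq> 0 \<and> (\<forall>j. j \<notin> B \<longrightarrow> e j = 0) \<and> (\<forall>j\<in>B. \<bar>e j\<bar> \<le> r j))"
      using block_minkowski[OF i] unfolding B_def by blast
    have fin: "finite B" and iB: "i \<in> B" and Bm: "B \<subseteq> {..<m}" using block[OF i] by (auto simp: B_def)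
    have "(\<delta> ^ card B / C) / n ^ (max_block - 1) \<le> \<bar>z i\<bar>"
      if z: "z \<in> \<Lambda>" and n: "n \<ge> 1" "bounded_by m n z" and zi: "z i \<noteq> 0" for z n
    proof -
      have supp: "B \<subseteq> {i. z i \<noteq> 0}"
        unfolding B_def using block(3)[OF i rational_supp_center[OF z]] zi by blast
      have prodpos: "(\<Prod>j\<in>B. \<bar>z j\<bar>) > 0" using supp by (intro prod_pos) auto
      have "\<delta> ^ card B / (\<Prod>j\<in>B. \<bar>z j\<bar>) < C"
      proof (rule ccontr)
        assume "\<not> ?thesis"
        then have "C \<le> (\<Prod>j\<in>B. \<delta> / \<bar>z j\<bar>)" by (simp add: prod_dividef)
        moreover have "\<forall>j\<in>B. \<delta> / \<bar>z j\<bar> > 0" using supp \<delta>(1) by auto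
        ultimately obtain e where e: "e \<in> multipliers" "e \<noteq> 0" "\<forall>j. j \<notin> B \<longrightarrow> e j = 0"
          "\<forall>j\<in>B. \<bar>e j\<bar> \<le> \<delta> / \<bar>z j\<bar>" using C(2)[of "\<lambda>j. \<delta> / \<bar>z j\<bar>"] by blast
        have "e \<star> z = 0"
        proof (rule \<delta>(2))
          show "e \<star> z \<in> \<Lambda>" using e(1) z by (simp add: multipliers_def)
          have "\<bar>(e \<star> z) j\<bar> \<le> \<delta>" for j
          proof (cases "j \<in> B")
            case True
            then have "\<bar>z j\<bar> > 0" "\<bar>e j\<bar> \<le> \<delta> / \<bar>z j\<bar>" using supp e(4) by auto
            then show ?thesis by (simp add: abs_mult field_simps)
          next
            case False
            then show ?thesis using e(3) \<delta>(1) by simp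
          qed
          then show "\<forall>j<m. \<bar>(e \<star> z) j\<bar> \<le> \<delta>" by blast
        qed
        then have ez: "e j * z j = 0" for j by (metis scale_apply real_scaleR_def zero_fun_apply)
        have "e j = 0" for j
        proof (cases "j \<in> B")
          case True
          then show ?thesis using supp ez[of j] by auto
        qed (use e(3) in blast)
        then have "e = 0" by (intro ext) simp
        then show False using e(2) by contradiction
      qed
      then have 1: "\<delta> ^ card B / C < (\<Prod>j\<in>B. \<bar>z j\<bar>)"
        using prodpos C(1) by (simp add: field_simps)
      have "(\<Prod>j\<in>B. \<bar>z j\<bar>) = \<bar>z i\<bar> * (\<Prod>j\<in>B - {i}. \<bar>z j\<bar>)"
        using fin iB by (rule prod.remove)
      also have "\<dots> \<le> \<bar>z i\<bar> * (\<Prod>j\<in>B - {i}. n)"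
        using bounded_byD[OF n(2)] Bm by (intro mult_left_mono prod_mono) auto
      also have "\<dots> = \<bar>z i\<bar> * n ^ (card B - 1)" using fin iB by simp
      also have "\<dots> \<le> \<bar>z i\<bar> * n ^ (max_block - 1)"
        using n(1) card_block_le[OF i] by (intro mult_left_mono power_increasing) (auto simp: B_def)
      finally have "\<delta> ^ card B / C \<le> \<bar>z i\<bar> * n ^ (max_block - 1)" using 1 by linarith
      then show ?thesis using n(1) by (intro mult_imp_div_pos_le[where y = "n ^ (max_block - 1)"]) auto
    qed
    moreover have "\<delta> ^ card B / C > 0" using \<delta>(1) C(1) by simp
    ultimately show ?thesis by blast
  qed
  then obtain f where f: "\<forall>i<m. f i > 0 \<and> (\<forall>z\<in>\<Lambda>. \<forall>n\<ge>1. bounded_by m n z \<longrightarrow> z i \<noteq> 0 \<longrightarrow>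
      f i / n ^ (max_block - 1) \<le> \<bar>z i\<bar>)" by metis
  define c where "c = Min (insert 1 (f ` {..<m}))"
  have c: "c > 0" "\<And>i. i < m \<Longrightarrow> c \<le> f i" using f by (auto simp: c_def)
  show ?thesis
  proof (intro exI[of _ c] conjI c(1) ballI allI impI)
    fix z and n :: real and i
    assume h: "z \<in> \<Lambda>" "1 \<le> n" "bounded_by m n z" "i < m" "z i \<noteq> 0"
    have "c / n ^ (max_block - 1) \<le> f i / n ^ (max_block - 1)"
      using c(2)[OF h(4)] h(2) by (intro divide_right_mono) auto
    also have "\<dots> \<le> \<bar>z i\<bar>" using f h by blast
    finally show "c / n ^ (max_block - 1) \<le> \<bar>z i\<bar>" .
  qed
qed

text \<open>One of \<open>\<omega>(u, b1)\<close> and \<open>\<omega>(u, b2)\<close> does not vanish at \<open>i\<close>, and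
  it is at most of order \<open>\<bar>u\<^sub>i\<bar>\<close> there.\<close>

lemma lattice_coordinate_lower_bound:
  "\<exists>c>0. \<forall>u\<in>L. \<forall>n\<ge>1. bounded_by m n u \<longrightarrow>
     (\<forall>i<m. u i \<noteq> 0 \<longrightarrow> c / n ^ (max_block - 1) \<le> cmod (u i))"
proof -
  obtain c where c: "c > 0" "\<forall>z\<in>\<Lambda>. \<forall>n\<ge>1. bounded_by m n z \<longrightarrow>
     (\<forall>i<m. z i \<noteq> 0 \<longrightarrow> c / n ^ (max_block - 1) \<le> \<bar>z i\<bar>)"
    using center_coordinate_lower_bound by blast
  obtain s1 where s1: "s1 \<ge> 1" "bounded_by m s1 b1" using bounded_by_exists by blast
  obtain s2 where s2: "s2 \<ge> 1" "bounded_by m s2 b2" using bounded_by_exists by blast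
  define s where "s = max s1 s2"
  have s: "s \<ge> 1" "bounded_by m s b1" "bounded_by m s b2"
    using s1 s2 by (auto simp: s_def intro: bounded_by_mono)
  show ?thesis
  proof (intro exI[of _ "c / s ^ max_block / s"] conjI ballI allI impI)
    show "c / s ^ max_block / s > 0" using c(1) s(1) by simp
    fix u and n :: real and i
    assume u: "u \<in> L" and n: "1 \<le> n" "bounded_by m n u" and i: "i < m" "u i \<noteq> 0"
    have "\<exists>b\<in>{b1, b2}. symp u b i \<noteq> 0"
      using frame_nondegenerate[of "u i" "b1 i" "b2 i"] frame(3)[OF i(1)] i(2) by (auto simp: symp_apply)
    then obtain b where b: "b \<in> L" "bounded_by m s b" "symp u b i \<noteq> 0" using s frame(1,2) by blast
    have "bounded_by m (n * s) (symp u b)" using n b(2) by (intro bounded_by_symp) auto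
    moreover have "n * s \<ge> 1" using mult_mono[of 1 n 1 s] n s by simp
    ultimately have "c / (n * s) ^ (max_block - 1) \<le> \<bar>symp u b i\<bar>"
      using c(2) symp_closed[OF u b(1)] i(1) b(3) by blast
    also have "\<dots> \<le> cmod (u i) * s"
      using norm_symp_le[of u b i] bounded_byD[OF b(2) i(1)] by (meson mult_left_mono norm_ge_zero order_trans)
    finally have 1: "c / (n * s) ^ (max_block - 1) / s \<le> cmod (u i)"
      using s(1) by (intro mult_imp_div_pos_le[where y = s]) auto
    have "s ^ (max_block - 1) \<le> s ^ max_block" using s(1) by (intro power_increasing) auto
    then have "s ^ (max_block - 1) * n ^ (max_block - 1) \<le> s ^ max_block * n ^ (max_block - 1)"
      using n(1) by (intro mult_right_mono) auto
    then have "(n * s) ^ (max_block - 1) \<le> s ^ max_block * n ^ (max_block - 1)"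
      by (simp add: power_mult_distrib mult.commute)
    then have "c / (s ^ max_block * n ^ (max_block - 1)) / s \<le> c / (n * s) ^ (max_block - 1) / s"
      using c(1) s(1) n(1) by (intro divide_right_mono divide_left_mono) auto
    then show "c / s ^ max_block / s / n ^ (max_block - 1) \<le> cmod (u i)"
      using 1 by (simp add: divide_divide_eq_left mult_ac)
  qed
qed

text \<open>Subtract from \<open>x\<close> lattice vectors in the kernel of \<open>\<omega>(u, \<cdot>)\<close>. On the
  support \<open>D\<close> of \<open>u\<close> the difference of \<open>x\<close> and the shortest real solution
  \<open>w0\<close> is a real multiple \<open>a u\<close>, which a lattice vector \<open>e u\<close> with a multiplier
  \<open>e\<close> approximates with error of order \<open>\<bar>u\<bar>\<close>. Off \<open>D\<close> the kernel is
  everything, and since \<open>D\<close> is rational the lattice vectors supported off \<open>D\<close> are relatively dense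
  there. What remains is \<open>w0\<close>, of size at most \<open>n\<^sup>2\<close> divided by the smallest nonzero
  coordinate of \<open>u\<close>, plus \<open>O(n)\<close>.\<close>

theorem short_conjugators:
  assumes m: "m \<ge> 1"
  shows "\<exists>C\<ge>1. \<forall>u\<in>L. \<forall>x\<in>L. \<forall>n\<ge>1. bounded_by m n u \<longrightarrow> bounded_by m (n\<^sup>2) (symp u x) \<longrightarrow>
    (\<exists>w\<in>L. symp u w = symp u x \<and> bounded_by m (C * n ^ (max_block + 1)) w)"
proof -
  define K where "K = max_block"
  have K: "K \<ge> 1" using max_block_bounds[OF m] by (simp add: K_def)
  obtain c where c: "c > 0" "\<forall>u\<in>L. \<forall>n\<ge>1. bounded_by m n u \<longrightarrow>
     (\<forall>i<m. u i \<noteq> 0 \<longrightarrow> c / n ^ (K - 1) \<le> cmod (u i))"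
    using lattice_coordinate_lower_bound unfolding K_def by blast
  obtain N where N: "N \<ge> 1" "\<forall>D. rational D \<longrightarrow> ind N D \<in> multipliers"
    using rational_uniform by blast
  obtain R1 where R1: "R1 \<ge> 1" "\<And>x. \<exists>a\<in>multipliers. bounded_by m R1 (x - a)"
    using rel_denseE[OF multipliers_rel_dense] by blast
  obtain R2 where R2: "R2 \<ge> 1" "\<And>x. \<exists>a\<in>L. bounded_by m R2 (x - a)"
    using rel_denseE[OF L_rel_dense] by blast
  define C where "C = 1 / c + R1 + real N * R2"
  have pos: "1 / c > 0" "real N * R2 \<ge> 0" using c(1) R2(1) by simp_all
  have C1: "C \<ge> 1" unfolding C_def using pos R1(1) by linarith
  have main: "\<exists>w\<in>L. symp u w = symp u x \<and> bounded_by m (C * n ^ (K + 1)) w"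
    if u: "u \<in> L" and x: "x \<in> L" and n: "n \<ge> 1" and bu: "bounded_by m n u"
      and bz: "bounded_by m (n\<^sup>2) (symp u x)" for u x n
  proof -
    define D where "D = {i. u i \<noteq> 0}"
    define I where "I = ind N ({..<m} - D)"
    have I: "I \<in> multipliers"
      unfolding I_def using N(2) rational_Compl rational_supp_lattice[OF u] by (auto simp: D_def)
    define w0 where "w0 = (\<lambda>i. \<i> * of_real (symp u x i) / cnj (u i))"
    define a where "a = (\<lambda>i. Re ((x i - w0 i) / u i))"
    obtain e where e: "e \<in> multipliers" "bounded_by m R1 (a - e)" using R1(2) by blast
    obtain y where y: "y \<in> L" "bounded_by m R2 ((\<lambda>i. x i / of_real (real N)) - y)" using R2(2) by blast
    define w where "w = x - e \<star> u - I \<star> y"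
    have wL: "w \<in> L"
      unfolding w_def using x u y(1) e(1) I
      by (intro add_subgroup_diff[OF L_subgroup]) (auto simp: multipliers_def)
    have Iu: "I i = 0" if "u i \<noteq> 0" for i using that by (simp add: I_def ind_apply D_def)
    have "symp u w = symp u x"
    proof
      fix i
      have "symp u (e \<star> u) i = 0" by (simp add: symp_apply)
      moreover have "symp u (I \<star> y) i = 0" using Iu[of i] by (cases "u i = 0") (auto simp: symp_apply)
      ultimately show "symp u w i = symp u x i" by (simp add: w_def symp_diff_right)
    qed
    moreover have "bounded_by m (C * n ^ (K + 1)) w"
      unfolding bounded_by_def
    proof (intro allI impI)
      fix i assume i: "i < m"
      have np: "n ^ (K + 1) \<ge> 1" using n by (rule one_le_power)
      show "norm (w i) \<le> C * n ^ (K + 1)"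
      proof (cases "u i = 0")
        case False
        have "Im (cnj (u i) * (x i - w0 i)) = 0"
          using Im_cnj_mult_ii(1)[OF False, of "symp u x i"] by (simp add: right_diff_distrib symp_apply w0_def)
        then have "x i - w0 i = a i *\<^sub>R u i"
          unfolding a_def by (rule Im_cnj_mult_0_imp_real_multiple[OF False])
        then have "w i = w0 i + (a - e) i *\<^sub>R u i"
          using Iu[OF False] by (simp add: w_def algebra_simps)
        moreover have "cmod (w0 i) \<le> n ^ (K + 1) / c"
        proof -
          have low: "c / n ^ (K - 1) \<le> cmod (u i)" using c(2) u n bu i False by blast
          have "cmod (w0 i) = \<bar>symp u x i\<bar> / cmod (u i)"
            unfolding w0_def by (rule Im_cnj_mult_ii(2)[OF False])
          also have "\<dots> \<le> n\<^sup>2 / (c / n ^ (K - 1))"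
            using bounded_byD[OF bz i] low c(1) n by (intro frac_le) auto
          also have "\<dots> = n ^ (2 + (K - 1)) / c" by (simp add: power_add power2_eq_square)
          also have "2 + (K - 1) = K + 1" using K by simp
          finally show ?thesis .
        qed
        moreover have "cmod ((a - e) i *\<^sub>R u i) \<le> R1 * n ^ (K + 1)"
        proof -
          have "cmod ((a - e) i *\<^sub>R u i) \<le> R1 * n"
            unfolding norm_scaleR using bounded_byD[OF e(2) i] bounded_byD[OF bu i] R1(1)
            by (intro mult_mono) auto
          also have "\<dots> \<le> R1 * n ^ (K + 1)"
            using R1(1) n power_increasing[of 1 "K + 1" n] by (intro mult_left_mono) auto
          finally show ?thesis .
        qed
        ultimately have "cmod (w i) \<le> n ^ (K + 1) / c + R1 * n ^ (K + 1)"
          by (metis norm_triangle_mono)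
        moreover have "0 \<le> real N * R2 * n ^ (K + 1)" using R2(1) n by simp
        ultimately show ?thesis by (simp add: C_def algebra_simps)
      next
        case True
        then have "w i = of_real (real N) * ((\<lambda>i. x i / of_real (real N)) - y) i"
          using i N(1) by (simp add: w_def I_def ind_apply D_def scaleR_conv_of_real algebra_simps)
        then have "cmod (w i) \<le> real N * R2"
          using bounded_byD[OF y(2) i] by (simp add: norm_mult mult_left_mono)
        also have "\<dots> \<le> C * 1" using c(1) R1(1) by (simp add: C_def)
        also have "\<dots> \<le> C * n ^ (K + 1)" using C1 np by (intro mult_left_mono) auto
        finally show ?thesis .
      qed
    qed
    ultimately show ?thesis using wL by blast
  qed
  then show ?thesis using C1 unfolding K_def by blast
qed

text \<open>In a largest block, with \<open>K\<close> coordinates, Minkowski's theorem gives a multiplier \<open>e\<close> of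
  size \<open>n\<close> whose value at \<open>i\<close> is of order \<open>n\<close> to the power \<open>-(K - 1)\<close>.
  Take \<open>u = e b1\<close>, and \<open>x\<close> such that \<open>\<omega>(b1, x)\<close> is about \<open>n\<close> to
  the power \<open>K + 1\<close> at \<open>i\<close> and bounded elsewhere. Multiplication by \<open>e\<close> brings it down
  to size \<open>n\<^sup>2\<close>. But \<open>\<omega>(u, w) = \<omega>(u, x)\<close> forces \<open>\<omega>(b1, w)\<close>
  and \<open>\<omega>(b1, x)\<close> to agree at \<open>i\<close>, because \<open>e\<close> does not vanish at
  \<open>i\<close>.\<close>

theorem long_conjugators:
  assumes m: "m \<ge> 1"
  shows "\<exists>C\<ge>1. \<forall>n\<ge>1. \<exists>u\<in>L. \<exists>x\<in>L. bounded_by m (C * n) u \<and> bounded_by m (C * n\<^sup>2) (symp u x) \<and>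
    (\<forall>w\<in>L. symp u w = symp u x \<longrightarrow> (\<exists>i<m. n ^ (max_block + 1) \<le> C * cmod (w i)))"
proof -
  define K where "K = max_block"
  have K: "K \<ge> 1" using max_block_bounds[OF m] by (simp add: K_def)
  obtain i where i: "i < m" "card (block i) = K" using max_block_attained[OF m] by (auto simp: K_def)
  define B where "B = block i"
  obtain C1 where C1: "C1 > 0" "\<And>r. (\<forall>j\<in>B. r j > 0) \<Longrightarrow> C1 \<le> (\<Prod>j\<in>B. r j) \<Longrightarrow>
        (\<exists>e\<in>multipliers. e \<noteq> 0 \<and> (\<forall>j. j \<notin> B \<longrightarrow> e j = 0) \<and> (\<forall>j\<in>B. \<bar>e j\<bar> \<le> r j))"
    using block_minkowski[OF i(1)] unfolding B_def by blast
  have fin: "finite B" and iB: "i \<in> B" and Bm: "B \<subseteq> {..<m}" and cardB: "card B = K"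
    using block[OF i(1)] i(2) by (auto simp: B_def)
  obtain s where s: "s \<ge> 1" "bounded_by m s b1" using bounded_by_exists by blast
  obtain R where R: "R \<ge> 1" "\<And>x. \<exists>a\<in>L. bounded_by m R (x - a)"
    using rel_denseE[OF L_rel_dense] by blast
  define C where "C = (1 + C1) * s + C1 * (1 + 2 * s * R) + s * R"
  have sR: "s * R \<ge> 0" using s R by simp
  have ge: "(1 + C1) * s \<ge> s" using C1(1) s(1) by (simp add: algebra_simps)
  have C1sR: "C1 * (1 + 2 * s * R) \<ge> 0" using C1(1) sR by (simp add: mult.assoc)
  have C: "C \<ge> 1" "C \<ge> s" "C \<ge> (1 + C1) * s" "C \<ge> C1 * (1 + 2 * s * R)" "C \<ge> s * R"
    using ge sR C1sR s(1) unfolding C_def by linarith+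
  have main: "\<exists>u\<in>L. \<exists>x\<in>L. bounded_by m (C * n) u \<and> bounded_by m (C * n\<^sup>2) (symp u x) \<and>
    (\<forall>w\<in>L. symp u w = symp u x \<longrightarrow> (\<exists>i<m. n ^ (K + 1) \<le> C * cmod (w i)))" if n: "n \<ge> 1" for n
  proof -
    \<comment> \<open>a box of volume exactly \<open>C1\<close> that is thin in the direction \<open>i\<close>\<close>
    define r where "r j = (if j = i then C1 / n ^ (K - 1) else n)" for j
    have rpos: "\<forall>j\<in>B. r j > 0" using C1(1) n by (auto simp: r_def)
    have "(\<Prod>j\<in>B. r j) = r i * (\<Prod>j\<in>B - {i}. r j)" using fin iB by (rule prod.remove)
    also have "(\<Prod>j\<in>B - {i}. r j) = (\<Prod>j\<in>B - {i}. n)" by (rule prod.cong) (auto simp: r_def)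
    also have "\<dots> = n ^ (K - 1)" using fin iB cardB by simp
    finally have "(\<Prod>j\<in>B. r j) = C1" using n by (simp add: r_def)
    then obtain e where e: "e \<in> multipliers" "e \<noteq> 0" "\<forall>j. j \<notin> B \<longrightarrow> e j = 0" "\<forall>j\<in>B. \<bar>e j\<bar> \<le> r j"
      using C1(2)[OF rpos] by auto
    have ei: "e i \<noteq> 0" using multiplier_supp_block[OF i(1) e(1,2)] e(3) by (auto simp: B_def)
    have np: "n ^ (K - 1) \<ge> 1" using n by simp
    have e_bound: "\<bar>e j\<bar> \<le> (1 + C1) * n" for j
    proof -
      have "C1 / n ^ (K - 1) \<le> C1 / 1" using np C1(1) by (intro divide_left_mono) auto
      moreover have "C1 * 1 \<le> C1 * n" using C1(1) n by (intro mult_left_mono) auto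
      moreover have "0 \<le> C1 * n" using C1(1) n by simp
      ultimately have "r j \<le> n + C1 * n" "0 \<le> n + C1 * n" using n by (auto simp: r_def)
      then show ?thesis using e(3,4) by (cases "j \<in> B") (auto simp: algebra_simps intro: order_trans)
    qed
    define u where "u = e \<star> b1"
    have u: "u \<in> L" using e(1) frame(1) by (simp add: u_def multipliers_def)
    \<comment> \<open>the summand \<open>s * R\<close> pays for rounding \<open>x0\<close> to the lattice\<close>
    define t where "t = n ^ (K + 1) + s * R"
    obtain x0 where x0: "\<forall>j<m. symp b1 x0 j = (if j = i then t else 0)"
      using symp_solve[OF frame_nonzero(1), of "\<lambda>j. if j = i then t else 0"] ..
    obtain x where x: "x \<in> L" "bounded_by m R (x0 - x)" using R(2) by blast
    have close: "\<bar>symp b1 x j - (if j = i then t else 0)\<bar> \<le> s * R" if j: "j < m" for j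
    proof -
      have "bounded_by m (s * R) (symp b1 (x0 - x))" using s x(2) by (intro bounded_by_symp) auto
      then have "\<bar>symp b1 (x0 - x) j\<bar> \<le> s * R" using j by (auto dest: bounded_byD)
      moreover have "symp b1 (x0 - x) j = (if j = i then t else 0) - symp b1 x j"
        using x0 j by (simp add: symp_diff_right)
      ultimately show ?thesis by (simp add: abs_minus_commute)
    qed
    have at_i: "n ^ (K + 1) \<le> symp b1 x i" "symp b1 x i \<le> n ^ (K + 1) + 2 * s * R"
      using close[OF i(1)] unfolding t_def by auto
    have n2: "n * n \<ge> n" "n\<^sup>2 \<ge> 1" using n by (auto intro: one_le_power)
    have sym_u: "symp u w = e \<star> symp b1 w" for w unfolding u_def by (rule symp_scale_left)
    have "bounded_by m (C * n) u"
      unfolding bounded_by_def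
    proof (intro allI impI)
      fix j assume j: "j < m"
      have "cmod (u j) \<le> ((1 + C1) * n) * s"
        unfolding u_def scale_apply norm_scaleR
        using e_bound[of j] bounded_byD[OF s(2) j] C1(1) n by (intro mult_mono) auto
      also have "\<dots> = ((1 + C1) * s) * n" by simp
      also have "\<dots> \<le> C * n" using C(3) n by (intro mult_right_mono) auto
      finally show "norm (u j) \<le> C * n" .
    qed
    moreover have "bounded_by m (C * n\<^sup>2) (symp u x)"
      unfolding bounded_by_def
    proof (intro allI impI)
      fix j assume j: "j < m"
      have eq: "norm (symp u x j) = \<bar>e j\<bar> * \<bar>symp b1 x j\<bar>" by (simp add: sym_u abs_mult)
      consider "j \<notin> B" | "j = i" | "j \<in> B" "j \<noteq> i" by blast
      then show "norm (symp u x j) \<le> C * n\<^sup>2"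
      proof cases
        case 1
        then show ?thesis unfolding eq using e(3) C(1) by simp
      next
        case 2
        have "symp b1 x i \<ge> 0" using at_i(1) n zero_le_power[of n "K + 1"] by linarith
        then have "\<bar>symp b1 x j\<bar> \<le> n ^ (K + 1) + 2 * s * R" using at_i(2) 2 by simp
        moreover have "\<bar>e j\<bar> \<le> C1 / n ^ (K - 1)" using e(4) iB 2 by (auto simp: r_def)
        ultimately have "\<bar>e j\<bar> * \<bar>symp b1 x j\<bar> \<le> C1 / n ^ (K - 1) * (n ^ (K + 1) + 2 * s * R)"
          using C1(1) n by (intro mult_mono) auto
        also have "\<dots> = C1 * (n ^ (K + 1) / n ^ (K - 1)) + C1 * (2 * s * R) / n ^ (K - 1)"
          by (simp add: distrib_left)
        also have "n ^ (K + 1) / n ^ (K - 1) = n\<^sup>2"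
        proof -
          have "K + 1 = 2 + (K - 1)" using K by simp
          then have "n ^ (K + 1) = n\<^sup>2 * n ^ (K - 1)" by (metis power_add)
          then show ?thesis using n by simp
        qed
        also have "C1 * (2 * s * R) / n ^ (K - 1) \<le> C1 * (2 * s * R) / 1"
          using np C1(1) sR by (intro divide_left_mono) (auto simp: mult.assoc)
        also have "\<dots> \<le> C1 * (2 * s * R) * n\<^sup>2"
          using n2(2) C1(1) sR mult_left_mono[of 1 "n\<^sup>2" "C1 * (2 * s * R)"] by (simp add: mult.assoc)
        finally have "\<bar>e j\<bar> * \<bar>symp b1 x j\<bar> \<le> C1 * (1 + 2 * s * R) * n\<^sup>2" by (simp add: algebra_simps)
        also have "\<dots> \<le> C * n\<^sup>2" using C(4) by (intro mult_right_mono) auto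
        finally show ?thesis unfolding eq .
      next
        case 3
        then have "\<bar>e j\<bar> \<le> n" using e(4) by (auto simp: r_def)
        moreover have "\<bar>symp b1 x j\<bar> \<le> s * R" using close[OF j] 3 by simp
        ultimately have "\<bar>e j\<bar> * \<bar>symp b1 x j\<bar> \<le> n * (s * R)" using n by (intro mult_mono) auto
        also have "\<dots> \<le> n\<^sup>2 * C" using n2(1) C(5) sR n
          by (intro mult_mono) (auto simp: power2_eq_square)
        finally show ?thesis unfolding eq by (simp add: mult.commute)
      qed
    qed
    moreover have "\<exists>i<m. n ^ (K + 1) \<le> C * cmod (w i)" if w: "w \<in> L" "symp u w = symp u x" for w
    proof -
      have "e i * symp b1 w i = e i * symp b1 x i"
        using fun_cong[OF w(2), of i] by (simp add: sym_u)
      then have "symp b1 w i = symp b1 x i" using ei by simp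
      then have "n ^ (K + 1) \<le> \<bar>symp b1 w i\<bar>" using at_i(1) by simp
      also have "\<dots> \<le> cmod (b1 i) * cmod (w i)" by (rule norm_symp_le)
      also have "\<dots> \<le> C * cmod (w i)"
        using bounded_byD[OF s(2) i(1)] C(2) by (intro mult_right_mono) auto
      finally show ?thesis using i(1) by blast
    qed
    ultimately show ?thesis using u x(1) by blast
  qed
  then show ?thesis using C(1) unfolding K_def by blast
qed

end

section \<open>Word norms\<close>

locale generated_group = group G for G (structure) +
  fixes S
  assumes gen: "finite_generating_set G S"
begin

abbreviation letters :: "'a set" where "letters \<equiv> S \<union> m_inv G ` S"

abbreviation eval_word :: "'a list \<Rightarrow> 'a" where "eval_word ws \<equiv> foldr (\<otimes>) ws \<one>"

abbreviation wn :: "'a \<Rightarrow> nat" where "wn \<equiv> word_norm G S"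

lemma letters_closed: "letters \<subseteq> carrier G"
  using gen by (auto simp: finite_generating_set_def)

lemma finite_letters: "finite letters"
  using gen by (auto simp: finite_generating_set_def)

lemma eval_word_closed: "set ws \<subseteq> letters \<Longrightarrow> eval_word ws \<in> carrier G"
proof (induction ws)
  case (Cons a ws)
  then have "a \<in> carrier G" using letters_closed by auto
  then show ?case using Cons by simp
qed simp

lemma eval_word_append:
  "set ws \<subseteq> letters \<Longrightarrow> set vs \<subseteq> letters \<Longrightarrow> eval_word (ws @ vs) = eval_word ws \<otimes> eval_word vs"
proof (induction ws)
  case Nil
  then show ?case using eval_word_closed by simp
next
  case (Cons a ws)
  then have "a \<in> carrier G" using letters_closed by auto
  then show ?case using Cons eval_word_closed by (simp add: m_assoc)
qed

lemma letters_inv: "a \<in> letters \<Longrightarrow> inv a \<in> letters"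
  using gen by (auto simp: finite_generating_set_def)

lemma word_exists: assumes "g \<in> carrier G" shows "\<exists>ws. set ws \<subseteq> letters \<and> eval_word ws = g"
proof -
  have sub: "S \<subseteq> carrier G" using gen by (simp add: finite_generating_set_def)
  have "g \<in> generate G S" using assms gen by (simp add: finite_generating_set_def)
  then show ?thesis
  proof (induction rule: generate.induct)
    case one
    show ?case by (intro exI[of _ "[]"]) simp
  next
    case (incl h)
    then show ?case using sub by (intro exI[of _ "[h]"]) auto
  next
    case (inv h)
    then show ?case using sub by (intro exI[of _ "[inv h]"]) auto
  next
    case (eng h1 h2)
    then obtain ws vs where "set ws \<subseteq> letters" "eval_word ws = h1" "set vs \<subseteq> letters" "eval_word vs = h2"
      by blast
    then show ?case using eval_word_append[of ws vs] by (intro exI[of _ "ws @ vs"]) auto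
  qed
qed

lemma word_norm_attained:
  assumes "g \<in> carrier G"
  obtains ws where "set ws \<subseteq> letters" "eval_word ws = g" "length ws = wn g"
proof -
  have "\<exists>k ws. length ws = k \<and> set ws \<subseteq> letters \<and> eval_word ws = g"
    using word_exists[OF assms] by blast
  then have "\<exists>ws. length ws = wn g \<and> set ws \<subseteq> letters \<and> eval_word ws = g"
    unfolding word_norm_def by (rule LeastI_ex)
  then show thesis using that by blast
qed

lemma word_norm_le: "set ws \<subseteq> letters \<Longrightarrow> eval_word ws = g \<Longrightarrow> wn g \<le> length ws"
  unfolding word_norm_def by (intro Least_le) blast

lemma word_norm_one: "wn \<one> = 0"
  using word_norm_le[of "[]" \<one>] by simp

lemma word_norm_mult:
  assumes "g \<in> carrier G" "h \<in> carrier G"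
  shows "wn (g \<otimes> h) \<le> wn g + wn h"
proof -
  obtain ws where ws: "set ws \<subseteq> letters" "eval_word ws = g" "length ws = wn g"
    using word_norm_attained[OF assms(1)] by blast
  obtain vs where vs: "set vs \<subseteq> letters" "eval_word vs = h" "length vs = wn h"
    using word_norm_attained[OF assms(2)] by blast
  have "wn (g \<otimes> h) \<le> length (ws @ vs)"
    using ws vs eval_word_append[of ws vs] by (intro word_norm_le) auto
  then show ?thesis using ws vs by simp
qed

lemma word_norm_inv:
  assumes "g \<in> carrier G"
  shows "wn (inv g) \<le> wn g"
proof -
  have *: "set (rev (map (m_inv G) ws)) \<subseteq> letters \<and> eval_word (rev (map (m_inv G) ws)) = inv (eval_word ws)"
    if "set ws \<subseteq> letters" for ws
    using that
  proof (induction ws)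
    case (Cons a ws)
    have a: "a \<in> letters" "a \<in> carrier G" "inv a \<in> letters" "inv a \<in> carrier G"
      using Cons.prems letters_closed letters_inv by auto
    have IH: "set (rev (map (m_inv G) ws)) \<subseteq> letters" "eval_word (rev (map (m_inv G) ws)) = inv (eval_word ws)"
      using Cons by auto
    have "eval_word (rev (map (m_inv G) ws) @ [inv a]) = inv (eval_word ws) \<otimes> inv a"
      using eval_word_append[OF IH(1), of "[inv a]"] a IH(2) by simp
    also have "\<dots> = inv (a \<otimes> eval_word ws)"
      using a eval_word_closed[of ws] Cons.prems by (simp add: inv_mult_group)
    finally show ?case using IH(1) a(3) by simp
  qed simp
  obtain ws where ws: "set ws \<subseteq> letters" "eval_word ws = g" "length ws = wn g"
    using word_norm_attained[OF assms] by blast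
  have "wn (inv g) \<le> length (rev (map (m_inv G) ws))"
    using *[OF ws(1)] ws(2) by (intro word_norm_le) auto
  then show ?thesis using ws by simp
qed

lemma finite_ball: "finite {g \<in> carrier G. wn g \<le> n}"
proof (rule finite_subset)
  show "{g \<in> carrier G. wn g \<le> n} \<subseteq> eval_word ` {ws. set ws \<subseteq> letters \<and> length ws \<le> n}"
  proof
    fix g assume g: "g \<in> {g \<in> carrier G. wn g \<le> n}"
    then have "g \<in> carrier G" by blast
    then obtain ws where "set ws \<subseteq> letters" "eval_word ws = g" "length ws = wn g"
      by (rule word_norm_attained)
    then show "g \<in> eval_word ` {ws. set ws \<subseteq> letters \<and> length ws \<le> n}" using g by (intro image_eqI[of _ _ ws]) auto
  qed
  show "finite (eval_word ` {ws. set ws \<subseteq> letters \<and> length ws \<le> n})"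
    by (intro finite_imageI finite_lists_length_le finite_letters)
qed

lemma conjugator_length_le: "conjugates G x u v \<Longrightarrow> conjugator_length G S u v \<le> wn x"
  unfolding conjugator_length_def by (intro Least_le) blast

lemma conjugator_length_attained:
  assumes "conjugates G x u v"
  obtains y where "conjugates G y u v" "wn y = conjugator_length G S u v"
proof -
  have "\<exists>k y. conjugates G y u v \<and> wn y = k" using assms by blast
  then have "\<exists>y. conjugates G y u v \<and> wn y = conjugator_length G S u v"
    unfolding conjugator_length_def by (rule LeastI_ex)
  then show thesis using that by blast
qed

lemma conjugator_length_function:
  defines "P n u v \<equiv> u \<in> carrier G \<and> v \<in> carrier G \<and> (\<exists>x. conjugates G x u v) \<and> wn u \<le> n \<and> wn v \<le> n"
  shows "P n u v \<Longrightarrow> conjugator_length G S u v \<le> conjugator_length_function G S n"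
    "\<exists>u v. P n u v \<and> conjugator_length G S u v = conjugator_length_function G S n"
proof -
  define A where "A = {conjugator_length G S u v | u v. P n u v}"
  have A: "conjugator_length_function G S n = Max A"
    unfolding conjugator_length_function_def A_def P_def ..
  have "A \<subseteq> (\<lambda>(u, v). conjugator_length G S u v) ` ({g \<in> carrier G. wn g \<le> n} \<times> {g \<in> carrier G. wn g \<le> n})"
    by (auto simp: A_def P_def)
  then have fin: "finite A"
    by (rule finite_subset) (intro finite_imageI finite_cartesian_product finite_ball)
  have "conjugates G \<one> \<one> \<one>" by (simp add: conjugates_def)
  then have "P n \<one> \<one>" unfolding P_def using word_norm_one by auto
  then have ne: "A \<noteq> {}" unfolding A_def by blast
  show "conjugator_length G S u v \<le> conjugator_length_function G S n" if "P n u v"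
    unfolding A using fin by (rule Max_ge) (use that in \<open>auto simp: A_def\<close>)
  have "Max A \<in> A" using fin ne by (rule Max_in)
  then obtain u v where "Max A = conjugator_length G S u v" "P n u v" unfolding A_def by blast
  then show "\<exists>u v. P n u v \<and> conjugator_length G S u v = conjugator_length_function G S n"
    unfolding A by metis
qed

end

text \<open>Walk along the segment from \<open>0\<close> to \<open>d\<close> in \<open>n\<close> steps of length at most
  \<open>1\<close> and round each point to \<open>D\<close>; successive lattice points differ by one of finitely many bounded
  elements. The predicate form yields finite generation as well as a linear bound on word norms.\<close>

lemma short_path:
  fixes D :: "(nat \<Rightarrow> 'v::real_normed_vector) set"
  assumes D: "add_subgroup D" "rel_dense m D"
  shows "\<exists>R. \<forall>P :: nat \<Rightarrow> (nat \<Rightarrow> 'v) \<Rightarrow> bool. (\<forall>f\<in>D. bounded_by m R f \<longrightarrow> P 1 f) \<longrightarrow>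
    (\<forall>n. \<forall>a\<in>D. \<forall>f\<in>D. P n a \<longrightarrow> bounded_by m R f \<longrightarrow> P (n + 1) (a + f)) \<longrightarrow>
    (\<forall>d\<in>D. \<forall>n. bounded_by m (real n) d \<longrightarrow> P (n + 1) d)"
proof -
  obtain R where R: "R \<ge> 1" "\<And>x. \<exists>d\<in>D. bounded_by m R (x - d)" using rel_denseE[OF D(2)] by blast
  have "P (n + 1) d"
    if P1: "\<And>f. f \<in> D \<Longrightarrow> bounded_by m (1 + 2 * R) f \<Longrightarrow> P 1 f"
      and P2: "\<And>n a f. a \<in> D \<Longrightarrow> f \<in> D \<Longrightarrow> P n a \<Longrightarrow> bounded_by m (1 + 2 * R) f \<Longrightarrow> P (n + 1) (a + f)"
      and "d \<in> D" "bounded_by m (real n) x" "bounded_by m R (x - d)"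
    for P :: "nat \<Rightarrow> (nat \<Rightarrow> 'v) \<Rightarrow> bool" and d n x
    using that(3-)
  proof (induction n arbitrary: d x)
    case 0
    have "bounded_by m (1 + 2 * R) d"
      unfolding bounded_by_def
    proof (intro allI impI)
      fix i assume i: "i < m"
      have "x i = 0" using bounded_byD[OF 0(2) i] by simp
      then have "norm (d i) \<le> R" using bounded_byD[OF 0(3) i] by simp
      then show "norm (d i) \<le> 1 + 2 * R" using R(1) by simp
    qed
    then show ?case using P1[OF 0(1)] by simp
  next
    case (Suc n)
    define x' where "x' = const_vec (real n / real (Suc n)) \<star> x"
    obtain d' where d': "d' \<in> D" "bounded_by m R (x' - d')" using R(2) by blast
    have x': "norm (x' i) \<le> real n" "norm (x i - x' i) \<le> 1" if i: "i < m" for i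
    proof -
      have xi: "norm (x i) \<le> real (Suc n)" using bounded_byD[OF Suc(3) i] .
      have "norm (x' i) = real n / real (Suc n) * norm (x i)" by (simp add: x'_def)
      also have "\<dots> \<le> real n / real (Suc n) * real (Suc n)" using xi by (intro mult_left_mono) auto
      finally show "norm (x' i) \<le> real n" by simp
      have "x i - x' i = (1 - real n / real (Suc n)) *\<^sub>R x i" by (simp add: x'_def algebra_simps)
      also have "1 - real n / real (Suc n) = 1 / real (Suc n)" by (simp add: field_simps)
      finally have "norm (x i - x' i) = norm (x i) / real (Suc n)" by simp
      also have "\<dots> \<le> 1" using xi by simp
      finally show "norm (x i - x' i) \<le> 1" .
    qed
    have "bounded_by m (real n) x'" using x' by (simp add: bounded_by_def)
    then have "P (n + 1) d'" by (rule Suc.IH[OF d'(1) _ d'(2)])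
    moreover have "bounded_by m (1 + 2 * R) (d - d')"
      unfolding bounded_by_def
    proof (intro allI impI)
      fix i assume i: "i < m"
      have "norm ((x i - x' i) + (x' i - d' i)) \<le> 1 + R"
        using x'(2)[OF i] bounded_byD[OF d'(2) i] by (intro norm_triangle_mono) auto
      moreover have "norm (x i - d i) \<le> R" using bounded_byD[OF Suc(4) i] by simp
      ultimately have "norm (((x i - x' i) + (x' i - d' i)) - (x i - d i)) \<le> (1 + R) + R"
        by (meson add_mono norm_triangle_ineq4 order_trans)
      then show "norm ((d - d') i) \<le> 1 + 2 * R" by (simp add: algebra_simps)
    qed
    moreover have "d - d' \<in> D" using Suc(2) d'(1) by (rule add_subgroup_diff[OF D(1)])
    ultimately have "P (n + 1 + 1) (d' + (d - d'))" using d'(1) by (intro P2) auto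
    then show ?case by simp
  qed
  note * = this
  have zero: "bounded_by m R (d - d)" for d :: "nat \<Rightarrow> 'v" using R(1) by (simp add: bounded_by_def)
  show ?thesis
  proof (intro exI[of _ "1 + 2 * R"] allI impI ballI)
    fix P :: "nat \<Rightarrow> (nat \<Rightarrow> 'v) \<Rightarrow> bool" and d n
    assume P1: "\<forall>f\<in>D. bounded_by m (1 + 2 * R) f \<longrightarrow> P 1 f"
      and P2: "\<forall>n. \<forall>a\<in>D. \<forall>f\<in>D. P n a \<longrightarrow> bounded_by m (1 + 2 * R) f \<longrightarrow> P (n + 1) (a + f)"
      and d: "d \<in> D" "bounded_by m (real n) d"
    show "P (n + 1) d"
      by (rule *[OF _ _ d zero]) (use P1 P2 in blast)+
  qed
qed

lemma subadditive_linear_bound: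
  fixes D :: "(nat \<Rightarrow> 'v::real_normed_vector) set" and N :: "(nat \<Rightarrow> 'v) \<Rightarrow> nat"
  assumes D: "add_subgroup D" "rel_dense m D" "loc_finite m D"
    and N: "\<And>a b. a \<in> D \<Longrightarrow> b \<in> D \<Longrightarrow> N (a + b) \<le> N a + N b"
  shows "\<exists>C\<ge>1. \<forall>r\<ge>1. \<forall>d\<in>D. bounded_by m r d \<longrightarrow> real (N d) \<le> C * r"
proof -
  obtain R where R: "\<And>P :: nat \<Rightarrow> (nat \<Rightarrow> 'v) \<Rightarrow> bool. (\<forall>f\<in>D. bounded_by m R f \<longrightarrow> P 1 f) \<Longrightarrow>
    (\<forall>n. \<forall>a\<in>D. \<forall>f\<in>D. P n a \<longrightarrow> bounded_by m R f \<longrightarrow> P (n + 1) (a + f)) \<Longrightarrow>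
    (\<forall>d\<in>D. \<forall>n. bounded_by m (real n) d \<longrightarrow> P (n + 1) d)"
    using short_path[OF D(1,2)] by blast
  define F where "F = {d \<in> D. bounded_by m R d}"
  have fin: "finite F" unfolding F_def by (rule loc_finiteD[OF D(3)])
  define C where "C = 1 + (\<Sum>f\<in>F. N f)"
  have C: "N f \<le> C" if "f \<in> D" "bounded_by m R f" for f
    using member_le_sum[of f F N] fin that by (simp add: C_def F_def)
  have main: "\<forall>d\<in>D. \<forall>n. bounded_by m (real n) d \<longrightarrow> N d \<le> C * (n + 1)"
  proof (rule R[of "\<lambda>n d. N d \<le> C * n"])
    show "\<forall>f\<in>D. bounded_by m R f \<longrightarrow> N f \<le> C * 1" using C by simp
    show "\<forall>n. \<forall>a\<in>D. \<forall>f\<in>D. N a \<le> C * n \<longrightarrow> bounded_by m R f \<longrightarrow> N (a + f) \<le> C * (n + 1)"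
    proof (intro allI ballI impI)
      fix n a f assume h: "a \<in> D" "f \<in> D" "N a \<le> C * n" "bounded_by m R f"
      have "N (a + f) \<le> N a + N f" using N h by blast
      also have "\<dots> \<le> C * n + C" using h C by (intro add_mono) auto
      finally show "N (a + f) \<le> C * (n + 1)" by simp
    qed
  qed
  have "real (N d) \<le> (3 * real C) * r" if r: "r \<ge> 1" and d: "d \<in> D" "bounded_by m r d" for r d
  proof -
    define n where "n = nat \<lceil>r\<rceil>"
    have n: "r \<le> real n" "real n \<le> r + 1" unfolding n_def using r by linarith+
    have "N d \<le> C * (n + 1)" using main d(1) bounded_by_mono[OF d(2) n(1)] by blast
    then have "real (N d) \<le> real (C * (n + 1))" by (rule of_nat_mono)
    also have "\<dots> = real C * (real n + 1)" by (simp add: distrib_left)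
    also have "\<dots> \<le> real C * (3 * r)" using n r by (intro mult_left_mono) auto
    finally show ?thesis by simp
  qed
  moreover have "C \<ge> 1" by (simp add: C_def)
  then have "3 * real C \<ge> 1" by linarith
  ultimately show ?thesis by blast
qed

section \<open>Heisenberg lattices in coordinates\<close>

text \<open>An abstract group with the coordinates \<open>(w, z)\<close>: \<open>W\<close> is the projection modulo the
  centre and \<open>Z\<close> the symmetrised central coordinate, for which inversion is negation. A lattice enters through
  cocompactness modulo the centre and discreteness of the centre.\<close>

locale heisenberg_lattice = group G for G (structure) +
  fixes m :: nat and W :: "'a \<Rightarrow> nat \<Rightarrow> complex" and Z :: "'a \<Rightarrow> nat \<Rightarrow> real"
  assumes W_supported: "\<And>g. supported m (W g)" and Z_supported: "\<And>g. supported m (Z g)"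
    and W_mult: "\<And>g h. g \<in> carrier G \<Longrightarrow> h \<in> carrier G \<Longrightarrow> W (g \<otimes> h) = W g + W h"
    and Z_mult: "\<And>g h. g \<in> carrier G \<Longrightarrow> h \<in> carrier G \<Longrightarrow>
      Z (g \<otimes> h) = Z g + Z h + const_vec (1 / 2) \<star> symp (W g) (W h)"
    and coords_inj: "\<And>g h. g \<in> carrier G \<Longrightarrow> h \<in> carrier G \<Longrightarrow> W g = W h \<Longrightarrow> Z g = Z h \<Longrightarrow> g = h"
    and W_rel_dense: "rel_dense m (W ` carrier G)"
    and center_discrete: "\<exists>\<epsilon>>0. \<forall>g\<in>carrier G. W g = 0 \<longrightarrow> (\<forall>i<m. \<bar>Z g i\<bar> < \<epsilon>) \<longrightarrow> Z g = 0"
begin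

abbreviation proj :: "(nat \<Rightarrow> complex) set" where "proj \<equiv> W ` carrier G"

abbreviation center_coords :: "(nat \<Rightarrow> real) set"
  where "center_coords \<equiv> Z ` {g \<in> carrier G. W g = 0}"

lemma symp_self: "symp u u = 0"
  by (rule ext) (simp add: symp_apply)

lemma W_one: "W \<one> = 0"
  using W_mult[of \<one> \<one>] by simp

lemma Z_one: "Z \<one> = 0"
proof
  fix i
  have "Z (\<one> \<otimes> \<one>) i = Z \<one> i + Z \<one> i"
    unfolding Z_mult[OF one_closed one_closed] by (simp add: W_one symp_self)
  then show "Z \<one> i = 0 i" by simp
qed

lemma W_inv: assumes "g \<in> carrier G" shows "W (inv g) = - W g"
  using W_mult[of "inv g" g] assms W_one by (simp add: eq_neg_iff_add_eq_0)

lemma Z_inv: assumes "g \<in> carrier G" shows "Z (inv g) = - Z g"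
proof
  fix i
  have "Z (inv g \<otimes> g) i = Z (inv g) i + Z g i + (1 / 2) * symp (W (inv g)) (W g) i"
    using Z_mult[of "inv g" g] assms by simp
  moreover have "symp (W (inv g)) (W g) i = 0" using assms by (simp add: W_inv symp_apply)
  ultimately show "Z (inv g) i = (- Z g) i" using assms by (simp add: Z_one)
qed

lemma W_conj: assumes "u \<in> carrier G" "x \<in> carrier G" shows "W (inv x \<otimes> u \<otimes> x) = W u"
  using assms by (simp add: W_mult W_inv)

lemma Z_conj: assumes "u \<in> carrier G" "x \<in> carrier G"
  shows "Z (inv x \<otimes> u \<otimes> x) = Z u + symp (W u) (W x)"
proof
  fix i
  have "Z (inv x \<otimes> u \<otimes> x) i = - Z x i + Z u i + (1 / 2) * symp (- W x) (W u) i + Z x i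
      + (1 / 2) * symp (- W x + W u) (W x) i"
    using assms by (simp add: Z_mult W_mult W_inv Z_inv)
  then show "Z (inv x \<otimes> u \<otimes> x) i = (Z u + symp (W u) (W x)) i"
    by (simp add: symp_apply algebra_simps)
qed

lemma conjugates_iff:
  assumes "u \<in> carrier G" "v \<in> carrier G"
  shows "conjugates G x u v \<longleftrightarrow> x \<in> carrier G \<and> W v = W u \<and> Z v = Z u + symp (W u) (W x)"
proof (cases "x \<in> carrier G")
  case True
  show ?thesis
  proof
    assume "conjugates G x u v"
    then have "v = inv x \<otimes> u \<otimes> x" by (simp add: conjugates_def)
    then show "x \<in> carrier G \<and> W v = W u \<and> Z v = Z u + symp (W u) (W x)"
      using True assms(1) W_conj Z_conj by metis
  next
    assume "x \<in> carrier G \<and> W v = W u \<and> Z v = Z u + symp (W u) (W x)"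
    then have "inv x \<otimes> u \<otimes> x = v"
      using True assms W_conj Z_conj by (intro coords_inj) auto
    then show "conjugates G x u v" using True by (simp add: conjugates_def)
  qed
qed (simp add: conjugates_def)

lemma commutator:
  assumes "u \<in> carrier G" "x \<in> carrier G"
  shows "inv u \<otimes> (inv x \<otimes> u \<otimes> x) \<in> carrier G" "W (inv u \<otimes> (inv x \<otimes> u \<otimes> x)) = 0"
    "Z (inv u \<otimes> (inv x \<otimes> u \<otimes> x)) = symp (W u) (W x)"
proof -
  show "inv u \<otimes> (inv x \<otimes> u \<otimes> x) \<in> carrier G" using assms by simp
  show "W (inv u \<otimes> (inv x \<otimes> u \<otimes> x)) = 0"
    using assms W_mult[of "inv u" "inv x \<otimes> u \<otimes> x"] by (simp add: W_inv W_conj)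
  show "Z (inv u \<otimes> (inv x \<otimes> u \<otimes> x)) = symp (W u) (W x)"
  proof
    fix i
    have "Z (inv u \<otimes> (inv x \<otimes> u \<otimes> x)) i = - Z u i + (Z u + symp (W u) (W x)) i + (1 / 2) * symp (- W u) (W u) i"
      using assms Z_mult[of "inv u" "inv x \<otimes> u \<otimes> x"] by (simp add: Z_inv W_inv W_conj Z_conj)
    then show "Z (inv u \<otimes> (inv x \<otimes> u \<otimes> x)) i = symp (W u) (W x) i" by (simp add: symp_apply)
  qed
qed

lemma Z_mult_central:
  assumes "g \<in> carrier G" "h \<in> carrier G" "W g = 0 \<or> W h = 0"
  shows "Z (g \<otimes> h) = Z g + Z h"
  using assms by (intro ext) (auto simp: Z_mult symp_apply)

sublocale lattice_pair m proj center_coords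
proof
  show "add_subgroup proj"
    unfolding add_subgroup_def
  proof (intro conjI ballI)
    show "0 \<in> proj" using W_one by (metis image_eqI one_closed)
    fix a b assume "a \<in> proj" "b \<in> proj"
    then obtain g h where g: "g \<in> carrier G" "h \<in> carrier G" "a = W g" "b = W h" by blast
    then have "a - b = W (g \<otimes> inv h)" by (simp add: W_mult W_inv)
    then show "a - b \<in> proj" using g by simp
  qed
  show cen: "add_subgroup center_coords"
    unfolding add_subgroup_def
  proof (intro conjI ballI)
    show "0 \<in> center_coords" by (rule image_eqI[of _ _ \<one>]) (simp_all add: W_one Z_one)
    fix a b assume "a \<in> center_coords" "b \<in> center_coords"
    then obtain g h where g: "g \<in> carrier G" "h \<in> carrier G" "W g = 0" "W h = 0" "a = Z g" "b = Z h"
      by blast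
    then have "a - b = Z (g \<otimes> inv h)" "W (g \<otimes> inv h) = 0"
      by (simp_all add: Z_mult_central Z_inv W_mult W_inv)
    then show "a - b \<in> center_coords" using g by (intro image_eqI[of _ _ "g \<otimes> inv h"]) auto
  qed
  show supp: "supported m z" if "z \<in> center_coords" for z using that Z_supported by blast
  show "supported m w" if "w \<in> proj" for w using that W_supported by blast
  show "rel_dense m proj" by (rule W_rel_dense)
  show "symp u v \<in> center_coords" if uv: "u \<in> proj" "v \<in> proj" for u v
  proof -
    obtain g h where g: "g \<in> carrier G" "h \<in> carrier G" "u = W g" "v = W h" using uv by blast
    show ?thesis unfolding g(3,4)
      using commutator[OF g(1,2)] by (intro image_eqI[of _ _ "inv g \<otimes> (inv h \<otimes> g \<otimes> h)"]) auto
  qed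
  obtain \<epsilon> where \<epsilon>: "\<epsilon> > 0" "\<And>g. g \<in> carrier G \<Longrightarrow> W g = 0 \<Longrightarrow> (\<forall>i<m. \<bar>Z g i\<bar> < \<epsilon>) \<Longrightarrow> Z g = 0"
    using center_discrete by blast
  show "loc_finite m center_coords"
  proof (rule loc_finite_real[OF cen supp \<epsilon>(1)])
    fix d assume d: "d \<in> center_coords" "\<And>i. i < m \<Longrightarrow> \<bar>d i\<bar> < \<epsilon>"
    then obtain g where "g \<in> carrier G" "W g = 0" "d = Z g" by blast
    then show "d = 0" using \<epsilon>(2)[of g] d(2) by simp
  qed
qed

definition central_elt :: "(nat \<Rightarrow> real) \<Rightarrow> 'a"
  where "central_elt z = (SOME g. g \<in> carrier G \<and> W g = 0 \<and> Z g = z)"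

lemma central_elt:
  assumes "z \<in> center_coords"
  shows "central_elt z \<in> carrier G" "W (central_elt z) = 0" "Z (central_elt z) = z"
proof -
  have "\<exists>g. g \<in> carrier G \<and> W g = 0 \<and> Z g = z" using assms by blast
  then have "central_elt z \<in> carrier G \<and> W (central_elt z) = 0 \<and> Z (central_elt z) = z"
    unfolding central_elt_def by (rule someI_ex)
  then show "central_elt z \<in> carrier G" "W (central_elt z) = 0" "Z (central_elt z) = z" by auto
qed

lemma central_eltI: "g \<in> carrier G \<Longrightarrow> W g = 0 \<Longrightarrow> Z g = z \<Longrightarrow> central_elt z = g"
  using central_elt[of z] by (intro coords_inj) auto

lemma central_elt_add:
  assumes "a \<in> center_coords" "b \<in> center_coords"
  shows "central_elt (a + b) = central_elt a \<otimes> central_elt b"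
  using central_elt[OF assms(1)] central_elt[OF assms(2)]
  by (intro central_eltI) (auto simp: W_mult Z_mult_central)

lemma finitely_generated: "\<exists>S. finite_generating_set G S"
proof -
  define lift where "lift w = (SOME g. g \<in> carrier G \<and> W g = w)" for w
  have lift: "lift w \<in> carrier G" "W (lift w) = w" if "w \<in> proj" for w
  proof -
    have "\<exists>g. g \<in> carrier G \<and> W g = w" using that by blast
    then have "lift w \<in> carrier G \<and> W (lift w) = w" unfolding lift_def by (rule someI_ex)
    then show "lift w \<in> carrier G" "W (lift w) = w" by auto
  qed
  obtain R where R: "\<And>P :: nat \<Rightarrow> (nat \<Rightarrow> complex) \<Rightarrow> bool. (\<forall>f\<in>proj. bounded_by m R f \<longrightarrow> P 1 f) \<Longrightarrow>
    (\<forall>n. \<forall>a\<in>proj. \<forall>f\<in>proj. P n a \<longrightarrow> bounded_by m R f \<longrightarrow> P (n + 1) (a + f)) \<Longrightarrow>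
    (\<forall>d\<in>proj. \<forall>n. bounded_by m (real n) d \<longrightarrow> P (n + 1) d)"
    using short_path[OF L_subgroup L_rel_dense] by blast
  obtain R' where R': "\<And>P :: nat \<Rightarrow> (nat \<Rightarrow> real) \<Rightarrow> bool. (\<forall>f\<in>center_coords. bounded_by m R' f \<longrightarrow> P 1 f) \<Longrightarrow>
    (\<forall>n. \<forall>a\<in>center_coords. \<forall>f\<in>center_coords. P n a \<longrightarrow> bounded_by m R' f \<longrightarrow> P (n + 1) (a + f)) \<Longrightarrow>
    (\<forall>d\<in>center_coords. \<forall>n. bounded_by m (real n) d \<longrightarrow> P (n + 1) d)"
    using short_path[OF \<Lambda>_subgroup \<Lambda>_rel_dense] by blast
  define S1 where "S1 = lift ` {w \<in> proj. bounded_by m R w}"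
  define S2 where "S2 = central_elt ` {z \<in> center_coords. bounded_by m R' z}"
  define S where "S = S1 \<union> S2"
  have fin: "finite S"
    unfolding S_def S1_def S2_def
    by (intro finite_UnI finite_imageI loc_finiteD L_loc_finite \<Lambda>_loc_finite)
  have SG: "S \<subseteq> carrier G" using lift central_elt by (auto simp: S_def S1_def S2_def)
  have big: "\<exists>n. bounded_by m (real n) v" for v :: "nat \<Rightarrow> 'v::real_normed_vector"
    using bounded_by_exists[of m v] real_arch_simple bounded_by_mono by metis
  have gen1: "\<exists>g\<in>generate G S. W g = w" if w: "w \<in> proj" for w
  proof -
    have "\<forall>d\<in>proj. \<forall>n. bounded_by m (real n) d \<longrightarrow> (\<exists>g\<in>generate G S. W g = d)"
    proof (rule R[of "\<lambda>_ d. \<exists>g\<in>generate G S. W g = d"])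
      have base: "\<exists>g\<in>generate G S. W g = f" if "f \<in> proj" "bounded_by m R f" for f
      proof
        show "lift f \<in> generate G S" using that by (intro generate.incl) (auto simp: S_def S1_def)
        show "W (lift f) = f" using lift that by blast
      qed
      then show "\<forall>f\<in>proj. bounded_by m R f \<longrightarrow> (\<exists>g\<in>generate G S. W g = f)" by blast
      show "\<forall>n. \<forall>a\<in>proj. \<forall>f\<in>proj. (\<exists>g\<in>generate G S. W g = a) \<longrightarrow> bounded_by m R f \<longrightarrow>
          (\<exists>g\<in>generate G S. W g = a + f)"
      proof (intro allI ballI impI)
        fix a f assume f: "f \<in> proj" "bounded_by m R f" and a: "\<exists>g\<in>generate G S. W g = a"
        then obtain g h where gh: "g \<in> generate G S" "W g = a" "h \<in> generate G S" "W h = f"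
          using base by blast
        then have "W (g \<otimes> h) = a + f" using generate_in_carrier[OF SG] by (simp add: W_mult)
        then show "\<exists>g\<in>generate G S. W g = a + f" using gh generate.eng by metis
      qed
    qed
    then show ?thesis using w big by blast
  qed
  have gen2: "central_elt z \<in> generate G S" if z: "z \<in> center_coords" for z
  proof -
    have "\<forall>d\<in>center_coords. \<forall>n. bounded_by m (real n) d \<longrightarrow> central_elt d \<in> generate G S"
    proof (rule R'[of "\<lambda>_ d. central_elt d \<in> generate G S"])
      show base: "\<forall>f\<in>center_coords. bounded_by m R' f \<longrightarrow> central_elt f \<in> generate G S"
        by (auto intro!: generate.incl simp: S_def S2_def)
      show "\<forall>n. \<forall>a\<in>center_coords. \<forall>f\<in>center_coords. central_elt a \<in> generate G S \<longrightarrow> bounded_by m R' f \<longrightarrow>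
          central_elt (a + f) \<in> generate G S"
      proof (intro allI ballI impI)
        fix a f assume "a \<in> center_coords" "f \<in> center_coords" "central_elt a \<in> generate G S"
          "bounded_by m R' f"
        then show "central_elt (a + f) \<in> generate G S"
          unfolding central_elt_add[OF \<open>a \<in> center_coords\<close> \<open>f \<in> center_coords\<close>]
          using base by (intro generate.eng) blast+
      qed
    qed
    then show ?thesis using z big by blast
  qed
  have "g \<in> generate G S" if g: "g \<in> carrier G" for g
  proof -
    obtain h where h: "h \<in> generate G S" "W h = W g" using gen1[of "W g"] g by blast
    have hG: "h \<in> carrier G" using h generate_in_carrier[OF SG] by blast
    have W0: "W (g \<otimes> inv h) = 0" using g hG h(2) by (simp add: W_mult W_inv)
    then have "central_elt (Z (g \<otimes> inv h)) = g \<otimes> inv h" using g hG by (intro central_eltI) auto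
    moreover have "Z (g \<otimes> inv h) \<in> center_coords" using W0 g hG by (intro image_eqI[of _ _ "g \<otimes> inv h"]) auto
    ultimately have "g \<otimes> inv h \<in> generate G S" using gen2 by metis
    then have "(g \<otimes> inv h) \<otimes> h \<in> generate G S" using h(1) by (rule generate.eng)
    then show ?thesis using g hG by (simp add: m_assoc)
  qed
  then have "generate G S = carrier G" using generate_in_carrier[OF SG] by blast
  then show ?thesis using fin SG unfolding finite_generating_set_def by blast
qed

end

section \<open>Word norm and conjugator length in coordinates\<close>

locale generated_heisenberg_lattice =
  heisenberg_lattice G m W Z + generated_group G S for G (structure) and m W Z S
begin

text \<open>The coordinate \<open>w\<close> is additive, so it grows at most linearly along a word; each letter then adds at
  most a linear term to \<open>z\<close>.\<close>

lemma word_norm_lower_bound: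
  "\<exists>C\<ge>1. \<forall>g\<in>carrier G. bounded_by m (C * real (wn g)) (W g) \<and> bounded_by m (C * (real (wn g))\<^sup>2) (Z g)"
proof -
  obtain s where s: "s \<ge> 1" "\<And>a. a \<in> letters \<Longrightarrow> bounded_by m s (W a) \<and> bounded_by m s (Z a)"
  proof -
    define q where "q a = (SOME r. r \<ge> 1 \<and> bounded_by m r (W a)) + (SOME r. r \<ge> 1 \<and> bounded_by m r (Z a))" for a
    have q: "bounded_by m (q a) (W a) \<and> bounded_by m (q a) (Z a) \<and> q a \<ge> 0" for a
    proof -
      define r1 where "r1 = (SOME r. r \<ge> 1 \<and> bounded_by m r (W a))"
      define r2 where "r2 = (SOME r. r \<ge> 1 \<and> bounded_by m r (Z a))"
      have "\<exists>r. r \<ge> 1 \<and> bounded_by m r (W a)" using bounded_by_exists by blast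
      then have 1: "r1 \<ge> 1 \<and> bounded_by m r1 (W a)" unfolding r1_def by (rule someI_ex)
      have "\<exists>r. r \<ge> 1 \<and> bounded_by m r (Z a)" using bounded_by_exists by blast
      then have 2: "r2 \<ge> 1 \<and> bounded_by m r2 (Z a)" unfolding r2_def by (rule someI_ex)
      have "q a = r1 + r2" by (simp add: q_def r1_def r2_def)
      then have "r1 \<le> q a" "r2 \<le> q a" "q a \<ge> 0" using 1 2 by linarith+
      then show ?thesis
        using bounded_by_mono[OF conjunct2[OF 1]] bounded_by_mono[OF conjunct2[OF 2]] by simp
    qed
    have "bounded_by m (1 + sum q letters) (W a) \<and> bounded_by m (1 + sum q letters) (Z a)" if "a \<in> letters" for a
    proof -
      have "q a \<le> sum q letters" using that finite_letters q by (intro member_le_sum) auto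
      then have le: "q a \<le> 1 + sum q letters" by simp
      show ?thesis
        using bounded_by_mono[OF _ le, of m "W a"] bounded_by_mono[OF _ le, of m "Z a"] q[of a] by simp
    qed
    moreover have "1 + sum q letters \<ge> 1" using q by (simp add: sum_nonneg)
    ultimately show thesis using that by blast
  qed
  have words: "bounded_by m (s\<^sup>2 * real (length ws)) (W (eval_word ws)) \<and>
      bounded_by m (s\<^sup>2 * (real (length ws))\<^sup>2) (Z (eval_word ws))" if "set ws \<subseteq> letters" for ws
    using that
  proof (induction ws)
    case Nil
    then show ?case by (simp add: bounded_by_def W_one Z_one)
  next
    case (Cons a ws)
    define n where "n = real (length ws)"
    have a: "a \<in> letters" "a \<in> carrier G" and ws: "eval_word ws \<in> carrier G"
      using Cons.prems letters_closed eval_word_closed by auto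
    have IH: "bounded_by m (s\<^sup>2 * n) (W (eval_word ws))" "bounded_by m (s\<^sup>2 * n\<^sup>2) (Z (eval_word ws))"
      using Cons by (simp_all add: n_def)
    have ss: "s \<le> s\<^sup>2" using s(1) by (simp add: power2_eq_square)
    have W_lin: "bounded_by m (s * real (length vs)) (W (eval_word vs))" if "set vs \<subseteq> letters" for vs
      using that
    proof (induction vs)
      case Nil
      then show ?case by (simp add: bounded_by_def W_one)
    next
      case (Cons b vs)
      have "b \<in> carrier G" "eval_word vs \<in> carrier G" using Cons.prems letters_closed eval_word_closed by auto
      then have eq: "W (eval_word (b # vs)) = W b + W (eval_word vs)" by (simp add: W_mult)
      have len: "s * real (length (b # vs)) = s + s * real (length vs)" by (simp add: distrib_left)
      show ?case
        unfolding eq len using Cons s(2) by (intro bounded_by_add) auto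
    qed
    have sW: "bounded_by m (s * n) (W (eval_word ws))" using W_lin[of ws] Cons.prems by (simp add: n_def)
    have n0: "n \<ge> 0" by (simp add: n_def)
    have len: "real (length (a # ws)) = n + 1" by (simp add: n_def)
    have "bounded_by m (s + s * n) (W a + W (eval_word ws))"
      using s(2)[OF a(1)] sW by (intro bounded_by_add) auto
    moreover have "s + s * n \<le> s\<^sup>2 * (n + 1)"
      using mult_right_mono[OF ss, of "n + 1"] n0 by (simp add: algebra_simps)
    ultimately have "bounded_by m (s\<^sup>2 * (n + 1)) (W a + W (eval_word ws))" by (rule bounded_by_mono)
    moreover have "W (eval_word (a # ws)) = W a + W (eval_word ws)" using a ws by (simp add: W_mult)
    ultimately have 1: "bounded_by m (s\<^sup>2 * (n + 1)) (W (eval_word (a # ws)))" by metis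
    have sy: "bounded_by m (s * (s * n)) (symp (W a) (W (eval_word ws)))"
      using s(2)[OF a(1)] sW s(1) by (intro bounded_by_symp) auto
    have 2: "bounded_by m (s\<^sup>2 * (n + 1)\<^sup>2) (Z (eval_word (a # ws)))"
      unfolding bounded_by_def
    proof (intro allI impI)
      fix i assume i: "i < m"
      have eq: "Z (eval_word (a # ws)) i = Z a i + Z (eval_word ws) i + (1 / 2) * symp (W a) (W (eval_word ws)) i"
        using a ws by (simp add: Z_mult)
      have "\<bar>Z a i\<bar> \<le> s" "\<bar>Z (eval_word ws) i\<bar> \<le> s\<^sup>2 * n\<^sup>2" "\<bar>symp (W a) (W (eval_word ws)) i\<bar> \<le> s * (s * n)"
        using s(2)[OF a(1)] IH(2) sy i by (auto dest: bounded_byD)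
      moreover have "s * (s * n) = s\<^sup>2 * n" by (simp add: power2_eq_square)
      moreover have "s\<^sup>2 * n \<ge> 0" using n0 by simp
      ultimately have "\<bar>Z (eval_word (a # ws)) i\<bar> \<le> s\<^sup>2 + s\<^sup>2 * n\<^sup>2 + 2 * (s\<^sup>2 * n)"
        unfolding eq using ss by linarith
      then show "norm (Z (eval_word (a # ws)) i) \<le> s\<^sup>2 * (n + 1)\<^sup>2"
        by (simp add: power2_eq_square algebra_simps)
    qed
    show ?case using 1 2 unfolding len by blast
  qed
  have "bounded_by m (s\<^sup>2 * real (wn g)) (W g) \<and> bounded_by m (s\<^sup>2 * (real (wn g))\<^sup>2) (Z g)"
    if g: "g \<in> carrier G" for g
  proof -
    obtain ws where ws: "set ws \<subseteq> letters" "eval_word ws = g" "length ws = wn g"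
      using word_norm_attained[OF g] by blast
    show ?thesis using words[OF ws(1)] unfolding ws(2,3) .
  qed
  moreover have "s\<^sup>2 \<ge> 1" using s(1) by (rule one_le_power)
  ultimately show ?thesis by blast
qed

lemma short_lift:
  "\<exists>C\<ge>1. \<forall>r\<ge>1. \<forall>d\<in>proj. bounded_by m r d \<longrightarrow> (\<exists>g\<in>carrier G. W g = d \<and> real (wn g) \<le> C * r)"
proof -
  define N where "N d = (LEAST k. \<exists>g\<in>carrier G. W g = d \<and> wn g = k)" for d
  have N: "\<exists>g\<in>carrier G. W g = d \<and> wn g = N d" if "d \<in> proj" for d
  proof -
    have "\<exists>k. \<exists>g\<in>carrier G. W g = d \<and> wn g = k" using that by blast
    then show ?thesis unfolding N_def by (rule LeastI_ex)
  qed
  have "N (a + b) \<le> N a + N b" if ab: "a \<in> proj" "b \<in> proj" for a b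
  proof -
    obtain g where g: "g \<in> carrier G" "W g = a" "wn g = N a" using N[OF ab(1)] by blast
    obtain h where h: "h \<in> carrier G" "W h = b" "wn h = N b" using N[OF ab(2)] by blast
    have "W (g \<otimes> h) = a + b" unfolding W_mult[OF g(1) h(1)] g(2) h(2) ..
    then have "N (a + b) \<le> wn (g \<otimes> h)"
      unfolding N_def using g(1) h(1) by (intro Least_le bexI[of _ "g \<otimes> h"]) simp_all
    then show ?thesis using word_norm_mult[OF g(1) h(1)] g h by simp
  qed
  then obtain C where C: "C \<ge> 1" "\<forall>r\<ge>1. \<forall>d\<in>proj. bounded_by m r d \<longrightarrow> real (N d) \<le> C * r"
    using subadditive_linear_bound[OF L_subgroup L_rel_dense L_loc_finite, of N] by blast
  have "\<exists>g\<in>carrier G. W g = d \<and> real (wn g) \<le> C * r" if "r \<ge> 1" "d \<in> proj" "bounded_by m r d" for r d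
    using N[OF that(2)] C(2) that by metis
  then show ?thesis using C(1) by blast
qed

lemma central_length_linear:
  "\<exists>C\<ge>1. \<forall>r\<ge>1. \<forall>z\<in>center_coords. bounded_by m r z \<longrightarrow> real (wn (central_elt z)) \<le> C * r"
proof (rule subadditive_linear_bound[OF \<Lambda>_subgroup \<Lambda>_rel_dense \<Lambda>_loc_finite])
  fix a b assume ab: "a \<in> center_coords" "b \<in> center_coords"
  show "wn (central_elt (a + b)) \<le> wn (central_elt a) + wn (central_elt b)"
    unfolding central_elt_add[OF ab] using ab by (intro word_norm_mult central_elt(1))
qed

text \<open>The centre is quadratically distorted. With \<open>b\<close> in \<open>L\<close> of size \<open>r\<close> in
  every coordinate, a real solution of \<open>\<omega>(b, x) = z\<close> has size at most \<open>r\<close>. Rounding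
  \<open>x\<close> to \<open>y\<close> in \<open>L\<close>, the commutator of lifts of \<open>b\<close> and \<open>y\<close>
  has length \<open>O(r)\<close> and misses \<open>z\<close> by a central element of size \<open>O(r)\<close>, whose length
  is at most linear in its size.\<close>

lemma central_length_sqrt:
  "\<exists>C\<ge>1. \<forall>r\<ge>1. \<forall>z\<in>center_coords. bounded_by m (r\<^sup>2) z \<longrightarrow> real (wn (central_elt z)) \<le> C * r"
proof -
  obtain CL where CL: "CL \<ge> 1" "\<forall>r\<ge>1. \<forall>d\<in>proj. bounded_by m r d \<longrightarrow>
      (\<exists>g\<in>carrier G. W g = d \<and> real (wn g) \<le> CL * r)" using short_lift by blast
  obtain CZ where CZ: "CZ \<ge> 1" "\<forall>r\<ge>1. \<forall>z\<in>center_coords. bounded_by m r z \<longrightarrow> real (wn (central_elt z)) \<le> CZ * r"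
    using central_length_linear by blast
  obtain R where R: "R \<ge> 1" "\<And>x. \<exists>d\<in>proj. bounded_by m R (x - d)" using rel_denseE[OF L_rel_dense] by blast
  define C where "C = 4 * (CL * (1 + 2 * R)) + CZ * ((1 + 2 * R) * R)"
  have "CL * (1 + 2 * R) \<ge> 1 * 1" using CL(1) R(1) by (intro mult_mono) auto
  moreover have "CZ * ((1 + 2 * R) * R) \<ge> 0" using CZ(1) R(1) by simp
  ultimately have C1: "C \<ge> 1" unfolding C_def by linarith
  have "real (wn (central_elt z)) \<le> C * r"
    if r: "r \<ge> 1" and z: "z \<in> center_coords" "bounded_by m (r\<^sup>2) z" for r z
  proof -
    obtain b where b: "b \<in> proj" "bounded_by m R (const_vec (of_real (r + R)) - b)" using R(2) by blast
    have bi: "r \<le> cmod (b i)" "cmod (b i) \<le> r + 2 * R" if "i < m" for i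
    proof -
      have n: "cmod (of_real (r + R) - b i) \<le> R" using bounded_byD[OF b(2) that] by simp
      have e: "cmod (of_real (r + R)) = r + R" using r R(1) by (simp only: norm_of_real)
      show "r \<le> cmod (b i)" using norm_triangle_ineq2[of "of_real (r + R)" "b i"] n e by linarith
      show "cmod (b i) \<le> r + 2 * R"
        using norm_triangle_ineq2[of "b i" "of_real (r + R)"] n e norm_minus_commute[of "b i" "of_real (r + R)"]
        by linarith
    qed
    define x where "x = (\<lambda>i. \<i> * of_real (z i) / cnj (b i))"
    have x: "symp b x i = z i" "cmod (x i) \<le> r" if i: "i < m" for i
    proof -
      have b0: "b i \<noteq> 0" using bi(1)[OF i] r by auto
      show "symp b x i = z i" unfolding symp_apply x_def by (rule Im_cnj_mult_ii(1)[OF b0])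
      have "cmod (x i) = \<bar>z i\<bar> / cmod (b i)" unfolding x_def by (rule Im_cnj_mult_ii(2)[OF b0])
      also have "\<dots> \<le> r\<^sup>2 / r" using bounded_byD[OF z(2) i] bi(1)[OF i] r by (intro frac_le) auto
      also have "\<dots> = r" using r by (simp add: power2_eq_square)
      finally show "cmod (x i) \<le> r" .
    qed
    obtain y where y: "y \<in> proj" "bounded_by m R (x - y)" using R(2) by blast
    have rR: "r + 2 * R \<le> (1 + 2 * R) * r" using r R(1) mult_left_mono[of 1 r "2 * R"] by (simp add: algebra_simps)
    have ge1: "(1 + 2 * R) * r \<ge> 1" using r R(1) mult_mono[of 1 "1 + 2 * R" 1 r] by simp
    have bb: "bounded_by m ((1 + 2 * R) * r) b"
      unfolding bounded_by_def using bi(2) rR by (meson order_trans)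
    have bx: "bounded_by m r x" using x(2) by (simp add: bounded_by_def)
    have "bounded_by m (r + R) (x - (x - y))" using bx y(2) by (rule bounded_by_diff)
    then have "bounded_by m (r + R) y" by simp
    then have by': "bounded_by m ((1 + 2 * R) * r) y" by (rule bounded_by_mono) (use rR R(1) in linarith)
    obtain g where g: "g \<in> carrier G" "W g = b" "real (wn g) \<le> CL * ((1 + 2 * R) * r)"
      using CL(2) ge1 b(1) bb by blast
    obtain h where h: "h \<in> carrier G" "W h = y" "real (wn h) \<le> CL * ((1 + 2 * R) * r)"
      using CL(2) ge1 y(1) by' by blast
    define c where "c = inv g \<otimes> (inv h \<otimes> g \<otimes> h)"
    have c: "c \<in> carrier G" "W c = 0" "Z c = symp b y" using commutator[OF g(1) h(1)] g h by (auto simp: c_def)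
    have c_in: "symp b y \<in> center_coords" using c by (intro image_eqI[of _ _ c]) auto
    have "wn c \<le> wn (inv g) + (wn (inv h) + wn g + wn h)"
      unfolding c_def using word_norm_mult g(1) h(1)
      by (meson add_le_mono add_left_mono inv_closed le_refl m_closed order_trans)
    then have "wn c \<le> 2 * wn g + 2 * wn h" using word_norm_inv[OF g(1)] word_norm_inv[OF h(1)] by linarith
    then have wc: "real (wn c) \<le> 4 * (CL * ((1 + 2 * R) * r))" using g(3) h(3) by linarith
    define z' where "z' = z - symp b y"
    have z': "z' \<in> center_coords" unfolding z'_def using z(1) c_in by (rule add_subgroup_diff[OF \<Lambda>_subgroup])
    have "bounded_by m ((1 + 2 * R) * r * R) (symp b (x - y))"
      using bb y(2) ge1 by (intro bounded_by_symp) auto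
    then have "bounded_by m ((1 + 2 * R) * r * R) z'"
      using x(1) by (simp add: bounded_by_def z'_def symp_diff_right)
    moreover have "(1 + 2 * R) * r * R \<ge> 1" using ge1 R(1) mult_mono[of 1 "(1 + 2 * R) * r" 1 R] by simp
    ultimately have wz': "real (wn (central_elt z')) \<le> CZ * ((1 + 2 * R) * r * R)" using CZ(2) z' by blast
    have "central_elt z = c \<otimes> central_elt z'"
      using c central_elt[OF z'] by (intro central_eltI) (auto simp: W_mult Z_mult_central z'_def)
    then have "wn (central_elt z) \<le> wn c + wn (central_elt z')"
      using word_norm_mult c(1) central_elt(1)[OF z'] by simp
    then have "real (wn (central_elt z)) \<le> 4 * (CL * ((1 + 2 * R) * r)) + CZ * ((1 + 2 * R) * r * R)"
      using wc wz' by linarith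
    also have "\<dots> = C * r" by (simp add: C_def algebra_simps)
    finally show ?thesis .
  qed
  then show ?thesis using C1 by blast
qed

text \<open>Divide \<open>g\<close> by a short lift of its projection. The central coordinate of the lift is
  \<open>O(r\<^sup>2)\<close> by the bound from below, so the quotient is a central element of size
  \<open>O(r\<^sup>2)\<close>.\<close>

theorem word_norm_upper_bound:
  "\<exists>C\<ge>1. \<forall>r\<ge>1. \<forall>g\<in>carrier G. bounded_by m r (W g) \<longrightarrow> bounded_by m (r\<^sup>2) (Z g) \<longrightarrow> real (wn g) \<le> C * r"
proof -
  obtain c where c: "c \<ge> 1" "\<forall>g\<in>carrier G. bounded_by m (c * real (wn g)) (W g) \<and>
      bounded_by m (c * (real (wn g))\<^sup>2) (Z g)" using word_norm_lower_bound by blast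
  obtain CL where CL: "CL \<ge> 1" "\<forall>r\<ge>1. \<forall>d\<in>proj. bounded_by m r d \<longrightarrow>
      (\<exists>g\<in>carrier G. W g = d \<and> real (wn g) \<le> CL * r)" using short_lift by blast
  obtain CZ where CZ: "CZ \<ge> 1" "\<forall>r\<ge>1. \<forall>z\<in>center_coords. bounded_by m (r\<^sup>2) z \<longrightarrow> real (wn (central_elt z)) \<le> CZ * r"
    using central_length_sqrt by blast
  define e where "e = 1 + c * CL"
  have cCL: "c * CL \<ge> 1" using c(1) CL(1) mult_mono[of 1 c 1 CL] by simp
  then have e1: "e \<ge> 1" by (simp add: e_def)
  have C1: "CL + CZ * e \<ge> 1" using CL(1) CZ(1) e1 mult_mono[of 1 CZ 1 e] by simp
  have "real (wn g) \<le> (CL + CZ * e) * r"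
    if r: "r \<ge> 1" and g: "g \<in> carrier G" "bounded_by m r (W g)" "bounded_by m (r\<^sup>2) (Z g)" for r g
  proof -
    obtain h where h: "h \<in> carrier G" "W h = W g" "real (wn h) \<le> CL * r"
      using CL(2) r g(1,2) by blast
    define k where "k = g \<otimes> inv h"
    have k: "k \<in> carrier G" "W k = 0" using g(1) h by (simp_all add: k_def W_mult W_inv)
    have Zk: "Z k = Z g - Z h"
    proof
      fix i
      show "Z k i = (Z g - Z h) i"
        unfolding k_def using g(1) h by (simp add: Z_mult W_inv Z_inv symp_apply)
    qed
    have "bounded_by m (c * (real (wn h))\<^sup>2) (Z h)" using c(2) h(1) by blast
    moreover have "c * (real (wn h))\<^sup>2 \<le> c * (CL * r)\<^sup>2"
      using h(3) c(1) by (intro mult_left_mono power_mono) auto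
    ultimately have "bounded_by m (c * (CL * r)\<^sup>2) (Z h)" by (rule bounded_by_mono)
    then have "bounded_by m (r\<^sup>2 + c * (CL * r)\<^sup>2) (Z k)" unfolding Zk by (rule bounded_by_diff[OF g(3)])
    moreover have "r\<^sup>2 + c * (CL * r)\<^sup>2 \<le> (e * r)\<^sup>2"
    proof -
      have "c * CL\<^sup>2 \<le> c * CL * (c * CL)"
        using c(1) CL(1) mult_left_mono[of 1 c "c * CL\<^sup>2"] by (simp add: power2_eq_square mult_ac)
      also have "\<dots> \<le> e\<^sup>2 - 1" using cCL by (simp add: e_def power2_eq_square algebra_simps)
      finally have "(1 + c * CL\<^sup>2) * r\<^sup>2 \<le> e\<^sup>2 * r\<^sup>2" by (intro mult_right_mono) auto
      then show ?thesis by (simp add: power_mult_distrib algebra_simps)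
    qed
    ultimately have "bounded_by m ((e * r)\<^sup>2) (Z k)" by (rule bounded_by_mono)
    moreover have "e * r \<ge> 1" using e1 r mult_mono[of 1 e 1 r] by simp
    moreover have "Z k \<in> center_coords" using k by (intro image_eqI[of _ _ k]) auto
    ultimately have "real (wn (central_elt (Z k))) \<le> CZ * (e * r)" using CZ(2) by blast
    moreover have "central_elt (Z k) = k" using k by (intro central_eltI) auto
    ultimately have wk: "real (wn k) \<le> CZ * (e * r)" by simp
    have "g = k \<otimes> h" using g(1) h(1) by (simp add: k_def m_assoc)
    then have "wn g \<le> wn k + wn h" using word_norm_mult k(1) h(1) by simp
    then have "real (wn g) \<le> CL * r + CZ * (e * r)" using wk h(3) by linarith
    then show ?thesis by (simp add: algebra_simps)
  qed
  then show ?thesis using C1 by blast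
qed

lemma conjugator_length_function_upper:
  assumes m: "m \<ge> 1"
  shows "\<exists>D\<ge>1. \<forall>n\<ge>1. real (conjugator_length_function G S n) \<le> D * real n ^ (max_block + 1)"
proof -
  obtain c where c: "c \<ge> 1" "\<forall>g\<in>carrier G. bounded_by m (c * real (wn g)) (W g) \<and>
      bounded_by m (c * (real (wn g))\<^sup>2) (Z g)" using word_norm_lower_bound by blast
  obtain CL where CL: "CL \<ge> 1" "\<forall>r\<ge>1. \<forall>d\<in>proj. bounded_by m r d \<longrightarrow>
      (\<exists>g\<in>carrier G. W g = d \<and> real (wn g) \<le> CL * r)" using short_lift by blast
  obtain C where C: "C \<ge> 1" "\<forall>u\<in>proj. \<forall>x\<in>proj. \<forall>n\<ge>1. bounded_by m n u \<longrightarrow> bounded_by m (n\<^sup>2) (symp u x) \<longrightarrow>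
    (\<exists>w\<in>proj. symp u w = symp u x \<and> bounded_by m (C * n ^ (max_block + 1)) w)"
    using short_conjugators[OF m] by blast
  define D where "D = CL * C * (2 * c) ^ (max_block + 1)"
  have c2: "(2 * c) ^ (max_block + 1) \<ge> 1" using c(1) by (intro one_le_power) auto
  have CLC: "CL * C \<ge> 1" using CL(1) C(1) mult_mono[of 1 CL 1 C] by simp
  have D1: "D \<ge> 1" using mult_mono[of 1 "CL * C" 1 "(2 * c) ^ (max_block + 1)"] CLC c2 by (simp add: D_def)
  have "real (conjugator_length_function G S n) \<le> D * real n ^ (max_block + 1)" if n: "n \<ge> 1" for n
  proof -
    obtain u v where uv: "u \<in> carrier G" "v \<in> carrier G" "\<exists>x. conjugates G x u v" "wn u \<le> n" "wn v \<le> n"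
      and eq: "conjugator_length G S u v = conjugator_length_function G S n"
      using conjugator_length_function(2)[of n] by blast
    obtain x where x: "x \<in> carrier G" "W v = W u" "Z v = Z u + symp (W u) (W x)"
      using uv(3) conjugates_iff[OF uv(1,2)] by blast
    \<comment> \<open>then \<open>r\<close> bounds the projection of \<open>u\<close>, and \<open>r\<^sup>2\<close> the difference of the central coordinates\<close>
    define r where "r = 2 * c * real n"
    have n1: "real n \<ge> 1" using n by simp
    have r1: "r \<ge> 1" using c(1) n1 mult_mono[of 1 "2 * c" 1 "real n"] by (simp add: r_def)
    have bW: "bounded_by m r (W u)"
    proof (rule bounded_by_mono)
      show "bounded_by m (c * real (wn u)) (W u)" using c(2) uv(1) by blast
      show "c * real (wn u) \<le> r"
        unfolding r_def using uv(4) c(1) by (intro mult_mono) auto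
    qed
    have bZ: "bounded_by m (c * (real n)\<^sup>2) (Z g)" if "g \<in> carrier G" "wn g \<le> n" for g
    proof (rule bounded_by_mono)
      show "bounded_by m (c * (real (wn g))\<^sup>2) (Z g)" using c(2) that(1) by blast
      show "c * (real (wn g))\<^sup>2 \<le> c * (real n)\<^sup>2"
        using that(2) c(1) by (intro mult_left_mono power_mono) auto
    qed
    have "bounded_by m (c * (real n)\<^sup>2 + c * (real n)\<^sup>2) (Z v - Z u)"
      using uv bZ by (intro bounded_by_diff) auto
    moreover have "Z v - Z u = symp (W u) (W x)" using x(3) by simp
    ultimately have "bounded_by m (c * (real n)\<^sup>2 + c * (real n)\<^sup>2) (symp (W u) (W x))" by simp
    moreover have "c * (real n)\<^sup>2 + c * (real n)\<^sup>2 \<le> r\<^sup>2"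
    proof -
      have "2 * c \<le> (2 * c)\<^sup>2" using c(1) by (simp add: power2_eq_square)
      then have "2 * c * (real n)\<^sup>2 \<le> (2 * c)\<^sup>2 * (real n)\<^sup>2" by (intro mult_right_mono) auto
      then show ?thesis by (simp add: r_def power_mult_distrib)
    qed
    ultimately have "bounded_by m (r\<^sup>2) (symp (W u) (W x))" by (rule bounded_by_mono)
    then obtain w where w: "w \<in> proj" "symp (W u) w = symp (W u) (W x)"
      "bounded_by m (C * r ^ (max_block + 1)) w"
      using C(2)[rule_format, OF imageI[OF uv(1)] imageI[OF x(1)] r1 bW] by blast
    have "r ^ (max_block + 1) \<ge> 1" using r1 by (rule one_le_power)
    then have "C * r ^ (max_block + 1) \<ge> 1" using C(1) mult_mono[of 1 C 1 "r ^ (max_block + 1)"] by simp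
    then obtain y where y: "y \<in> carrier G" "W y = w" "real (wn y) \<le> CL * (C * r ^ (max_block + 1))"
      using CL(2) w(1,3) by blast
    have "conjugates G y u v" using conjugates_iff[OF uv(1,2)] y(1,2) x(2,3) w(2) by simp
    then have "conjugator_length G S u v \<le> wn y" by (rule conjugator_length_le)
    then have "real (conjugator_length_function G S n) \<le> real (wn y)" using eq by simp
    also have "\<dots> \<le> CL * (C * r ^ (max_block + 1))" by (rule y(3))
    also have "\<dots> = D * real n ^ (max_block + 1)" unfolding D_def r_def power_mult_distrib by simp
    finally show ?thesis .
  qed
  then show ?thesis using D1 by blast
qed

lemma conjugator_length_function_lower:
  assumes m: "m \<ge> 1"
  shows "\<exists>D::nat\<ge>1. \<forall>n\<ge>1. \<forall>N\<ge>D * n. real n ^ (max_block + 1) \<le> real D * real (conjugator_length_function G S N)"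
proof -
  obtain c where c: "c \<ge> 1" "\<forall>g\<in>carrier G. bounded_by m (c * real (wn g)) (W g) \<and>
      bounded_by m (c * (real (wn g))\<^sup>2) (Z g)" using word_norm_lower_bound by blast
  obtain CL where CL: "CL \<ge> 1" "\<forall>r\<ge>1. \<forall>d\<in>proj. bounded_by m r d \<longrightarrow>
      (\<exists>g\<in>carrier G. W g = d \<and> real (wn g) \<le> CL * r)" using short_lift by blast
  obtain CU where CU: "CU \<ge> 1" "\<forall>r\<ge>1. \<forall>g\<in>carrier G. bounded_by m r (W g) \<longrightarrow> bounded_by m (r\<^sup>2) (Z g) \<longrightarrow>
      real (wn g) \<le> CU * r" using word_norm_upper_bound by blast
  obtain C where C: "C \<ge> 1" "\<forall>n\<ge>1. \<exists>u\<in>proj. \<exists>x\<in>proj. bounded_by m (C * n) u \<and> bounded_by m (C * n\<^sup>2) (symp u x) \<and>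
    (\<forall>w\<in>proj. symp u w = symp u x \<longrightarrow> (\<exists>i<m. n ^ (max_block + 1) \<le> C * cmod (w i)))"
    using long_conjugators[OF m] by blast
  define e where "e = c * (CL * C) + C"
  have CLC: "CL * C \<ge> 1" using CL(1) C(1) mult_mono[of 1 CL 1 C] by simp
  have cCLC: "c * (CL * C) \<ge> 1" using CLC c(1) mult_mono[of 1 c 1 "CL * C"] by simp
  have e1: "e \<ge> 1" "e \<ge> C" using cCLC C(1) by (auto simp: e_def)
  obtain D :: nat where D: "real D \<ge> CL * C + CU * e + C * c" using real_arch_simple by blast
  have pos: "CU * e \<ge> 1" "C * c \<ge> 1"
    using CU(1) e1 C(1) c(1) mult_mono[of 1 CU 1 e] mult_mono[of 1 C 1 c] by auto
  have D': "real D \<ge> CL * C" "real D \<ge> CU * e" "real D \<ge> C * c" using D pos CLC by linarith+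
  have D1: "D \<ge> 1" using D'(1) CLC by linarith
  have "real n ^ (max_block + 1) \<le> real D * real (conjugator_length_function G S N)"
    if n: "n \<ge> 1" and N: "N \<ge> D * n" for n N :: nat
  proof -
    have n1: "real n \<ge> 1" using n by simp
    have N': "real N \<ge> real D * real n" using N by (metis of_nat_mono of_nat_mult)
    obtain u x where u: "u \<in> proj" and x: "x \<in> proj" and bu: "bounded_by m (C * real n) u"
      and bz: "bounded_by m (C * (real n)\<^sup>2) (symp u x)"
      and long: "\<forall>w\<in>proj. symp u w = symp u x \<longrightarrow> (\<exists>i<m. real n ^ (max_block + 1) \<le> C * cmod (w i))"
      using C(2) n1 by blast
    have Cn: "C * real n \<ge> 1" using C(1) n1 mult_mono[of 1 C 1 "real n"] by simp
    obtain g where g: "g \<in> carrier G" "W g = u" "real (wn g) \<le> CL * (C * real n)"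
      using CL(2) Cn u bu by blast
    obtain h where h: "h \<in> carrier G" "W h = x" using x by blast
    define v where "v = inv h \<otimes> g \<otimes> h"
    have v: "v \<in> carrier G" "W v = u" "Z v = Z g + symp u x"
      using g h W_conj Z_conj by (auto simp: v_def)
    have conj: "conjugates G h g v" using g h by (simp add: conjugates_def v_def)
    have gN: "wn g \<le> N"
    proof -
      have "real (wn g) \<le> CL * C * real n" using g(3) by simp
      also have "\<dots> \<le> real D * real n" using D'(1) by (intro mult_right_mono) auto
      finally have "real (wn g) \<le> real N" using N' by linarith
      then show ?thesis by simp
    qed
    have "bounded_by m (c * (real (wn g))\<^sup>2) (Z g)" using c(2) g(1) by blast
    moreover have "c * (real (wn g))\<^sup>2 \<le> c * (CL * (C * real n))\<^sup>2"
      using g(3) c(1) by (intro mult_left_mono power_mono) auto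
    ultimately have "bounded_by m (c * (CL * (C * real n))\<^sup>2) (Z g)" by (rule bounded_by_mono)
    then have "bounded_by m (c * (CL * (C * real n))\<^sup>2 + C * (real n)\<^sup>2) (Z v)"
      unfolding v(3) using bz by (rule bounded_by_add)
    moreover have "c * (CL * (C * real n))\<^sup>2 + C * (real n)\<^sup>2 \<le> (e * real n)\<^sup>2"
    proof -
      have "1 * (c * (CL * C)\<^sup>2) \<le> c * (c * (CL * C)\<^sup>2)"
        using c(1) by (intro mult_right_mono) auto
      also have "\<dots> = (c * (CL * C))\<^sup>2" by (simp add: power2_eq_square mult_ac)
      finally have "c * (CL * C)\<^sup>2 \<le> (c * (CL * C))\<^sup>2" by simp
      moreover have "C \<le> C\<^sup>2" using C(1) by (simp add: power2_eq_square)
      moreover have "(c * (CL * C))\<^sup>2 + C\<^sup>2 \<le> e\<^sup>2"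
        using cCLC C(1) by (simp add: e_def power2_sum)
      ultimately have "c * (CL * C)\<^sup>2 + C \<le> e\<^sup>2" by linarith
      then have "(c * (CL * C)\<^sup>2 + C) * (real n)\<^sup>2 \<le> e\<^sup>2 * (real n)\<^sup>2" by (intro mult_right_mono) auto
      moreover have "(c * (CL * C)\<^sup>2 + C) * (real n)\<^sup>2 = c * (CL * (C * real n))\<^sup>2 + C * (real n)\<^sup>2"
        by (simp add: power_mult_distrib algebra_simps)
      ultimately show ?thesis by (simp add: power_mult_distrib)
    qed
    ultimately have bv: "bounded_by m ((e * real n)\<^sup>2) (Z v)" by (rule bounded_by_mono)
    have "C * real n \<le> e * real n" using e1 by (intro mult_right_mono) auto
    with bu have "bounded_by m (e * real n) (W v)" unfolding v(2) by (rule bounded_by_mono)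
    moreover have "e * real n \<ge> 1" using e1 n1 mult_mono[of 1 e 1 "real n"] by simp
    ultimately have "real (wn v) \<le> CU * (e * real n)" using CU(2) v(1) bv by blast
    also have "\<dots> = CU * e * real n" by simp
    also have "\<dots> \<le> real D * real n" using D'(2) by (intro mult_right_mono) auto
    finally have vN: "wn v \<le> N" using N' by linarith
    obtain y where y: "conjugates G y g v" "wn y = conjugator_length G S g v"
      using conjugator_length_attained[OF conj] by blast
    have yG: "y \<in> carrier G" "Z v = Z g + symp u (W y)"
      using y(1) conjugates_iff[OF g(1) v(1)] g(2) by auto
    then have "symp u (W y) = symp u x" using v(3) by simp
    then obtain i where i: "i < m" "real n ^ (max_block + 1) \<le> C * cmod (W y i)"
      using long yG(1) by blast
    have "cmod (W y i) \<le> c * real (wn y)" using c(2) yG(1) i(1) by (auto dest: bounded_byD)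
    then have "C * cmod (W y i) \<le> C * (c * real (wn y))" using C(1) by (intro mult_left_mono) auto
    then have "real n ^ (max_block + 1) \<le> (C * c) * real (wn y)" using i(2) by simp
    also have "\<dots> \<le> real D * real (conjugator_length_function G S N)"
    proof (intro mult_mono D'(3))
      have "conjugator_length G S g v \<le> conjugator_length_function G S N"
        by (rule conjugator_length_function(1)) (use g(1) v(1) conj gN vN in blast)
      then show "real (wn y) \<le> real (conjugator_length_function G S N)" using y(2) by simp
    qed auto
    finally show ?thesis .
  qed
  then show ?thesis using D1 by blast
qed

lemma conjugator_length_function_growth:
  assumes m: "m \<ge> 1"
  shows "(\<lambda>n. real (conjugator_length_function G S n)) \<simeq>\<^sub>g (\<lambda>n. real n ^ (max_block + 1))"
  unfolding growth_equiv_def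
proof
  obtain D where D: "D \<ge> 1" "\<forall>n\<ge>1. real (conjugator_length_function G S n) \<le> D * real n ^ (max_block + 1)"
    using conjugator_length_function_upper[OF m] by blast
  obtain C :: nat where C: "real C \<ge> D" using real_arch_simple by blast
  have C1: "C \<ge> 1" using C D(1) by linarith
  have "real (conjugator_length_function G S n) \<le> real C * real (C * n + C) ^ (max_block + 1) + real C"
    if n: "n \<ge> 1" for n
  proof -
    have "1 * n \<le> C * n" using C1 by (rule mult_le_mono1)
    then have "n \<le> C * n + C" by linarith
    then have "real n \<le> real (C * n + C)" by (rule of_nat_mono)
    then have "real n ^ (max_block + 1) \<le> real (C * n + C) ^ (max_block + 1)"
      by (intro power_mono) simp_all
    then have "D * real n ^ (max_block + 1) \<le> real C * real (C * n + C) ^ (max_block + 1)"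
      using C D(1) by (intro mult_mono) auto
    then show ?thesis using D(2) n by (meson add_increasing2 of_nat_0_le_iff order_trans)
  qed
  then show "(\<lambda>n. real (conjugator_length_function G S n)) \<preceq>\<^sub>g (\<lambda>n. real n ^ (max_block + 1))"
    unfolding growth_le_def using C1 by blast
  obtain E :: nat where E: "E \<ge> 1" "\<forall>n\<ge>1. \<forall>N\<ge>E * n. real n ^ (max_block + 1) \<le> real E * real (conjugator_length_function G S N)"
    using conjugator_length_function_lower[OF m] by blast
  have "real n ^ (max_block + 1) \<le> real E * real (conjugator_length_function G S (E * n + E)) + real E"
    if "n \<ge> 1" for n
    using E(2) that by (meson add_increasing2 le_add1 of_nat_0_le_iff)
  then show "(\<lambda>n. real n ^ (max_block + 1)) \<preceq>\<^sub>g (\<lambda>n. real (conjugator_length_function G S n))"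
    unfolding growth_le_def using E(1) by blast
qed

end

context heisenberg_lattice
begin

theorem conjugator_length_growth:
  assumes "m \<ge> 1"
  shows "conjugator_length_growth G (\<lambda>n. real n ^ (max_block + 1))"
  unfolding conjugator_length_growth_def finitely_generated_group_def
proof (intro conjI allI impI)
  show "group G" by (rule is_group)
  show "\<exists>S. finite_generating_set G S" by (rule finitely_generated)
  fix S assume S: "finite_generating_set G S"
  interpret generated_heisenberg_lattice G m W Z S by unfold_locales (rule S)
  show "(\<lambda>n. real (conjugator_length_function G S n)) \<simeq>\<^sub>g (\<lambda>n. real n ^ (max_block + 1))"
    by (rule conjugator_length_function_growth[OF assms])
qed

end

section \<open>Cocompact lattices of the Heisenberg power\<close>

definition coord_W :: "nat \<Rightarrow> (nat \<Rightarrow> heis) \<Rightarrow> nat \<Rightarrow> complex"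
  where "coord_W m g = (\<lambda>i. if i < m then Complex (fst (g i)) (fst (snd (g i))) else 0)"

definition coord_Z :: "nat \<Rightarrow> (nat \<Rightarrow> heis) \<Rightarrow> nat \<Rightarrow> real"
  where "coord_Z m g = (\<lambda>i. if i < m then snd (snd (g i)) - fst (g i) * fst (snd (g i)) / 2 else 0)"

lemma carrier_heisenberg_power: "carrier (heisenberg_power m) = {..<m} \<rightarrow>\<^sub>E UNIV"
  by (simp add: heisenberg_power_def heisenberg_def)

lemma heisenberg_power_mult:
  "i < m \<Longrightarrow> (g \<otimes>\<^bsub>heisenberg_power m\<^esub> h) i =
    (fst (g i) + fst (h i), fst (snd (g i)) + fst (snd (h i)),
     snd (snd (g i)) + snd (snd (h i)) + fst (g i) * fst (snd (h i)))"
  by (simp add: heisenberg_power_def heisenberg_def product_group_def case_prod_unfold)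

lemma heisenberg_power_one: "i < m \<Longrightarrow> \<one>\<^bsub>heisenberg_power m\<^esub> i = (0, 0, 0)"
  by (simp add: heisenberg_power_def heisenberg_def product_group_def)

lemma coord_W_mult:
  "coord_W m (g \<otimes>\<^bsub>heisenberg_power m\<^esub> h) = coord_W m g + coord_W m h"
  by (rule ext) (simp add: coord_W_def heisenberg_power_mult complex_eq_iff)

lemma coord_Z_mult:
  "coord_Z m (g \<otimes>\<^bsub>heisenberg_power m\<^esub> h) =
     coord_Z m g + coord_Z m h + const_vec (1 / 2) \<star> symp (coord_W m g) (coord_W m h)"
  by (rule ext) (simp add: coord_Z_def coord_W_def heisenberg_power_mult symp_apply field_simps)

lemma coords_inject:
  assumes "g \<in> carrier (heisenberg_power m)" "h \<in> carrier (heisenberg_power m)"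
    and "coord_W m g = coord_W m h" "coord_Z m g = coord_Z m h"
  shows "g = h"
proof
  fix i
  show "g i = h i"
  proof (cases "i < m")
    case True
    have "fst (g i) = fst (h i)" "fst (snd (g i)) = fst (snd (h i))"
      using fun_cong[OF assms(3), of i] True by (simp_all add: coord_W_def)
    moreover have "snd (snd (g i)) = snd (snd (h i))"
      using fun_cong[OF assms(4), of i] True calculation by (simp add: coord_Z_def)
    ultimately show ?thesis by (simp add: prod_eq_iff)
  next
    case False
    then have "i \<notin> {..<m}" by simp
    then show ?thesis
      using PiE_arb assms(1,2)[unfolded carrier_heisenberg_power] by metis
  qed
qed

lemma coords_surj:
  obtains g where "g \<in> carrier (heisenberg_power m)" "\<And>i. i < m \<Longrightarrow> coord_W m g i = w i"
proof
  show "(\<lambda>i\<in>{..<m}. (Re (w i), Im (w i), 0)) \<in> carrier (heisenberg_power m)"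
    by (simp add: carrier_heisenberg_power)
  show "\<And>i. i < m \<Longrightarrow> coord_W m (\<lambda>i\<in>{..<m}. (Re (w i), Im (w i), 0)) i = w i"
    by (simp add: coord_W_def)
qed

lemma continuous_map_coord_W:
  assumes "i < m"
  shows "continuous_map (heisenberg_power_topology m) euclidean (\<lambda>g. coord_W m g i)"
proof -
  have 1: "continuous_map (heisenberg_power_topology m) euclidean (\<lambda>g. g i)"
    unfolding heisenberg_power_topology_def
    using assms by (intro continuous_map_product_projection) simp
  have "continuous_on UNIV (\<lambda>p::heis. Complex (fst p) (fst (snd p)))"
    unfolding Complex_eq by (intro continuous_intros)
  then have 2: "continuous_map euclidean euclidean (\<lambda>p::heis. Complex (fst p) (fst (snd p)))"
    by (simp add: continuous_map_iff_continuous2)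
  have "(\<lambda>g. coord_W m g i) = (\<lambda>p. Complex (fst p) (fst (snd p))) \<circ> (\<lambda>g. g i)"
    using assms by (simp add: coord_W_def comp_def)
  then show ?thesis using continuous_map_compose[OF 1 2] by simp
qed

text \<open>The elements with \<open>\<bar>w\<bar> < n\<close> map to open subsets of the quotient, since their saturation is
  a union of translates. These subsets increase to the whole quotient, so by compactness one of them is everything, which
  says that each \<open>w\<close> is within distance \<open>n\<close> of the projection of the lattice.\<close>

lemma cocompact_rel_dense:
  assumes "cocompact_lattice (heisenberg_power m) (heisenberg_power_topology m) \<Gamma>"
  shows "rel_dense m (coord_W m ` \<Gamma>)"
proof -
  define N where "N = heisenberg_power m"
  define T where "T = heisenberg_power_topology m"
  have top: "topspace T = carrier N" by (simp add: T_def N_def topspace_heisenberg_power)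
  interpret group N unfolding N_def by (rule group_heisenberg_power)
  obtain Y where sub: "subgroup \<Gamma> N" and q: "quotient_map T Y (\<lambda>g. g <#\<^bsub>N\<^esub> \<Gamma>)" and Y: "compact_space Y"
    using assms unfolding cocompact_lattice_def N_def T_def by blast
  have \<Gamma>N: "\<Gamma> \<subseteq> carrier N" using sub by (rule subgroup.subset)
  define U where "U n = {g \<in> carrier N. \<forall>i<m. cmod (coord_W m g i) < real n}" for n :: nat
  define V where "V n = (\<lambda>g. g <#\<^bsub>N\<^esub> \<Gamma>) ` U n" for n
  have pre: "(x <#\<^bsub>N\<^esub> \<Gamma> \<in> V n) \<longleftrightarrow> (\<exists>\<gamma>\<in>\<Gamma>. \<forall>i<m. cmod (coord_W m x i + coord_W m \<gamma> i) < real n)"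
    if x: "x \<in> carrier N" for x n
  proof
    assume "x <#\<^bsub>N\<^esub> \<Gamma> \<in> V n"
    then obtain u where u: "u \<in> U n" "x <#\<^bsub>N\<^esub> \<Gamma> = u <#\<^bsub>N\<^esub> \<Gamma>" unfolding V_def by blast
    have uN: "u \<in> carrier N" using u(1) by (simp add: U_def)
    have "u \<otimes>\<^bsub>N\<^esub> \<one>\<^bsub>N\<^esub> \<in> u <#\<^bsub>N\<^esub> \<Gamma>"
      unfolding l_coset_def using subgroup.one_closed[OF sub] by blast
    then have "u \<in> x <#\<^bsub>N\<^esub> \<Gamma>" using u(2) uN by simp
    then obtain \<gamma> where \<gamma>: "\<gamma> \<in> \<Gamma>" "u = x \<otimes>\<^bsub>N\<^esub> \<gamma>" unfolding l_coset_def by blast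
    have "coord_W m u = coord_W m x + coord_W m \<gamma>" unfolding \<gamma>(2) N_def by (rule coord_W_mult)
    then have "\<forall>i<m. cmod (coord_W m x i + coord_W m \<gamma> i) < real n"
      using u(1) by (simp add: U_def)
    then show "\<exists>\<gamma>\<in>\<Gamma>. \<forall>i<m. cmod (coord_W m x i + coord_W m \<gamma> i) < real n" using \<gamma>(1) by blast
  next
    assume "\<exists>\<gamma>\<in>\<Gamma>. \<forall>i<m. cmod (coord_W m x i + coord_W m \<gamma> i) < real n"
    then obtain \<gamma> where \<gamma>: "\<gamma> \<in> \<Gamma>" "\<forall>i<m. cmod (coord_W m x i + coord_W m \<gamma> i) < real n" by blast
    have \<gamma>N: "\<gamma> \<in> carrier N" using \<gamma>(1) \<Gamma>N by blast
    have "coord_W m (x \<otimes>\<^bsub>N\<^esub> \<gamma>) = coord_W m x + coord_W m \<gamma>" unfolding N_def by (rule coord_W_mult)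
    then have "x \<otimes>\<^bsub>N\<^esub> \<gamma> \<in> U n" using \<gamma>(2) x \<gamma>N by (simp add: U_def)
    moreover have "x <#\<^bsub>N\<^esub> \<Gamma> = (x \<otimes>\<^bsub>N\<^esub> \<gamma>) <#\<^bsub>N\<^esub> \<Gamma>"
    proof (rule l_repr_independence[OF _ x sub])
      show "x \<otimes>\<^bsub>N\<^esub> \<gamma> \<in> x <#\<^bsub>N\<^esub> \<Gamma>" unfolding l_coset_def using \<gamma>(1) by blast
    qed
    ultimately show "x <#\<^bsub>N\<^esub> \<Gamma> \<in> V n" unfolding V_def by blast
  qed
  have VY: "V n \<subseteq> topspace Y" for n
  proof -
    have "(\<lambda>g. g <#\<^bsub>N\<^esub> \<Gamma>) ` topspace T = topspace Y" using q by (simp add: quotient_map_def)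
    moreover have "U n \<subseteq> topspace T" by (auto simp: top U_def)
    ultimately show ?thesis unfolding V_def by blast
  qed
  have openV: "openin Y (V n)" for n
  proof -
    have "{x \<in> topspace T. x <#\<^bsub>N\<^esub> \<Gamma> \<in> V n} =
        (\<Union>\<gamma>\<in>\<Gamma>. (\<Inter>i\<in>{..<m}. {x \<in> topspace T. coord_W m x i \<in> ball (- coord_W m \<gamma> i) (real n)}) \<inter> topspace T)"
    proof -
      have "dist (- b) a = cmod (a + b)" for a b :: complex
        by (metis add.commute diff_minus_eq_add dist_commute dist_norm)
      moreover have "(\<forall>i\<in>{..<m}. P i) \<longleftrightarrow> (\<forall>i<m. P i)" for P :: "nat \<Rightarrow> bool" by blast
      ultimately show ?thesis unfolding top using pre by (auto simp: mem_ball) (rule bexI, assumption+)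
    qed
    moreover have "openin T \<dots>"
    proof (intro openin_Union ballI)
      fix A assume "A \<in> (\<lambda>\<gamma>. (\<Inter>i\<in>{..<m}. {x \<in> topspace T. coord_W m x i \<in> ball (- coord_W m \<gamma> i) (real n)}) \<inter> topspace T) ` \<Gamma>"
      then obtain \<gamma> where A: "A = (\<Inter>i\<in>{..<m}. {x \<in> topspace T. coord_W m x i \<in> ball (- coord_W m \<gamma> i) (real n)}) \<inter> topspace T"
        by blast
      show "openin T A"
        unfolding A
      proof (rule openin_INT)
        fix i assume "i \<in> {..<m}"
        then have "continuous_map T euclidean (\<lambda>g. coord_W m g i)"
          unfolding T_def by (intro continuous_map_coord_W) simp
        then show "openin T {x \<in> topspace T. coord_W m x i \<in> ball (- coord_W m \<gamma> i) (real n)}"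
          by (rule openin_continuous_map_preimage) simp
      qed simp
    qed
    ultimately have "openin T {x \<in> topspace T. x <#\<^bsub>N\<^esub> \<Gamma> \<in> V n}" by simp
    then show ?thesis using q VY unfolding quotient_map_def by blast
  qed
  have cover: "topspace Y \<subseteq> \<Union>(range V)"
  proof
    fix y assume "y \<in> topspace Y"
    moreover have "(\<lambda>g. g <#\<^bsub>N\<^esub> \<Gamma>) ` topspace T = topspace Y" using q by (simp add: quotient_map_def)
    ultimately obtain x where x: "x \<in> carrier N" "y = x <#\<^bsub>N\<^esub> \<Gamma>" unfolding top by blast
    obtain s where s: "bounded_by m s (coord_W m x)" using bounded_by_exists by blast
    obtain n :: nat where n: "s < real n" using reals_Archimedean2 by blast
    have "cmod (coord_W m x i) < real n" if "i < m" for i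
      using bounded_byD[OF s that] n by simp
    then have "y \<in> V n" unfolding V_def x(2) U_def using x(1) by blast
    then show "y \<in> \<Union>(range V)" by blast
  qed
  obtain \<F> where \<F>: "finite \<F>" "\<F> \<subseteq> range V" "topspace Y \<subseteq> \<Union>\<F>"
  proof -
    have "\<forall>\<U>. (\<forall>u\<in>\<U>. openin Y u) \<and> topspace Y \<subseteq> \<Union>\<U> \<longrightarrow> (\<exists>\<F>. finite \<F> \<and> \<F> \<subseteq> \<U> \<and> topspace Y \<subseteq> \<Union>\<F>)"
      using Y unfolding compact_space_def compactin_def by blast
    moreover have "\<forall>u\<in>range V. openin Y u" using openV by blast
    ultimately show thesis using cover that by meson
  qed
  obtain A where A: "finite A" "\<F> = V ` A" using finite_subset_image[OF \<F>(1,2)] by blast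
  define K where "K = Max (insert 0 A)"
  have K: "n \<le> K" if "n \<in> A" for n using that A(1) by (simp add: K_def)
  have "\<exists>d\<in>coord_W m ` \<Gamma>. bounded_by m (real K) (v - d)" for v
  proof -
    obtain x where x: "x \<in> carrier N" "\<And>i. i < m \<Longrightarrow> coord_W m x i = (- v) i"
      using coords_surj[of m "- v"] unfolding N_def by blast
    have "x <#\<^bsub>N\<^esub> \<Gamma> \<in> topspace Y"
      using q x(1) top unfolding quotient_map_def by blast
    then obtain n where n: "n \<in> A" "x <#\<^bsub>N\<^esub> \<Gamma> \<in> V n" using \<F>(3) A(2) by blast
    then obtain \<gamma> where \<gamma>: "\<gamma> \<in> \<Gamma>" "\<forall>i<m. cmod (coord_W m x i + coord_W m \<gamma> i) < real n"
      using pre[OF x(1)] by blast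
    have "norm ((v - coord_W m \<gamma>) i) \<le> real K" if i: "i < m" for i
    proof -
      have "coord_W m x i + coord_W m \<gamma> i = - (v - coord_W m \<gamma>) i" using x(2)[OF i] by simp
      then have "norm ((v - coord_W m \<gamma>) i) < real n" using \<gamma>(2) i by (metis norm_minus_cancel)
      then show ?thesis using K[OF n(1)] by linarith
    qed
    then show ?thesis using \<gamma>(1) by (auto simp: bounded_by_def)
  qed
  then show ?thesis unfolding rel_dense_def by blast
qed

text \<open>A neighbourhood of the identity that contains no other lattice element contains a box around it.\<close>

lemma discrete_center:
  assumes "cocompact_lattice (heisenberg_power m) (heisenberg_power_topology m) \<Gamma>"
  shows "\<exists>\<epsilon>>0. \<forall>g\<in>\<Gamma>. coord_W m g = 0 \<longrightarrow> (\<forall>i<m. \<bar>coord_Z m g i\<bar> < \<epsilon>) \<longrightarrow> coord_Z m g = 0"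
proof -
  define e where "e = \<one>\<^bsub>heisenberg_power m\<^esub>"
  have sub: "subgroup \<Gamma> (heisenberg_power m)"
    and disc: "subtopology (heisenberg_power_topology m) \<Gamma> = discrete_topology \<Gamma>"
    using assms by (auto simp: cocompact_lattice_def)
  have e\<Gamma>: "e \<in> \<Gamma>" unfolding e_def using sub by (rule subgroup.one_closed)
  then have "openin (subtopology (heisenberg_power_topology m) \<Gamma>) {e}" unfolding disc by simp
  then obtain B where B: "openin (heisenberg_power_topology m) B" "{e} = B \<inter> \<Gamma>"
    unfolding openin_subtopology by blast
  then have "e \<in> B" by blast
  then obtain U where U: "\<forall>i\<in>{..<m}. openin euclidean (U i)" "e \<in> Pi\<^sub>E {..<m} U" "Pi\<^sub>E {..<m} U \<subseteq> B"
    using B(1) unfolding heisenberg_power_topology_def openin_product_topology_alt by meson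
  have "\<exists>\<epsilon>>0. \<forall>t. \<bar>t\<bar> < \<epsilon> \<longrightarrow> (0, 0, t) \<in> U i" if i: "i < m" for i
  proof -
    have "open (U i)" using U(1) i by simp
    moreover have "continuous_on UNIV (\<lambda>t::real. (0::real, 0::real, t))" by (intro continuous_intros)
    ultimately have "open ((\<lambda>t::real. (0::real, 0::real, t)) -` U i)"
      by (simp add: open_vimage)
    moreover have "e i = (0, 0, 0)" unfolding e_def using i by (rule heisenberg_power_one)
    moreover have "e i \<in> U i" using U(2) i by auto
    ultimately have "\<exists>\<epsilon>>0. ball 0 \<epsilon> \<subseteq> (\<lambda>t::real. (0::real, 0::real, t)) -` U i"
      by (intro open_contains_ball[THEN iffD1, rule_format]) auto
    then obtain \<epsilon> where "\<epsilon> > 0" "ball 0 \<epsilon> \<subseteq> (\<lambda>t::real. (0::real, 0::real, t)) -` U i" by blast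
    then show ?thesis by (intro exI[of _ \<epsilon>]) (auto simp: subset_iff)
  qed
  then obtain f where f: "\<And>i. i < m \<Longrightarrow> f i > 0 \<and> (\<forall>t. \<bar>t\<bar> < f i \<longrightarrow> (0, 0, t) \<in> U i)" by metis
  define \<epsilon> where "\<epsilon> = Min (insert 1 (f ` {..<m}))"
  have \<epsilon>: "\<epsilon> > 0" "\<And>i. i < m \<Longrightarrow> \<epsilon> \<le> f i" using f by (auto simp: \<epsilon>_def)
  have "coord_Z m g = 0" if g: "g \<in> \<Gamma>" "coord_W m g = 0" "\<forall>i<m. \<bar>coord_Z m g i\<bar> < \<epsilon>" for g
  proof -
    have gi: "g i = (0, 0, coord_Z m g i)" if i: "i < m" for i
    proof -
      have "fst (g i) = 0" "fst (snd (g i)) = 0"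
        using fun_cong[OF g(2), of i] i by (simp_all add: coord_W_def complex_eq_iff)
      then show ?thesis using i by (simp add: coord_Z_def prod_eq_iff)
    qed
    have gU: "g i \<in> U i" if i: "i < m" for i
    proof -
      have "\<bar>coord_Z m g i\<bar> < f i" using g(3) i \<epsilon>(2)[OF i] by (meson less_le_trans)
      then show ?thesis using f[OF i] gi[OF i] by simp
    qed
    have "g \<in> carrier (heisenberg_power m)" using g(1) subgroup.subset[OF sub] by blast
    then have "g \<in> Pi\<^sub>E {..<m} U"
      using gU unfolding carrier_heisenberg_power by (auto simp: PiE_iff)
    then have "g \<in> B \<inter> \<Gamma>" using U(3) g(1) by blast
    then have "g = e" using B(2) by blast
    then show ?thesis by (intro ext) (simp add: coord_Z_def e_def heisenberg_power_one)
  qed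
  then show ?thesis using \<epsilon>(1) by blast
qed

lemma heisenberg_latticeI:
  assumes "subgroup \<Gamma> (heisenberg_power m)" "rel_dense m (coord_W m ` \<Gamma>)"
    "\<exists>\<epsilon>>0. \<forall>g\<in>\<Gamma>. coord_W m g = 0 \<longrightarrow> (\<forall>i<m. \<bar>coord_Z m g i\<bar> < \<epsilon>) \<longrightarrow> coord_Z m g = 0"
  shows "heisenberg_lattice (lattice_group m \<Gamma>) m (coord_W m) (coord_Z m)"
proof -
  interpret group "lattice_group m \<Gamma>"
    using assms(1) group_heisenberg_power by (rule subgroup.subgroup_is_group)
  have sub: "\<Gamma> \<subseteq> carrier (heisenberg_power m)" using assms(1) by (rule subgroup.subset)
  show ?thesis
  proof unfold_locales
    show "supported m (coord_W m g)" "supported m (coord_Z m g)" for g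
      by (simp_all add: supported_def coord_W_def coord_Z_def)
    show "coord_W m (g \<otimes>\<^bsub>lattice_group m \<Gamma>\<^esub> h) = coord_W m g + coord_W m h" for g h
      using coord_W_mult by simp
    show "coord_Z m (g \<otimes>\<^bsub>lattice_group m \<Gamma>\<^esub> h) =
      coord_Z m g + coord_Z m h + const_vec (1 / 2) \<star> symp (coord_W m g) (coord_W m h)" for g h
      using coord_Z_mult by simp
    show "g = h" if "g \<in> carrier (lattice_group m \<Gamma>)" "h \<in> carrier (lattice_group m \<Gamma>)"
      "coord_W m g = coord_W m h" "coord_Z m g = coord_Z m h" for g h
      using that sub by (intro coords_inject) auto
    show "rel_dense m (coord_W m ` carrier (lattice_group m \<Gamma>))" using assms(2) by simp
    show "\<exists>\<epsilon>>0. \<forall>g\<in>carrier (lattice_group m \<Gamma>). coord_W m g = 0 \<longrightarrow>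
        (\<forall>i<m. \<bar>coord_Z m g i\<bar> < \<epsilon>) \<longrightarrow> coord_Z m g = 0"
      using assms(3) by simp
  qed
qed

theorem cocompact_lattice_coordinates:
  assumes "cocompact_lattice (heisenberg_power m) (heisenberg_power_topology m) \<Gamma>"
  shows "heisenberg_lattice (lattice_group m \<Gamma>) m (coord_W m) (coord_Z m)"
proof -
  have "subgroup \<Gamma> (heisenberg_power m)" using assms by (simp add: cocompact_lattice_def)
  then show ?thesis
    using cocompact_rel_dense[OF assms] discrete_center[OF assms] by (rule heisenberg_latticeI)
qed

context heisenberg_lattice
begin

text \<open>Commutators are central.\<close>

lemma nilpotent: "nilpotent_group G"
  unfolding nilpotent_group_def
proof (intro conjI exI)
  show "group G" by (rule is_group)
  have one: "lower_central_series G 1 \<subseteq> {g \<in> carrier G. W g = 0}"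
  proof
    fix x assume "x \<in> lower_central_series G 1"
    then have "x \<in> generate G (\<Union>a\<in>carrier G. \<Union>b\<in>carrier G. {a \<otimes> b \<otimes> inv a \<otimes> inv b})" by simp
    then show "x \<in> {g \<in> carrier G. W g = 0}"
      by (induction rule: generate.induct) (auto simp: W_one W_mult W_inv)
  qed
  have two: "a \<otimes> b \<otimes> inv a \<otimes> inv b = \<one>" if "a \<in> lower_central_series G 1" "b \<in> carrier G" for a b
  proof -
    have a: "a \<in> carrier G" "W a = 0" using one that(1) by auto
    have "a \<otimes> b = b \<otimes> a"
      using a that(2) by (intro coords_inj) (auto simp: W_mult Z_mult_central)
    then have "a \<otimes> b \<otimes> inv a = b" using a that(2) by (simp add: m_assoc)
    then show ?thesis using that(2) by simp
  qed
  have "lower_central_series G 2 \<subseteq> {\<one>}"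
  proof
    fix x assume "x \<in> lower_central_series G 2"
    then have "x \<in> generate G (\<Union>a\<in>lower_central_series G 1. \<Union>b\<in>carrier G. {a \<otimes> b \<otimes> inv a \<otimes> inv b})"
      unfolding numeral_2_eq_2 One_nat_def by (simp only: lower_central_series.simps(2))
    then show "x \<in> {\<one>}"
    proof (induction rule: generate.induct)
      case (incl h)
      then obtain a b where "a \<in> lower_central_series G 1" "b \<in> carrier G" "h = a \<otimes> b \<otimes> inv a \<otimes> inv b"
        by blast
      then show ?case using two by blast
    next
      case (inv h)
      then obtain a b where "a \<in> lower_central_series G 1" "b \<in> carrier G" "h = a \<otimes> b \<otimes> inv a \<otimes> inv b"
        by blast
      then have "h = \<one>" using two by blast
      then show ?case by simp
    qed auto
  qed
  moreover have "\<one> \<in> lower_central_series G 2"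
    unfolding numeral_2_eq_2 by (simp add: generate.one)
  ultimately show "lower_central_series G 2 = {\<one>}" by blast
qed

end

section \<open>Quasi-isometry of lattices\<close>

text \<open>The quotient \<open>(v, y)\<^bsup>-1\<^esup> (w, z)\<close> has both coordinates bounded by
  \<open>R\<close>.\<close>

definition close_coords :: "nat \<Rightarrow> real \<Rightarrow> (nat \<Rightarrow> complex) \<Rightarrow> (nat \<Rightarrow> real) \<Rightarrow> (nat \<Rightarrow> complex) \<Rightarrow> (nat \<Rightarrow> real) \<Rightarrow> bool"
  where "close_coords m R w z v y \<longleftrightarrow> bounded_by m R (w - v) \<and>
    bounded_by m R (z - y - const_vec (1 / 2) \<star> symp v w)"

lemma close_coords_mono: "close_coords m R w z v y \<Longrightarrow> R \<le> R' \<Longrightarrow> close_coords m R' w z v y"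
  unfolding close_coords_def
  using bounded_by_mono[of m R "w - v" R'] bounded_by_mono[of m R "z - y - const_vec (1 / 2) \<star> symp v w" R']
  by blast

lemma close_coords_sym: "close_coords m R w z v y \<Longrightarrow> close_coords m R v y w z"
proof -
  have "symp v w i = - symp w v i" for i by (simp add: symp_apply)
  then have "y i - z i - symp w v i / 2 = - (z i - y i - symp v w i / 2)" for i
    by (simp add: field_simps)
  then have "\<bar>y i - z i - symp w v i / 2\<bar> = \<bar>z i - y i - symp v w i / 2\<bar>" for i
    by (simp only: abs_minus_cancel)
  then show "close_coords m R w z v y \<Longrightarrow> close_coords m R v y w z"
    unfolding close_coords_def bounded_by_def by (simp add: norm_minus_commute)
qed

text \<open>Replacing both points by close ones multiplies the size of their quotient by a constant at most, the size being
  that for which the central coordinate counts with its square root. The central coordinate of the new quotient is that of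
  the old one plus those of the two corrections plus terms bilinear in corrections and old quotient.\<close>

lemma close_coords_difference:
  assumes near: "close_coords m R w1 z1 v1 y1" "close_coords m R w2 z2 v2 y2"
    and b: "bounded_by m r (w2 - w1)" "bounded_by m (r\<^sup>2) (z2 - z1 - const_vec (1 / 2) \<star> symp w1 w2)"
    and r: "r \<ge> 1" "R \<ge> 1"
  shows "bounded_by m (3 * R * r) (v2 - v1)"
    "bounded_by m ((3 * R * r)\<^sup>2) (y2 - y1 - const_vec (1 / 2) \<star> symp v1 v2)"
proof -
  have Rr: "R \<le> R * r" "r \<le> R * r" "1 \<le> R * r"
    using r mult_mono[of 1 R 1 r] mult_right_mono[of 1 R r] mult_left_mono[of 1 r R] by auto
  show "bounded_by m (3 * R * r) (v2 - v1)"
    unfolding bounded_by_def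
  proof (intro allI impI)
    fix i assume i: "i < m"
    have "cmod (w2 i - v2 i) \<le> R" "cmod (w1 i - v1 i) \<le> R" "cmod (w2 i - w1 i) \<le> r"
      using near b(1) i by (auto simp: close_coords_def dest: bounded_byD)
    then have "cmod (w1 i - v1 i - (w2 i - v2 i)) \<le> R + R" "cmod (w2 i - w1 i) \<le> r"
      by (meson add_mono norm_triangle_ineq4 order_trans)+
    then have "cmod ((w1 i - v1 i - (w2 i - v2 i)) + (w2 i - w1 i)) \<le> R + R + r" by (rule norm_triangle_mono)
    then show "norm ((v2 - v1) i) \<le> 3 * R * r" using Rr by (simp add: algebra_simps)
  qed
  show "bounded_by m ((3 * R * r)\<^sup>2) (y2 - y1 - const_vec (1 / 2) \<star> symp v1 v2)"
    unfolding bounded_by_def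
  proof (intro allI impI)
    fix i assume i: "i < m"
    define k1 where "k1 = w1 - v1"
    define k2 where "k2 = w2 - v2"
    have k: "cmod (k1 i) \<le> R" "cmod (k2 i) \<le> R" "cmod ((w2 - w1) i) \<le> r"
      using near b(1) i by (auto simp: close_coords_def k1_def k2_def dest: bounded_byD)
    have a: "\<bar>z1 i - y1 i - symp v1 w1 i / 2\<bar> \<le> R" "\<bar>z2 i - y2 i - symp v2 w2 i / 2\<bar> \<le> R"
      "\<bar>z2 i - z1 i - symp w1 w2 i / 2\<bar> \<le> r\<^sup>2"
      using near b(2) i by (auto simp: close_coords_def dest: bounded_byD)
    have "y2 i - y1 i - symp v1 v2 i / 2 = (z2 i - z1 i - symp w1 w2 i / 2)
      + (z1 i - y1 i - symp v1 w1 i / 2) - (z2 i - y2 i - symp v2 w2 i / 2)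
      + (symp (k1 + k2) (w2 - w1) i - symp k1 k2 i) / 2"
      by (simp add: symp_apply k1_def k2_def algebra_simps) (simp add: field_simps)
    moreover have "\<bar>symp (k1 + k2) (w2 - w1) i\<bar> \<le> 2 * R * r"
    proof -
      have "cmod ((k1 + k2) i) \<le> R + R"
        unfolding plus_fun_apply using k(1,2) by (rule norm_triangle_mono)
      then have "cmod ((k1 + k2) i) * cmod ((w2 - w1) i) \<le> (R + R) * r"
        using k(3) r by (intro mult_mono) auto
      then show ?thesis using norm_symp_le[of "k1 + k2" "w2 - w1" i] by simp
    qed
    moreover have "\<bar>symp k1 k2 i\<bar> \<le> R * R"
    proof -
      have "cmod (k1 i) * cmod (k2 i) \<le> R * R" using k(1,2) r by (intro mult_mono) auto
      then show ?thesis using norm_symp_le[of k1 k2 i] by simp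
    qed
    moreover have "\<bar>A + B - C + (D - E) / 2\<bar> \<le> r2 + R + R + (d + e) / 2"
      if "\<bar>A\<bar> \<le> r2" "\<bar>B\<bar> \<le> R" "\<bar>C\<bar> \<le> R" "\<bar>D\<bar> \<le> d" "\<bar>E\<bar> \<le> e" for A B C D E r2 d e :: real
      using that by (simp add: abs_le_iff field_simps)
    ultimately have "\<bar>y2 i - y1 i - symp v1 v2 i / 2\<bar> \<le> r\<^sup>2 + R + R + (2 * R * r + R * R) / 2"
      using a by metis
    also have "\<dots> \<le> (3 * R * r)\<^sup>2"
    proof -
      have "r * r \<le> (R * r) * (R * r)" "R * R \<le> (R * r) * (R * r)" "R * r * 1 \<le> (R * r) * (R * r)"
        using Rr r by (intro mult_mono; simp)+
      then have "r\<^sup>2 \<le> (R * r)\<^sup>2" "R * R \<le> (R * r)\<^sup>2" "R * r \<le> (R * r)\<^sup>2"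
        by (simp_all add: power2_eq_square)
      moreover have "(3 * R * r)\<^sup>2 = 9 * (R * r)\<^sup>2" by (simp add: power_mult_distrib)
      moreover have "r\<^sup>2 + R + R + (2 * R * r + R * R) / 2 = r\<^sup>2 + 2 * R + R * r + (R * R) / 2" by simp
      ultimately show ?thesis using Rr by linarith
    qed
    finally show "norm ((y2 - y1 - const_vec (1 / 2) \<star> symp v1 v2) i) \<le> (3 * R * r)\<^sup>2" by simp
  qed
qed

context heisenberg_lattice
begin

text \<open>Approximate the projection by that of any lattice element, and then the central coordinate by a central
  factor.\<close>

lemma close_element_exists: "\<exists>R\<ge>1. \<forall>w z. \<exists>b\<in>carrier G. close_coords m R w z (W b) (Z b)"
proof -
  obtain R1 where R1: "R1 \<ge> 1" "\<And>x. \<exists>d\<in>proj. bounded_by m R1 (x - d)" using rel_denseE[OF L_rel_dense] by blast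
  obtain R2 where R2: "R2 \<ge> 1" "\<And>x. \<exists>d\<in>center_coords. bounded_by m R2 (x - d)" using rel_denseE[OF \<Lambda>_rel_dense] by blast
  have "\<exists>b\<in>carrier G. close_coords m (R1 + R2) w z (W b) (Z b)" for w z
  proof -
    obtain b where b: "b \<in> carrier G" "bounded_by m R1 (w - W b)" using R1(2)[of w] by blast
    obtain c where c: "c \<in> carrier G" "W c = 0" "bounded_by m R2 (z - Z b - const_vec (1 / 2) \<star> symp (W b) w - Z c)"
      using R2(2)[of "z - Z b - const_vec (1 / 2) \<star> symp (W b) w"] by blast
    have bc: "b \<otimes> c \<in> carrier G" "W (b \<otimes> c) = W b" "Z (b \<otimes> c) = Z b + Z c"
      using b(1) c(1,2) by (simp_all add: W_mult Z_mult_central)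
    have eq: "z - Z b - const_vec (1 / 2) \<star> symp (W b) w - Z c = z - (Z b + Z c) - const_vec (1 / 2) \<star> symp (W b) w"
      by (rule ext) simp
    have "close_coords m (R1 + R2) w z (W (b \<otimes> c)) (Z (b \<otimes> c))"
      unfolding close_coords_def bc(2,3)
    proof
      show "bounded_by m (R1 + R2) (w - W b)" using b(2) by (rule bounded_by_mono) (use R2(1) in simp)
      show "bounded_by m (R1 + R2) (z - (Z b + Z c) - const_vec (1 / 2) \<star> symp (W b) w)"
        using c(3) unfolding eq by (rule bounded_by_mono) (use R1(1) in simp)
    qed
    then show ?thesis using bc(1) by blast
  qed
  moreover have "R1 + R2 \<ge> 1" using R1(1) R2(1) by simp
  ultimately show ?thesis by blast
qed

lemma coords_quotient:
  assumes "a \<in> carrier G" "b \<in> carrier G"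
  shows "W (inv a \<otimes> b) = W b - W a" "Z (inv a \<otimes> b) = Z b - Z a - const_vec (1 / 2) \<star> symp (W a) (W b)"
proof -
  show "W (inv a \<otimes> b) = W b - W a" using assms by (simp add: W_mult W_inv)
  show "Z (inv a \<otimes> b) = Z b - Z a - const_vec (1 / 2) \<star> symp (W a) (W b)"
  proof
    fix i
    show "Z (inv a \<otimes> b) i = (Z b - Z a - const_vec (1 / 2) \<star> symp (W a) (W b)) i"
      using assms by (simp add: Z_mult W_inv Z_inv symp_apply) (simp add: field_simps)
  qed
qed

end

lemma close_distance_bound:
  fixes G1 :: "('a, 'c) monoid_scheme" and G2 :: "('b, 'd) monoid_scheme"
  assumes "generated_heisenberg_lattice G1 m W1 Z1 S1" "generated_heisenberg_lattice G2 m W2 Z2 S2"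
    and R: "R \<ge> 1"
  shows "\<exists>K\<ge>1. \<forall>a\<in>carrier G1. \<forall>b\<in>carrier G1. \<forall>a'\<in>carrier G2. \<forall>b'\<in>carrier G2.
    close_coords m R (W1 a) (Z1 a) (W2 a') (Z2 a') \<longrightarrow> close_coords m R (W1 b) (Z1 b) (W2 b') (Z2 b') \<longrightarrow>
    word_dist G2 S2 a' b' \<le> K * (word_dist G1 S1 a b + 1)"
proof -
  interpret A: generated_heisenberg_lattice G1 m W1 Z1 S1 by (rule assms(1))
  interpret B: generated_heisenberg_lattice G2 m W2 Z2 S2 by (rule assms(2))
  obtain c where c: "c \<ge> 1" "\<forall>g\<in>carrier G1. bounded_by m (c * real (word_norm G1 S1 g)) (W1 g) \<and>
      bounded_by m (c * (real (word_norm G1 S1 g))\<^sup>2) (Z1 g)" using A.word_norm_lower_bound by blast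
  obtain C where C: "C \<ge> 1" "\<forall>r\<ge>1. \<forall>g\<in>carrier G2. bounded_by m r (W2 g) \<longrightarrow> bounded_by m (r\<^sup>2) (Z2 g) \<longrightarrow>
      real (word_norm G2 S2 g) \<le> C * r" using B.word_norm_upper_bound by blast
  have "word_dist G2 S2 a' b' \<le> (C * (3 * R * c)) * (word_dist G1 S1 a b + 1)"
    if a: "a \<in> carrier G1" "a' \<in> carrier G2" and b: "b \<in> carrier G1" "b' \<in> carrier G2"
      and near: "close_coords m R (W1 a) (Z1 a) (W2 a') (Z2 a')" "close_coords m R (W1 b) (Z1 b) (W2 b') (Z2 b')"
    for a b a' b'
  proof -
    define g where "g = inv\<^bsub>G1\<^esub> a \<otimes>\<^bsub>G1\<^esub> b"
    define h where "h = inv\<^bsub>G2\<^esub> a' \<otimes>\<^bsub>G2\<^esub> b'"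
    define n where "n = real (word_norm G1 S1 g)"
    have n0: "n \<ge> 0" by (simp add: n_def)
    define r where "r = c * (n + 1)"
    have r1: "r \<ge> 1" using c(1) n0 mult_mono[of 1 c 1 "n + 1"] by (simp add: r_def)
    have g: "g \<in> carrier G1" using a b by (simp add: g_def)
    have h: "h \<in> carrier G2" using a b by (simp add: h_def)
    have "bounded_by m (c * n) (W1 g)" "bounded_by m (c * n\<^sup>2) (Z1 g)" using c(2) g by (auto simp: n_def)
    moreover have "c * n \<le> r" using c(1) by (simp add: r_def)
    moreover have "c * n\<^sup>2 \<le> r\<^sup>2"
    proof -
      have "c * n\<^sup>2 \<le> c\<^sup>2 * (n + 1)\<^sup>2"
        using c(1) n0 by (intro mult_mono power_mono) (auto simp: power2_eq_square)
      then show ?thesis by (simp add: r_def power_mult_distrib)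
    qed
    ultimately have "bounded_by m r (W1 g)" "bounded_by m (r\<^sup>2) (Z1 g)"
      using bounded_by_mono by blast+
    then have "bounded_by m r (W1 b - W1 a)" "bounded_by m (r\<^sup>2) (Z1 b - Z1 a - const_vec (1 / 2) \<star> symp (W1 a) (W1 b))"
      unfolding g_def A.coords_quotient[OF a(1) b(1)] by auto
    from close_coords_difference[OF near this r1 R]
    have "bounded_by m (3 * R * r) (W2 h)" "bounded_by m ((3 * R * r)\<^sup>2) (Z2 h)"
      unfolding h_def B.coords_quotient[OF a(2) b(2)] by auto
    moreover have "3 * R * r \<ge> 1" using R r1 mult_mono[of 1 "3 * R" 1 r] by simp
    ultimately have "real (word_norm G2 S2 h) \<le> C * (3 * R * r)" using C(2) h by blast
    then show ?thesis by (simp add: word_dist_def g_def[symmetric] h_def[symmetric] n_def[symmetric] r_def)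
  qed
  moreover have "C * (3 * R * c) \<ge> 1"
    using C(1) R c(1) mult_mono[of 1 "3 * R" 1 c] mult_mono[of 1 C 1 "3 * R * c"] by simp
  ultimately show ?thesis by blast
qed

text \<open>Send \<open>a\<close> to an element of the other lattice that is close in coordinates. The relation of closeness
  is symmetric, so one comparison of distances gives both inequalities and coarse surjectivity.\<close>

theorem heisenberg_lattices_quasi_isometric:
  fixes G1 :: "('a, 'c) monoid_scheme" and G2 :: "('b, 'd) monoid_scheme"
  assumes "heisenberg_lattice G1 m W1 Z1" "heisenberg_lattice G2 m W2 Z2"
  shows "quasi_isometric_groups G1 G2"
proof -
  interpret A: heisenberg_lattice G1 m W1 Z1 by (rule assms(1))
  interpret B: heisenberg_lattice G2 m W2 Z2 by (rule assms(2))
  have "\<exists>f. quasi_isometry (carrier G1) (word_dist G1 S) (carrier G2) (word_dist G2 T) f"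
    if S: "finite_generating_set G1 S" and T: "finite_generating_set G2 T" for S T
  proof -
    have AS: "generated_heisenberg_lattice G1 m W1 Z1 S"
      by (intro generated_heisenberg_lattice.intro assms generated_group.intro generated_group_axioms.intro
          A.is_group S)
    have BT: "generated_heisenberg_lattice G2 m W2 Z2 T"
      by (intro generated_heisenberg_lattice.intro assms generated_group.intro generated_group_axioms.intro
          B.is_group T)
    interpret AS: generated_heisenberg_lattice G1 m W1 Z1 S by (rule AS)
    obtain R1 where R1: "R1 \<ge> 1" "\<forall>w z. \<exists>b\<in>carrier G1. close_coords m R1 w z (W1 b) (Z1 b)"
      using A.close_element_exists by blast
    obtain R2 where R2: "R2 \<ge> 1" "\<forall>w z. \<exists>b\<in>carrier G2. close_coords m R2 w z (W2 b) (Z2 b)"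
      using B.close_element_exists by blast
    define R where "R = max R1 R2"
    have R: "R \<ge> 1" using R1 by (simp add: R_def)
    define near where "near a b \<longleftrightarrow> close_coords m R (W1 a) (Z1 a) (W2 b) (Z2 b)" for a b
    have ex2: "\<exists>b\<in>carrier G2. near a b" for a
      using R2(2) close_coords_mono[of m R2 _ _ _ _ R] unfolding near_def R_def by fastforce
    have ex1: "\<exists>a\<in>carrier G1. near a b" for b
      using R1(2) close_coords_mono[of m R1 _ _ _ _ R] close_coords_sym unfolding near_def R_def by fastforce
    define f where "f a = (SOME b. b \<in> carrier G2 \<and> near a b)" for a
    have f: "f a \<in> carrier G2" "near a (f a)" for a
    proof -
      have "\<exists>b. b \<in> carrier G2 \<and> near a b" using ex2 by blast
      then have "f a \<in> carrier G2 \<and> near a (f a)" unfolding f_def by (rule someI_ex)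
      then show "f a \<in> carrier G2" "near a (f a)" by auto
    qed
    obtain K1 where K1: "K1 \<ge> 1" "\<And>a b a' b'. a \<in> carrier G1 \<Longrightarrow> b \<in> carrier G1 \<Longrightarrow> a' \<in> carrier G2 \<Longrightarrow> b' \<in> carrier G2 \<Longrightarrow>
        near a a' \<Longrightarrow> near b b' \<Longrightarrow> word_dist G2 T a' b' \<le> K1 * (word_dist G1 S a b + 1)"
      using close_distance_bound[OF AS BT R] unfolding near_def by blast
    obtain K2 where K2: "K2 \<ge> 1" "\<And>a b a' b'. a \<in> carrier G1 \<Longrightarrow> b \<in> carrier G1 \<Longrightarrow> a' \<in> carrier G2 \<Longrightarrow> b' \<in> carrier G2 \<Longrightarrow>
        near a a' \<Longrightarrow> near b b' \<Longrightarrow> word_dist G1 S a b \<le> K2 * (word_dist G2 T a' b' + 1)"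
      using close_distance_bound[OF BT AS R] close_coords_sym unfolding near_def by meson
    define K where "K = K1 + K2"
    have K: "K \<ge> 1" "K1 \<le> K" "K2 \<le> K" using K1(1) K2(1) by (auto simp: K_def)
    have nonneg: "word_dist G1 S a b \<ge> 0" "word_dist G2 T a' b' \<ge> 0" for a b a' b'
      by (simp_all add: word_dist_def)
    have upper: "word_dist G2 T (f a) (f b) \<le> K * word_dist G1 S a b + K"
      if "a \<in> carrier G1" "b \<in> carrier G1" for a b
    proof -
      have "word_dist G2 T (f a) (f b) \<le> K1 * (word_dist G1 S a b + 1)" using K1(2) that f by blast
      also have "\<dots> \<le> K * (word_dist G1 S a b + 1)" using K(2) nonneg by (intro mult_right_mono) auto
      finally show ?thesis by (simp add: distrib_left)
    qed
    have lower: "word_dist G1 S a b / K - K \<le> word_dist G2 T (f a) (f b)"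
      if "a \<in> carrier G1" "b \<in> carrier G1" for a b
    proof -
      have "word_dist G1 S a b \<le> K2 * (word_dist G2 T (f a) (f b) + 1)" using K2(2) that f by blast
      also have "\<dots> \<le> K * (word_dist G2 T (f a) (f b) + 1)" using K(3) nonneg by (intro mult_right_mono) auto
      finally have "word_dist G1 S a b / K \<le> word_dist G2 T (f a) (f b) + 1"
        using K(1) by (simp add: pos_divide_le_eq mult.commute)
      then show ?thesis using K(1) by linarith
    qed
    have dense: "\<exists>a\<in>carrier G1. word_dist G2 T (f a) b \<le> K" if b: "b \<in> carrier G2" for b
    proof -
      obtain a where a: "a \<in> carrier G1" "near a b" using ex1 by blast
      have "word_dist G2 T (f a) b \<le> K1 * (word_dist G1 S a a + 1)"
        using K1(2)[OF a(1) a(1) f(1) b f(2) a(2)] .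
      moreover have "word_dist G1 S a a = 0" using a(1) AS.word_norm_one by (simp add: word_dist_def)
      ultimately have "word_dist G2 T (f a) b \<le> K" using K(2) by simp
      then show ?thesis using a(1) by blast
    qed
    have "quasi_isometry (carrier G1) (word_dist G1 S) (carrier G2) (word_dist G2 T) f"
      unfolding quasi_isometry_def
      using f(1) K(1) upper lower dense by (intro conjI exI[of _ K]) auto
    then show ?thesis by blast
  qed
  then show ?thesis
    unfolding quasi_isometric_groups_def finitely_generated_group_def
    using A.is_group B.is_group A.finitely_generated B.finitely_generated by blast
qed

section \<open>An irreducible polynomial with real roots\<close>

lemma poly_many_roots_0:
  fixes p :: "'a::idom poly"
  assumes "finite A" "Polynomial.degree p < card A" "\<And>x. x \<in> A \<Longrightarrow> poly p x = 0"
  shows "p = 0"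
proof (rule ccontr)
  assume p: "p \<noteq> 0"
  have "card A \<le> card {x. poly p x = 0}"
    using assms(3) poly_roots_finite[OF p] by (intro card_mono) auto
  also have "\<dots> \<le> Polynomial.degree p" using p by (rule card_poly_roots_bound)
  finally show False using assms(2) by simp
qed

definition split_poly :: "nat \<Rightarrow> int poly"
  where "split_poly k = (\<Prod>i<k. [:- 4 * int i, 1:]) - 1"

lemma split_poly_monic:
  assumes "k \<ge> 1"
  shows "Polynomial.degree (split_poly k) = k" "Polynomial.lead_coeff (split_poly k) = 1"
proof -
  define P :: "int poly" where "P = (\<Prod>i<k. [:- 4 * int i, 1:])"
  have deg: "Polynomial.degree P = k"
    unfolding P_def by (subst degree_prod_eq_sum_degree) auto
  have lc: "Polynomial.lead_coeff P = 1" unfolding P_def by (simp add: lead_coeff_prod)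
  have eq: "split_poly k = P + (- 1)" by (simp add: split_poly_def P_def)
  have "Polynomial.degree (- 1 :: int poly) < Polynomial.degree P" using assms deg by simp
  then show d: "Polynomial.degree (split_poly k) = k" unfolding eq using deg by (simp only: degree_add_eq_left)
  show "Polynomial.lead_coeff (split_poly k) = 1"
    unfolding d unfolding eq using lc deg assms by (simp add: Polynomial.coeff_1)
qed

text \<open>In a factorisation \<open>g h\<close> the values of \<open>g\<close> and \<open>h\<close> at the integers
  \<open>4 i\<close>, \<open>i < k\<close>, have product \<open>-1\<close>, so they are opposite. If both factors have degree
  less than \<open>k\<close> this forces \<open>h = -g\<close>, and \<open>-g\<^sup>2\<close> is not monic.\<close>

lemma split_poly_irreducible:
  assumes k: "k \<ge> 1"
  shows "Factorial_Ring.irreducible (split_poly k)"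
proof (rule Factorial_Ring.irreducibleI)
  show nz: "split_poly k \<noteq> 0" using split_poly_monic[OF k] by auto
  show "\<not> split_poly k dvd 1" using split_poly_monic(1)[OF k] k by (auto simp: is_unit_poly_iff)
  fix g h assume gh: "split_poly k = g * h"
  have nz': "g \<noteq> 0" "h \<noteq> 0" using gh nz by auto
  have deg: "Polynomial.degree g + Polynomial.degree h = k"
    using split_poly_monic(1)[OF k] nz' unfolding gh by (simp add: degree_mult_eq)
  have lc: "Polynomial.lead_coeff g * Polynomial.lead_coeff h = 1"
    using split_poly_monic(2)[OF k] unfolding gh lead_coeff_mult .
  have unit: "f dvd 1" if "Polynomial.degree f = 0" "Polynomial.lead_coeff f dvd 1" for f :: "int poly"
    using that by (auto simp: is_unit_poly_iff elim!: degree_eq_zeroE)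
  show "g dvd 1 \<or> h dvd 1"
  proof (cases "Polynomial.degree g < k \<and> Polynomial.degree h < k")
    case True
    define A where "A = (\<lambda>i. 4 * int i) ` {..<k}"
    have A: "finite A" "card A = k" unfolding A_def by (auto simp: card_image inj_on_def)
    have "g + h = 0"
    proof (rule poly_many_roots_0[OF A(1)])
      show "Polynomial.degree (g + h) < card A"
        using True A(2) by (intro le_less_trans[OF Polynomial.degree_add_le_max]) simp
      fix x assume "x \<in> A"
      then obtain i where i: "i < k" "x = 4 * int i" unfolding A_def by blast
      have "poly (\<Prod>i<k. [:- 4 * int i, 1:]) x = (\<Prod>j<k. poly [:- 4 * int j, 1:] x)" by (rule poly_prod)
      also have "\<dots> = 0" using i by (intro prod_zero bexI[of _ i]) auto
      finally have "poly (split_poly k) x = - 1" by (simp add: split_poly_def)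
      then have "poly g x * (- poly h x) = 1" unfolding gh by simp
      then have "poly g x = - poly h x" unfolding zmult_eq_1_iff by linarith
      then show "poly (g + h) x = 0" by simp
    qed
    then have "h = - g" by (simp add: eq_neg_iff_add_eq_0 add.commute)
    then have "Polynomial.lead_coeff g * Polynomial.lead_coeff g = - 1" using lc by simp
    then show ?thesis using zero_le_square[of "Polynomial.lead_coeff g"] by linarith
  next
    case False
    then have "Polynomial.degree h = 0 \<or> Polynomial.degree g = 0" using deg by linarith
    then show ?thesis using unit lc by (metis dvd_triv_left dvd_triv_right)
  qed
qed

abbreviation real_poly :: "int poly \<Rightarrow> real poly" where "real_poly \<equiv> map_poly real_of_int"

lemma real_poly_mult: "real_poly (f * g) = real_poly f * real_poly g"
  by (rule Polynomial.poly_eqI) (simp add: coeff_map_poly Polynomial.coeff_mult)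

lemma real_poly_add: "real_poly (f + g) = real_poly f + real_poly g"
  by (rule Polynomial.poly_eqI) (simp add: coeff_map_poly)

lemma real_poly_diff: "real_poly (f - g) = real_poly f - real_poly g"
  by (rule Polynomial.poly_eqI) (simp add: coeff_map_poly)

lemma degree_real_poly: "Polynomial.degree (real_poly f) = Polynomial.degree f"
  by (rule degree_map_poly) simp

lemma poly_real_split_poly:
  "poly (real_poly (split_poly k)) x = (\<Prod>i<k. x - 4 * real i) - 1"
proof -
  have "poly (real_poly (\<Prod>i<k. [:- 4 * int i, 1:])) x = (\<Prod>i<k. x - 4 * real i)"
  proof (induction k)
    case (Suc k)
    have "poly (real_poly [:- 4 * int k, 1:]) x = x - 4 * real k" by (simp add: map_poly_pCons)
    then show ?case unfolding prod.lessThan_Suc real_poly_mult poly_mult Suc.IH by (rule arg_cong)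
  qed simp
  moreover have "real_poly 1 = 1" by simp
  ultimately show ?thesis by (simp add: split_poly_def real_poly_diff)
qed

text \<open>The product \<open>s\<close> of the linear factors has modulus at least \<open>2\<close> at the points \<open>4 j
  - 2\<close>, and its sign alternates there. Subtracting \<open>1\<close> does not change the signs, so there is a root in
  each gap.\<close>

lemma split_poly_real_roots:
  "\<exists>\<theta>. inj_on \<theta> {..<k} \<and> (\<forall>i<k. poly (real_poly (split_poly k)) (\<theta> i) = 0)"
proof -
  define s where "s x = (\<Prod>i<k. x - 4 * real i)" for x
  have big: "\<bar>s (real_of_int (4 * t + 2))\<bar> \<ge> 2" if "k \<ge> 1" for t
  proof -
    have "2 \<le> \<bar>real_of_int (4 * t + 2) - 4 * real i\<bar>" for i
    proof -
      have "real_of_int (4 * t + 2) - 4 * real i = real_of_int (4 * (t - int i) + 2)" by simp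
      moreover have "2 \<le> \<bar>4 * (t - int i) + 2\<bar>" by presburger
      ultimately show ?thesis by linarith
    qed
    then have "(\<Prod>i<k. (2::real)) \<le> (\<Prod>i<k. \<bar>real_of_int (4 * t + 2) - 4 * real i\<bar>)"
      by (intro prod_mono) auto
    then have "2 ^ k \<le> \<bar>s (real_of_int (4 * t + 2))\<bar>" by (simp add: s_def abs_prod)
    moreover have "(2::real) ^ 1 \<le> 2 ^ k" using that by (intro power_increasing) auto
    ultimately show ?thesis by simp
  qed
  have "\<exists>x. 4 * real j - 2 < x \<and> x < 4 * real j + 2 \<and> poly (real_poly (split_poly k)) x = 0" if j: "j < k" for j
  proof -
    define a where "a = real_of_int (4 * (int j - 1) + 2)"
    define b where "b = real_of_int (4 * int j + 2)"
    have ab: "a = 4 * real j - 2" "b = 4 * real j + 2" by (simp_all add: a_def b_def)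
    have "s a * s b = (\<Prod>i<k. (a - 4 * real i) * (b - 4 * real i))" by (simp add: s_def prod.distrib)
    also have "\<dots> = ((a - 4 * real j) * (b - 4 * real j)) * (\<Prod>i\<in>{..<k} - {j}. (a - 4 * real i) * (b - 4 * real i))"
      using j by (intro prod.remove) auto
    also have "\<dots> < 0"
    proof (rule mult_neg_pos)
      show "(a - 4 * real j) * (b - 4 * real j) < 0" by (simp add: ab)
      show "(\<Prod>i\<in>{..<k} - {j}. (a - 4 * real i) * (b - 4 * real i)) > 0"
      proof (rule prod_pos)
        fix i assume "i \<in> {..<k} - {j}"
        then have "\<bar>real j - real i\<bar> \<ge> 1" by auto
        then have "1 \<le> \<bar>real j - real i\<bar> ^ 2" by (rule one_le_power)
        then have "1 \<le> (real j - real i)\<^sup>2" by (simp only: power2_abs)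
        moreover have "(a - 4 * real i) * (b - 4 * real i) = 16 * (real j - real i)\<^sup>2 - 4"
          by (simp add: ab power2_eq_square algebra_simps)
        ultimately show "0 < (a - 4 * real i) * (b - 4 * real i)" by linarith
      qed
    qed
    finally have neg: "s a * s b < 0" .
    have k1: "k \<ge> 1" using j by simp
    have "\<bar>s a\<bar> \<ge> 2" "\<bar>s b\<bar> \<ge> 2" unfolding a_def b_def by (rule big[OF k1])+
    then have "(s a - 1) * (s b - 1) < 0" using neg by (auto simp: mult_less_0_iff abs_if split: if_splits)
    moreover have "a < b" by (simp add: ab)
    ultimately show ?thesis
      using poly_IVT[of a b "real_poly (split_poly k)"] unfolding ab[symmetric] poly_real_split_poly s_def by blast
  qed
  then obtain \<theta> where \<theta>: "\<And>j. j < k \<Longrightarrow> 4 * real j - 2 < \<theta> j \<and> \<theta> j < 4 * real j + 2 \<and>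
      poly (real_poly (split_poly k)) (\<theta> j) = 0" by metis
  have "inj_on \<theta> {..<k}"
  proof (rule linorder_inj_onI)
    fix i j assume ij: "i < j" "i \<in> {..<k}" "j \<in> {..<k}"
    then have "\<theta> i < 4 * real i + 2" "4 * real j - 2 < \<theta> j" using \<theta> by auto
    moreover have "4 * real i + 4 \<le> 4 * real j" using ij(1) by linarith
    ultimately show "\<theta> i \<noteq> \<theta> j" by linarith
  qed auto
  then show ?thesis using \<theta> by blast
qed

lemma lagrange_basis:
  fixes \<theta> :: "nat \<Rightarrow> real"
  assumes "inj_on \<theta> {..<k}"
  shows "\<exists>l. \<forall>i<k. Polynomial.degree (l i) < k \<and> (\<forall>j<k. poly (l i) (\<theta> j) = (if i = j then 1 else 0))"
proof (intro exI allI impI)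
  define P where "P i = (\<Prod>j\<in>{..<k} - {i}. [:- \<theta> j, 1:])" for i
  fix i assume i: "i < k"
  have "Polynomial.degree (P i) = k - 1" unfolding P_def using i by (subst degree_prod_eq_sum_degree) auto
  then have "Polynomial.degree (P i) < k" using i by simp
  moreover have "Polynomial.degree (Polynomial.smult (1 / poly (P i) (\<theta> i)) (P i)) \<le> Polynomial.degree (P i)"
    by (rule Polynomial.degree_smult_le)
  moreover have "poly (Polynomial.smult (1 / poly (P i) (\<theta> i)) (P i)) (\<theta> j) = (if i = j then 1 else 0)"
    if j: "j < k" for j
  proof (cases "i = j")
    case True
    have "poly (P i) (\<theta> i) = (\<Prod>j\<in>{..<k} - {i}. \<theta> i - \<theta> j)" by (simp add: P_def poly_prod)
    also have "\<dots> \<noteq> 0" using assms i by (auto simp: inj_on_def)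
    finally show ?thesis using True by simp
  next
    case False
    have "poly (P i) (\<theta> j) = (\<Prod>l\<in>{..<k} - {i}. \<theta> j - \<theta> l)" by (simp add: P_def poly_prod)
    also have "\<dots> = 0" using False j by (intro prod_zero bexI[of _ j]) auto
    finally show ?thesis using False by simp
  qed
  ultimately show "Polynomial.degree (Polynomial.smult (1 / poly (P i) (\<theta> i)) (P i)) < k \<and>
      (\<forall>j<k. poly (Polynomial.smult (1 / poly (P i) (\<theta> i)) (P i)) (\<theta> j) = (if i = j then 1 else 0))"
    by (meson le_less_trans)
qed

section \<open>Lattices from rings of coordinates\<close>

lemma quotient_map_exists: "\<exists>Y. quotient_map Top Y q"
proof -
  define T where "T U \<longleftrightarrow> U \<subseteq> q ` topspace Top \<and> openin Top {x \<in> topspace Top. q x \<in> U}" for U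
  have ist: "istopology T"
    unfolding istopology_def
  proof (intro conjI allI impI)
    fix A B assume "T A" "T B"
    moreover have "{x \<in> topspace Top. q x \<in> A \<inter> B} = {x \<in> topspace Top. q x \<in> A} \<inter> {x \<in> topspace Top. q x \<in> B}" by blast
    ultimately show "T (A \<inter> B)" unfolding T_def by auto
  next
    fix \<K> assume "\<forall>K\<in>\<K>. T K"
    moreover have "{x \<in> topspace Top. q x \<in> \<Union>\<K>} = (\<Union>K\<in>\<K>. {x \<in> topspace Top. q x \<in> K})" by blast
    ultimately show "T (\<Union>\<K>)" unfolding T_def by auto
  qed
  have op: "openin (topology T) U \<longleftrightarrow> T U" for U using topology_inverse'[OF ist] by simp
  have "T (q ` topspace Top)"
  proof -
    have "{x \<in> topspace Top. q x \<in> q ` topspace Top} = topspace Top" by blast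
    then show ?thesis unfolding T_def by simp
  qed
  moreover have "topspace (topology T) = \<Union>{U. T U}" by (simp add: topspace_def[of "topology T"] op)
  moreover have "U \<subseteq> q ` topspace Top" if "T U" for U using that by (simp add: T_def)
  ultimately have top: "topspace (topology T) = q ` topspace Top" by blast
  have "quotient_map Top (topology T) q"
    unfolding quotient_map_def op top by (auto simp: T_def)
  then show ?thesis by blast
qed

definition cx :: "nat \<Rightarrow> (nat \<Rightarrow> heis) \<Rightarrow> nat \<Rightarrow> real"
  where "cx m g = (\<lambda>i. if i < m then fst (g i) else 0)"

definition cy :: "nat \<Rightarrow> (nat \<Rightarrow> heis) \<Rightarrow> nat \<Rightarrow> real"
  where "cy m g = (\<lambda>i. if i < m then fst (snd (g i)) else 0)"

definition cz :: "nat \<Rightarrow> (nat \<Rightarrow> heis) \<Rightarrow> nat \<Rightarrow> real"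
  where "cz m g = (\<lambda>i. if i < m then snd (snd (g i)) else 0)"

definition from_xyz :: "nat \<Rightarrow> (nat \<Rightarrow> real) \<Rightarrow> (nat \<Rightarrow> real) \<Rightarrow> (nat \<Rightarrow> real) \<Rightarrow> nat \<Rightarrow> heis"
  where "from_xyz m x y z = (\<lambda>i\<in>{..<m}. (x i, y i, z i))"

lemma from_xyz:
  assumes "supported m x" "supported m y" "supported m z"
  shows "from_xyz m x y z \<in> carrier (heisenberg_power m)"
    "cx m (from_xyz m x y z) = x" "cy m (from_xyz m x y z) = y" "cz m (from_xyz m x y z) = z"
  using assms
  by (auto simp: from_xyz_def carrier_heisenberg_power cx_def cy_def cz_def supported_def fun_eq_iff)

lemma xyz_mult:
  "cx m (g \<otimes>\<^bsub>heisenberg_power m\<^esub> h) = cx m g + cx m h"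
  "cy m (g \<otimes>\<^bsub>heisenberg_power m\<^esub> h) = cy m g + cy m h"
  "cz m (g \<otimes>\<^bsub>heisenberg_power m\<^esub> h) = cz m g + cz m h + cx m g \<star> cy m h"
  by (rule ext, simp add: cx_def cy_def cz_def heisenberg_power_mult)+

lemma xyz_one: "cx m \<one>\<^bsub>heisenberg_power m\<^esub> = 0" "cy m \<one>\<^bsub>heisenberg_power m\<^esub> = 0" "cz m \<one>\<^bsub>heisenberg_power m\<^esub> = 0"
  by (rule ext, simp add: cx_def cy_def cz_def heisenberg_power_one)+

lemma xyz_inject:
  assumes "g \<in> carrier (heisenberg_power m)" "h \<in> carrier (heisenberg_power m)"
    and "cx m g = cx m h" "cy m g = cy m h" "cz m g = cz m h"
  shows "g = h"
proof
  fix i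
  show "g i = h i"
  proof (cases "i < m")
    case True
    then show ?thesis
      using fun_cong[OF assms(3), of i] fun_cong[OF assms(4), of i] fun_cong[OF assms(5), of i]
      by (simp add: cx_def cy_def cz_def prod_eq_iff)
  next
    case False
    then have "i \<notin> {..<m}" by simp
    then show ?thesis
      using PiE_arb assms(1,2)[unfolded carrier_heisenberg_power] by metis
  qed
qed

text \<open>A discrete and cocompact subring of \<open>\<real>\<^sup>m\<close>. The points of the Heisenberg power with
  coordinates in it form a cocompact lattice.\<close>

locale coordinate_ring =
  fixes m :: nat and M :: "(nat \<Rightarrow> real) set"
  assumes M_subgroup: "add_subgroup M" and M_supported: "\<And>v. v \<in> M \<Longrightarrow> supported m v"
    and M_mult: "\<And>a b. a \<in> M \<Longrightarrow> b \<in> M \<Longrightarrow> a \<star> b \<in> M" and M_one: "ind 1 {..<m} \<in> M"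
    and M_rel_dense: "rel_dense m M"
    and M_discrete: "\<exists>\<epsilon>>0. \<forall>v\<in>M. (\<forall>i<m. \<bar>v i\<bar> < \<epsilon>) \<longrightarrow> v = 0"
begin

definition ring_points :: "(nat \<Rightarrow> heis) set"
  where "ring_points = {g \<in> carrier (heisenberg_power m). cx m g \<in> M \<and> cy m g \<in> M \<and> cz m g \<in> M}"

lemma from_xyz_ring_points: "x \<in> M \<Longrightarrow> y \<in> M \<Longrightarrow> z \<in> M \<Longrightarrow> from_xyz m x y z \<in> ring_points"
  using from_xyz[of m x y z] M_supported by (simp add: ring_points_def)

lemma M_uminus: assumes "a \<in> M" shows "- a \<in> M"
  using add_subgroup_diff[OF M_subgroup add_subgroup_0[OF M_subgroup] assms] by simp

lemma subgroup_ring_points: "subgroup ring_points (heisenberg_power m)"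
proof -
  interpret N: group "heisenberg_power m" by (rule group_heisenberg_power)
  have M0: "0 \<in> M" using M_subgroup by (rule add_subgroup_0)
  show ?thesis
  proof (rule N.subgroupI)
    show "ring_points \<subseteq> carrier (heisenberg_power m)" by (auto simp: ring_points_def)
    have "\<one>\<^bsub>heisenberg_power m\<^esub> \<in> ring_points" using M0 by (simp add: ring_points_def xyz_one)
    then show "ring_points \<noteq> {}" by blast
    fix g assume g: "g \<in> ring_points"
    then have gM: "g \<in> carrier (heisenberg_power m)" "cx m g \<in> M" "cy m g \<in> M" "cz m g \<in> M"
      by (auto simp: ring_points_def)
    define h where "h = from_xyz m (- cx m g) (- cy m g) (cx m g \<star> cy m g - cz m g)"
    have inM: "- cx m g \<in> M" "- cy m g \<in> M" "cx m g \<star> cy m g - cz m g \<in> M"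
      using gM M_uminus add_subgroup_diff[OF M_subgroup M_mult[OF gM(2,3)] gM(4)] by auto
    have h: "h \<in> ring_points" unfolding h_def using inM by (rule from_xyz_ring_points)
    then have hN: "h \<in> carrier (heisenberg_power m)" by (simp add: ring_points_def)
    have hxyz: "cx m h = - cx m g" "cy m h = - cy m g" "cz m h = cx m g \<star> cy m g - cz m g"
      unfolding h_def using from_xyz(2-4) inM M_supported by auto
    have "h \<otimes>\<^bsub>heisenberg_power m\<^esub> g = \<one>\<^bsub>heisenberg_power m\<^esub>"
    proof (rule xyz_inject[of _ m])
      show "h \<otimes>\<^bsub>heisenberg_power m\<^esub> g \<in> carrier (heisenberg_power m)" using gM(1) hN by simp
      show "cx m (h \<otimes>\<^bsub>heisenberg_power m\<^esub> g) = cx m \<one>\<^bsub>heisenberg_power m\<^esub>"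
        "cy m (h \<otimes>\<^bsub>heisenberg_power m\<^esub> g) = cy m \<one>\<^bsub>heisenberg_power m\<^esub>"
        "cz m (h \<otimes>\<^bsub>heisenberg_power m\<^esub> g) = cz m \<one>\<^bsub>heisenberg_power m\<^esub>"
        unfolding xyz_mult xyz_one hxyz by (rule ext, simp)+
    qed simp
    then have "inv\<^bsub>heisenberg_power m\<^esub> g = h" using gM(1) hN by (rule N.inv_equality)
    then show "inv\<^bsub>heisenberg_power m\<^esub> g \<in> ring_points" using h by simp
    fix h assume "h \<in> ring_points"
    then have hM: "h \<in> carrier (heisenberg_power m)" "cx m h \<in> M" "cy m h \<in> M" "cz m h \<in> M"
      by (auto simp: ring_points_def)
    have "g \<otimes>\<^bsub>heisenberg_power m\<^esub> h \<in> carrier (heisenberg_power m)" using gM(1) hM(1) by (rule N.m_closed)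
    then show "g \<otimes>\<^bsub>heisenberg_power m\<^esub> h \<in> ring_points"
      unfolding ring_points_def mem_Collect_eq xyz_mult
      by (intro conjI add_subgroup_add[OF M_subgroup] M_mult gM hM)
  qed
qed

lemma discrete_ring_points:
  "subtopology (heisenberg_power_topology m) ring_points = discrete_topology ring_points"
proof -
  define T where "T = heisenberg_power_topology m"
  have sub: "ring_points \<subseteq> topspace T" unfolding T_def topspace_heisenberg_power by (auto simp: ring_points_def)
  obtain \<epsilon> where \<epsilon>: "\<epsilon> > 0" "\<And>v. v \<in> M \<Longrightarrow> (\<forall>i<m. \<bar>v i\<bar> < \<epsilon>) \<Longrightarrow> v = 0" using M_discrete by blast
  have "openin (subtopology T ring_points) {g}" if g: "g \<in> ring_points" for g
  proof -
    define U where "U = Pi\<^sub>E {..<m} (\<lambda>i. ball (g i) \<epsilon>)"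
    have "openin T U"
      unfolding T_def heisenberg_power_topology_def U_def by (subst openin_PiE) auto
    moreover have "{g} = U \<inter> ring_points"
    proof
      have "g \<in> {..<m} \<rightarrow>\<^sub>E UNIV" using g by (simp add: ring_points_def carrier_heisenberg_power)
      then show "{g} \<subseteq> U \<inter> ring_points" using g \<epsilon>(1) by (auto simp: U_def PiE_iff)
      show "U \<inter> ring_points \<subseteq> {g}"
      proof
        fix h assume h: "h \<in> U \<inter> ring_points"
        have "h \<in> U" using h by blast
        then have d: "dist (g i) (h i) < \<epsilon>" if "i < m" for i
          using that PiE_mem[of h "{..<m}" "\<lambda>i. ball (g i) \<epsilon>" i] unfolding U_def by simp
        have hg: "h \<in> carrier (heisenberg_power m)" "g \<in> carrier (heisenberg_power m)"
          "cx m h \<in> M" "cy m h \<in> M" "cz m h \<in> M" "cx m g \<in> M" "cy m g \<in> M" "cz m g \<in> M"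
          using h g by (auto simp: ring_points_def)
        have small: "\<bar>fst (h i) - fst (g i)\<bar> < \<epsilon>" "\<bar>fst (snd (h i)) - fst (snd (g i))\<bar> < \<epsilon>"
          "\<bar>snd (snd (h i)) - snd (snd (g i))\<bar> < \<epsilon>" if i: "i < m" for i
        proof -
          have 0: "dist (h i) (g i) < \<epsilon>" using d[OF i] by (simp add: dist_commute)
          have 1: "dist (snd (h i)) (snd (g i)) < \<epsilon>" using dist_snd_le 0 by (rule le_less_trans)
          have 2: "dist (fst (h i)) (fst (g i)) < \<epsilon>" using dist_fst_le 0 by (rule le_less_trans)
          have 3: "dist (fst (snd (h i))) (fst (snd (g i))) < \<epsilon>" using dist_fst_le 1 by (rule le_less_trans)
          have 4: "dist (snd (snd (h i))) (snd (snd (g i))) < \<epsilon>" using dist_snd_le 1 by (rule le_less_trans)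
          show "\<bar>fst (h i) - fst (g i)\<bar> < \<epsilon>" "\<bar>fst (snd (h i)) - fst (snd (g i))\<bar> < \<epsilon>"
            "\<bar>snd (snd (h i)) - snd (snd (g i))\<bar> < \<epsilon>"
            using 2 3 4 by (simp_all add: dist_real_def)
        qed
        have "cx m h - cx m g = 0"
          by (rule \<epsilon>(2)[OF add_subgroup_diff[OF M_subgroup hg(3,6)]]) (use small in \<open>simp add: cx_def\<close>)
        moreover have "cy m h - cy m g = 0"
          by (rule \<epsilon>(2)[OF add_subgroup_diff[OF M_subgroup hg(4,7)]]) (use small in \<open>simp add: cy_def\<close>)
        moreover have "cz m h - cz m g = 0"
          by (rule \<epsilon>(2)[OF add_subgroup_diff[OF M_subgroup hg(5,8)]]) (use small in \<open>simp add: cz_def\<close>)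
        ultimately have "h = g"
          unfolding right_minus_eq by (rule xyz_inject[OF hg(1,2)])
        then show "h \<in> {g}" by simp
      qed
    qed
    ultimately show ?thesis unfolding openin_subtopology by blast
  qed
  moreover have "topspace (subtopology T ring_points) = ring_points" using Int_absorb1[OF sub] by simp
  ultimately show ?thesis unfolding T_def using discrete_topology_unique by metis
qed

lemma cocompact_ring_points:
  "cocompact_lattice (heisenberg_power m) (heisenberg_power_topology m) ring_points"
proof -
  define N where "N = heisenberg_power m"
  define T where "T = heisenberg_power_topology m"
  define q where "q g = g <#\<^bsub>N\<^esub> ring_points" for g
  interpret group N unfolding N_def by (rule group_heisenberg_power)
  have top: "topspace T = carrier N" by (simp add: T_def N_def topspace_heisenberg_power)
  have sub: "subgroup ring_points N" unfolding N_def by (rule subgroup_ring_points)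
  obtain Y where Y: "quotient_map T Y q" using quotient_map_exists by blast
  obtain R where R: "R \<ge> 1" "\<And>x. \<exists>d\<in>M. bounded_by m R (x - d)" using rel_denseE[OF M_rel_dense] by blast
  define K :: "(nat \<Rightarrow> heis) set" where "K = Pi\<^sub>E {..<m} (\<lambda>_. cball 0 (3 * R))"
  have "compactin T K"
    unfolding T_def heisenberg_power_topology_def K_def by (subst compactin_PiE) auto
  then have "compactin Y (q ` K)" by (rule image_compactin[OF _ quotient_imp_continuous_map[OF Y]])
  moreover have "q ` K = topspace Y"
  proof
    have "K \<subseteq> topspace T" unfolding top N_def carrier_heisenberg_power K_def by (auto simp: PiE_iff)
    then show "q ` K \<subseteq> topspace Y" using quotient_imp_surjective_map[OF Y] by blast
    show "topspace Y \<subseteq> q ` K"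
    proof
      fix y assume "y \<in> topspace Y"
      then obtain g where g: "g \<in> carrier N" "y = q g" using quotient_imp_surjective_map[OF Y] top by blast
      obtain x' where x': "x' \<in> M" "bounded_by m R (- cx m g - x')" using R(2) by blast
      obtain y' where y': "y' \<in> M" "bounded_by m R (- cy m g - y')" using R(2) by blast
      obtain z' where z': "z' \<in> M" "bounded_by m R (- (cz m g + cx m g \<star> y') - z')" using R(2) by blast
      define \<gamma> where "\<gamma> = from_xyz m x' y' z'"
      have \<gamma>: "\<gamma> \<in> ring_points" unfolding \<gamma>_def using x'(1) y'(1) z'(1) by (rule from_xyz_ring_points)
      then have \<gamma>N: "\<gamma> \<in> carrier N" using subgroup.subset[OF sub] by blast
      have xyz: "cx m \<gamma> = x'" "cy m \<gamma> = y'" "cz m \<gamma> = z'"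
        unfolding \<gamma>_def using from_xyz(2-4) x'(1) y'(1) z'(1) M_supported by auto
      define h where "h = g \<otimes>\<^bsub>N\<^esub> \<gamma>"
      have hN: "h \<in> carrier N" unfolding h_def using g(1) \<gamma>N by (rule m_closed)
      have "norm (h i) \<le> 3 * R" if i: "i < m" for i
      proof -
        have "cx m h i = cx m g i + x' i" "cy m h i = cy m g i + y' i"
          "cz m h i = cz m g i + z' i + cx m g i * y' i"
          unfolding h_def N_def xyz_mult xyz by simp_all
        then have "\<bar>cx m h i\<bar> \<le> R" "\<bar>cy m h i\<bar> \<le> R" "\<bar>cz m h i\<bar> \<le> R"
          using bounded_byD[OF x'(2) i] bounded_byD[OF y'(2) i] bounded_byD[OF z'(2) i]
          by (auto simp: abs_le_iff)
        then have b: "\<bar>fst (h i)\<bar> \<le> R" "\<bar>fst (snd (h i))\<bar> \<le> R" "\<bar>snd (snd (h i))\<bar> \<le> R"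
          using i by (simp_all add: cx_def cy_def cz_def)
        have "norm (h i) \<le> norm (fst (h i)) + norm (snd (h i))"
          using norm_Pair_le[of "fst (h i)" "snd (h i)"] by simp
        moreover have "norm (snd (h i)) \<le> norm (fst (snd (h i))) + norm (snd (snd (h i)))"
          using norm_Pair_le[of "fst (snd (h i))" "snd (snd (h i))"] by simp
        ultimately show ?thesis using b by simp
      qed
      then have "h \<in> K" using hN unfolding N_def carrier_heisenberg_power K_def by (auto simp: PiE_iff)
      moreover have "q g = q h"
        unfolding q_def
      proof (rule l_repr_independence[OF _ g(1) sub])
        show "h \<in> g <#\<^bsub>N\<^esub> ring_points" unfolding l_coset_def h_def using \<gamma> by blast
      qed
      ultimately show "y \<in> q ` K" using g(2) by blast
    qed
  qed
  ultimately have "compact_space Y" unfolding compact_space_def by simp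
  then show ?thesis
    unfolding cocompact_lattice_def using subgroup_ring_points discrete_ring_points Y
    unfolding N_def T_def q_def by blast
qed

sublocale heisenberg_lattice "lattice_group m ring_points" m "coord_W m" "coord_Z m"
  by (rule cocompact_lattice_coordinates[OF cocompact_ring_points])

lemma coord_xyz:
  "coord_W m g i = Complex (cx m g i) (cy m g i)" "coord_Z m g i = cz m g i - cx m g i * cy m g i / 2"
  by (simp_all add: coord_W_def coord_Z_def cx_def cy_def cz_def Complex_eq_0)

lemma center_coords_eq: "center_coords = M"
proof
  show "center_coords \<subseteq> M"
  proof
    fix z assume "z \<in> center_coords"
    then obtain g where g: "g \<in> ring_points" "coord_W m g = 0" "z = coord_Z m g" by auto
    have "cx m g i = 0" for i using fun_cong[OF g(2), of i] by (simp add: coord_xyz Complex_eq_0)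
    then have "z = cz m g" unfolding g(3) by (intro ext) (simp add: coord_xyz)
    then show "z \<in> M" using g(1) by (simp add: ring_points_def)
  qed
  show "M \<subseteq> center_coords"
  proof
    fix v assume v: "v \<in> M"
    define g where "g = from_xyz m 0 0 v"
    have M0: "0 \<in> M" using M_subgroup by (rule add_subgroup_0)
    have g: "g \<in> ring_points" unfolding g_def using M0 M0 v by (rule from_xyz_ring_points)
    have xyz: "cx m g = 0" "cy m g = 0" "cz m g = v"
      unfolding g_def using from_xyz(2-4)[OF supported_0 supported_0 M_supported[OF v]] by auto
    have "coord_W m g = 0" "coord_Z m g = v" by (rule ext, simp add: coord_xyz xyz Complex_eq_0)+
    then show "v \<in> center_coords" using g by (intro image_eqI[of _ _ g]) auto
  qed
qed

text \<open>The ring acts on its own lattice, so its idempotents alone decide which sets are rational.\<close>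

lemma M_subset_multipliers: "M \<subseteq> multipliers"
proof
  fix a assume a: "a \<in> M"
  have "a \<star> w \<in> proj" if w: "w \<in> proj" for w
  proof -
    obtain g where g: "g \<in> ring_points" "w = coord_W m g" using w by auto
    have gM: "cx m g \<in> M" "cy m g \<in> M" using g(1) by (auto simp: ring_points_def)
    define h where "h = from_xyz m (a \<star> cx m g) (a \<star> cy m g) 0"
    have inM: "a \<star> cx m g \<in> M" "a \<star> cy m g \<in> M" "0 \<in> M"
      using M_mult a gM add_subgroup_0[OF M_subgroup] by auto
    have h: "h \<in> ring_points" unfolding h_def using inM by (rule from_xyz_ring_points)
    have "cx m h = a \<star> cx m g" "cy m h = a \<star> cy m g"
      unfolding h_def using from_xyz(2,3)[OF inM[THEN M_supported]] by auto
    then have "coord_W m h = a \<star> w" unfolding g(2)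
      by (intro ext) (simp add: coord_xyz complex_eq_iff)
    then show ?thesis using h by (intro image_eqI[of _ _ h]) auto
  qed
  then show "a \<in> multipliers"
    unfolding multipliers_def unfolding center_coords_eq
    by (intro CollectI conjI ballI M_supported[OF a] M_mult[OF a])
qed

lemma rational_iff: "rational D \<longleftrightarrow> D \<subseteq> {..<m} \<and> (\<exists>N\<ge>1. ind N D \<in> M)"
proof -
  have "ind N D \<in> M" if "ind N D \<in> multipliers" "D \<subseteq> {..<m}" for N
  proof -
    have "\<forall>z\<in>center_coords. ind N D \<star> z \<in> center_coords"
      using that(1) unfolding multipliers_def by blast
    then have "ind N D \<star> ind 1 {..<m} \<in> M"
      using M_one unfolding center_coords_eq by (rule bspec)
    moreover have "ind N D \<star> ind 1 {..<m} = ind N D"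
      using that(2) by (intro ext) (auto simp: ind_apply)
    ultimately show ?thesis by simp
  qed
  then show ?thesis unfolding rational_def using M_subset_multipliers by blast
qed

end

section \<open>Lattices with prescribed growth\<close>

text \<open>The order \<open>\<int>[x]\<close> modulo \<open>split_poly k\<close>, embedded into
  \<open>\<real>\<^sup>k\<close> by its \<open>k\<close> real places \<open>\<theta> i\<close>, and an integer in each of the
  remaining \<open>m - k\<close> coordinates.\<close>

locale split_order =
  fixes k m :: nat and \<theta> :: "nat \<Rightarrow> real"
  assumes k: "1 \<le> k" "k \<le> m" and \<theta>_inj: "inj_on \<theta> {..<k}"
    and \<theta>_root: "\<And>i. i < k \<Longrightarrow> poly (real_poly (split_poly k)) (\<theta> i) = 0"
begin

definition represents :: "int poly \<Rightarrow> (nat \<Rightarrow> real) \<Rightarrow> bool"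
  where "represents f v \<longleftrightarrow> (\<forall>i<k. v i = poly (real_poly f) (\<theta> i))"

definition order_vectors :: "(nat \<Rightarrow> real) set"
  where "order_vectors = {v. supported m v \<and> (\<exists>f. represents f v) \<and> (\<forall>i\<ge>k. v i \<in> \<int>)}"

lemma card_roots: "finite (\<theta> ` {..<k})" "card (\<theta> ` {..<k}) = k"
  using \<theta>_inj by (auto simp: card_image)

lemma reduce: "\<exists>q r. f = split_poly k * q + r \<and> Polynomial.degree r < k"
proof -
  obtain q r where qr: "pseudo_divmod f (split_poly k) = (q, r)" by force
  have nz: "split_poly k \<noteq> 0" using split_poly_monic[OF k(1)] by auto
  have "f = split_poly k * q + r"
    using pseudo_divmod(1)[OF nz qr] split_poly_monic(2)[OF k(1)] by simp
  moreover have "Polynomial.degree r < k"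
    using pseudo_divmod(2)[OF nz qr] split_poly_monic(1)[OF k(1)] k(1) by auto
  ultimately show ?thesis by blast
qed

lemma represents_reduced:
  assumes "represents f v"
  shows "\<exists>r. represents r v \<and> Polynomial.degree r < k"
proof -
  obtain q r where qr: "f = split_poly k * q + r" "Polynomial.degree r < k" using reduce by blast
  have "represents r v"
    using assms \<theta>_root unfolding represents_def qr(1) by (simp add: real_poly_add real_poly_mult)
  then show ?thesis using qr(2) by blast
qed

lemma vanishing_dvd:
  assumes "\<And>i. i < k \<Longrightarrow> poly (real_poly f) (\<theta> i) = 0"
  shows "split_poly k dvd f"
proof -
  obtain q r where qr: "f = split_poly k * q + r" "Polynomial.degree r < k" using reduce by blast
  have "real_poly r = 0"
  proof (rule poly_many_roots_0[OF card_roots(1)])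
    show "Polynomial.degree (real_poly r) < card (\<theta> ` {..<k})" using qr(2) by (simp add: card_roots degree_real_poly)
    fix x assume "x \<in> \<theta> ` {..<k}"
    then obtain i where "i < k" "x = \<theta> i" by blast
    then show "poly (real_poly r) x = 0"
      using assms[of i] \<theta>_root[of i] unfolding qr(1) by (simp add: real_poly_add real_poly_mult)
  qed
  then have "r = 0" by (simp add: poly_eq_iff coeff_map_poly)
  then show ?thesis using qr(1) by simp
qed

lemma prime_split_poly: "Factorial_Ring.prime_elem (split_poly k)"
  by (rule irreducible_imp_prime_elem_gcd[OF split_poly_irreducible[OF k(1)]])

lemma lagrange:
  obtains l where "\<And>i. i < k \<Longrightarrow> Polynomial.degree (l i) < k"
    "\<And>i j. i < k \<Longrightarrow> j < k \<Longrightarrow> poly (l i) (\<theta> j) = (if i = j then 1 else 0)"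
  using lagrange_basis[OF \<theta>_inj] by blast

lemma interpolate:
  assumes l: "\<And>i. i < k \<Longrightarrow> Polynomial.degree (l i) < k"
    "\<And>i j. i < k \<Longrightarrow> j < k \<Longrightarrow> poly (l i) (\<theta> j) = (if i = j then 1 else 0)"
  defines "F v \<equiv> (\<Sum>i<k. Polynomial.smult (v i) (l i))"
  shows "Polynomial.degree (F v) < k" "j < k \<Longrightarrow> poly (F v) (\<theta> j) = v j"
proof -
  have "Polynomial.degree (F v) \<le> k - 1"
    unfolding F_def
  proof (rule degree_sum_le)
    fix i assume "i \<in> {..<k}"
    then have "Polynomial.degree (l i) \<le> k - 1" using l(1)[of i] by simp
    then show "Polynomial.degree (Polynomial.smult (v i) (l i)) \<le> k - 1"
      using Polynomial.degree_smult_le order_trans by blast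
  qed simp
  then show "Polynomial.degree (F v) < k" using k(1) by simp
  assume j: "j < k"
  have "poly (F v) (\<theta> j) = (\<Sum>i<k. v i * poly (l i) (\<theta> j))" by (simp add: F_def poly_sum)
  also have "\<dots> = (\<Sum>i<k. if i = j then v i else 0)" using l(2) j by (intro sum.cong) auto
  also have "\<dots> = v j" using j by simp
  finally show "poly (F v) (\<theta> j) = v j" .
qed

lemma order_vectors_subgroup: "add_subgroup order_vectors"
  unfolding add_subgroup_def
proof (intro conjI ballI)
  have "represents 0 0" by (simp add: represents_def)
  then show "0 \<in> order_vectors" unfolding order_vectors_def by (auto simp: supported_0)
  fix a b assume ab: "a \<in> order_vectors" "b \<in> order_vectors"
  then obtain f g where "represents f a" "represents g b" unfolding order_vectors_def by blast
  then have "represents (f - g) (a - b)" by (simp add: represents_def real_poly_diff)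
  then show "a - b \<in> order_vectors"
    using ab unfolding order_vectors_def by (auto simp: supported_diff)
qed

lemma order_vectors_mult:
  assumes ab: "a \<in> order_vectors" "b \<in> order_vectors"
  shows "a \<star> b \<in> order_vectors"
proof -
  obtain f g where "represents f a" "represents g b" using ab unfolding order_vectors_def by blast
  then have "represents (f * g) (a \<star> b)" by (simp add: represents_def real_poly_mult)
  then show ?thesis
    using ab unfolding order_vectors_def by (auto simp: supported_scale)
qed

text \<open>Interpolate the vector at the roots by a real polynomial of degree less than \<open>k\<close> and round its
  coefficients down.\<close>

lemma order_vectors_rel_dense: "rel_dense m order_vectors"
proof -
  obtain l where l: "\<And>i. i < k \<Longrightarrow> Polynomial.degree (l i) < k"
    "\<And>i j. i < k \<Longrightarrow> j < k \<Longrightarrow> poly (l i) (\<theta> j) = (if i = j then 1 else 0)" using lagrange by blast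
  define R where "R = 1 + (\<Sum>i<k. \<Sum>j<k. \<bar>\<theta> i\<bar> ^ j)"
  have R1: "R \<ge> 1" by (simp add: R_def sum_nonneg)
  have "\<exists>d\<in>order_vectors. bounded_by m R (x - d)" for x
  proof -
    define F where "F = (\<Sum>i<k. Polynomial.smult (x i) (l i))"
    have F: "Polynomial.degree F < k" "\<And>j. j < k \<Longrightarrow> poly F (\<theta> j) = x j"
      unfolding F_def using interpolate[OF l, where v = x] by auto
    define f where "f = map_poly floor F"
    have cf: "Polynomial.coeff f j = \<lfloor>Polynomial.coeff F j\<rfloor>" for j unfolding f_def by (simp add: coeff_map_poly)
    have degf: "Polynomial.degree f < k"
      using Polynomial.map_poly_degree_leq[of floor F] F(1) unfolding f_def by simp
    define d where "d = (\<lambda>i. if i < k then poly (real_poly f) (\<theta> i) else if i < m then of_int \<lfloor>x i\<rfloor> else 0)"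
    have "represents f d" by (simp add: represents_def d_def)
    then have "d \<in> order_vectors"
      unfolding order_vectors_def using k(2) by (auto simp: supported_def d_def)
    moreover have "\<bar>x i - d i\<bar> \<le> R" if i: "i < m" for i
    proof (cases "i < k")
      case True
      have "poly F (\<theta> i) = (\<Sum>j<k. Polynomial.coeff F j * \<theta> i ^ j)"
        using poly_as_sum_of_monoms'[of F "k - 1"] F(1) k(1) poly_altdef[of F "\<theta> i"]
        by (intro trans[OF poly_altdef] sum.mono_neutral_left) (auto simp: coeff_eq_0)
      moreover have "poly (real_poly f) (\<theta> i) = (\<Sum>j<k. of_int (Polynomial.coeff f j) * \<theta> i ^ j)"
      proof -
        have "poly (real_poly f) (\<theta> i) = (\<Sum>j<k. Polynomial.coeff (real_poly f) j * \<theta> i ^ j)"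
          using degf by (intro trans[OF poly_altdef] sum.mono_neutral_left) (auto simp: coeff_eq_0 degree_real_poly)
        then show ?thesis by (simp add: coeff_map_poly)
      qed
      ultimately have "x i - d i = (\<Sum>j<k. (Polynomial.coeff F j - of_int \<lfloor>Polynomial.coeff F j\<rfloor>) * \<theta> i ^ j)"
        using F(2)[OF True] True by (simp add: d_def cf sum_subtractf algebra_simps)
      also have "\<bar>\<dots>\<bar> \<le> (\<Sum>j<k. \<bar>(Polynomial.coeff F j - of_int \<lfloor>Polynomial.coeff F j\<rfloor>) * \<theta> i ^ j\<bar>)"
        by (rule sum_abs)
      also have "\<dots> \<le> (\<Sum>j<k. \<bar>\<theta> i\<bar> ^ j)"
      proof (rule sum_mono)
        fix j
        have "\<bar>Polynomial.coeff F j - of_int \<lfloor>Polynomial.coeff F j\<rfloor>\<bar> \<le> 1" by linarith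
        then have "\<bar>Polynomial.coeff F j - of_int \<lfloor>Polynomial.coeff F j\<rfloor>\<bar> * \<bar>\<theta> i\<bar> ^ j \<le> 1 * \<bar>\<theta> i\<bar> ^ j"
          by (intro mult_right_mono) auto
        then show "\<bar>(Polynomial.coeff F j - of_int \<lfloor>Polynomial.coeff F j\<rfloor>) * \<theta> i ^ j\<bar> \<le> \<bar>\<theta> i\<bar> ^ j"
          by (simp add: abs_mult power_abs)
      qed
      also have "\<dots> \<le> (\<Sum>i<k. \<Sum>j<k. \<bar>\<theta> i\<bar> ^ j)"
        using True by (intro member_le_sum) (auto intro: sum_nonneg)
      also have "\<dots> \<le> R" by (simp add: R_def)
      finally show ?thesis .
    next
      case False
      then have "\<bar>x i - d i\<bar> \<le> 1" using i unfolding d_def by simp linarith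
      then show ?thesis using R1 by linarith
    qed
    ultimately show ?thesis by (auto simp: bounded_by_def)
  qed
  then show ?thesis unfolding rel_dense_def by blast
qed

text \<open>The coefficients of a polynomial of degree less than \<open>k\<close> depend linearly on its values at the roots,
  so integral coefficients vanish if the values are small.\<close>

lemma order_vectors_discrete: "\<exists>\<epsilon>>0. \<forall>v\<in>order_vectors. (\<forall>i<m. \<bar>v i\<bar> < \<epsilon>) \<longrightarrow> v = 0"
proof -
  obtain l where l: "\<And>i. i < k \<Longrightarrow> Polynomial.degree (l i) < k"
    "\<And>i j. i < k \<Longrightarrow> j < k \<Longrightarrow> poly (l i) (\<theta> j) = (if i = j then 1 else 0)" using lagrange by blast
  define B where "B = 1 + (\<Sum>j<k. \<Sum>i<k. \<bar>Polynomial.coeff (l i) j\<bar>)"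
  have B1: "B \<ge> 1" by (simp add: B_def sum_nonneg)
  have "v = 0" if v: "v \<in> order_vectors" and small: "\<forall>i<m. \<bar>v i\<bar> < 1 / B" for v
  proof -
    obtain f where f: "represents f v" "Polynomial.degree f < k"
      using v represents_reduced unfolding order_vectors_def by blast
    define F where "F = (\<Sum>i<k. Polynomial.smult (v i) (l i))"
    have F: "Polynomial.degree F < k" "\<And>j. j < k \<Longrightarrow> poly F (\<theta> j) = v j"
      unfolding F_def using interpolate[OF l, where v = v] by auto
    have "real_poly f - F = 0"
    proof (rule poly_many_roots_0[OF card_roots(1)])
      show "Polynomial.degree (real_poly f - F) < card (\<theta> ` {..<k})"
        unfolding card_roots using f(2) F(1) Polynomial.degree_diff_le_max[of "real_poly f" F]
        by (simp add: degree_real_poly)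
      show "\<And>x. x \<in> \<theta> ` {..<k} \<Longrightarrow> poly (real_poly f - F) x = 0"
        using f(1) F(2) by (auto simp: represents_def)
    qed
    then have fF: "real_poly f = F" by simp
    have "Polynomial.coeff f j = 0" for j
    proof (cases "j < k")
      case True
      have "real_of_int (Polynomial.coeff f j) = Polynomial.coeff F j"
        unfolding fF[symmetric] by (simp add: coeff_map_poly)
      also have "\<dots> = (\<Sum>i<k. v i * Polynomial.coeff (l i) j)" by (simp add: F_def Polynomial.coeff_sum)
      also have "\<bar>\<dots>\<bar> \<le> (\<Sum>i<k. \<bar>v i * Polynomial.coeff (l i) j\<bar>)" by (rule sum_abs)
      also have "\<dots> \<le> (\<Sum>i<k. 1 / B * \<bar>Polynomial.coeff (l i) j\<bar>)"
      proof (rule sum_mono)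
        fix i assume "i \<in> {..<k}"
        then have "\<bar>v i\<bar> \<le> 1 / B" using small k(2) by (meson lessThan_iff less_imp_le less_le_trans)
        then show "\<bar>v i * Polynomial.coeff (l i) j\<bar> \<le> 1 / B * \<bar>Polynomial.coeff (l i) j\<bar>"
          unfolding abs_mult by (rule mult_right_mono) simp
      qed
      also have "\<dots> = (\<Sum>i<k. \<bar>Polynomial.coeff (l i) j\<bar>) / B" by (simp add: sum_divide_distrib)
      also have "(\<Sum>i<k. \<bar>Polynomial.coeff (l i) j\<bar>) \<le> (\<Sum>j<k. \<Sum>i<k. \<bar>Polynomial.coeff (l i) j\<bar>)"
        using member_le_sum[of j "{..<k}" "\<lambda>j. \<Sum>i<k. \<bar>Polynomial.coeff (l i) j\<bar>"] True
        by (auto intro: sum_nonneg)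
      then have "(\<Sum>i<k. \<bar>Polynomial.coeff (l i) j\<bar>) / B < 1" using B1 by (simp add: B_def)
      finally have "\<bar>real_of_int (Polynomial.coeff f j)\<bar> < 1" .
      then show ?thesis by linarith
    next
      case False
      then show ?thesis using f(2) by (intro coeff_eq_0) simp
    qed
    then have f0: "f = 0" by (simp add: poly_eq_iff)
    show "v = 0"
    proof
      fix i
      consider "i < k" | "k \<le> i" "i < m" | "m \<le> i" by linarith
      then show "v i = 0 i"
      proof cases
        case 1
        then show ?thesis using f(1) f0 by (simp add: represents_def)
      next
        case 2
        then have "v i \<in> \<int>" using v by (simp add: order_vectors_def)
        moreover have "1 / B \<le> 1" using B1 by simp
        then have "\<bar>v i\<bar> < 1" using small 2(2) by (meson less_le_trans)
        ultimately show ?thesis using Ints_nonzero_abs_less1 by simp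
      next
        case 3
        then show ?thesis using v by (simp add: order_vectors_def supported_def)
      qed
    qed
  qed
  moreover have "1 / B > 0" using B1 by simp
  ultimately show ?thesis by blast
qed

lemma ind_order_vectors:
  assumes "D \<subseteq> {..<m}" "D \<inter> {..<k} = {} \<or> {..<k} \<subseteq> D"
  shows "ind 1 D \<in> order_vectors"
proof -
  have "\<exists>f. represents f (ind 1 D)"
  proof (cases "{..<k} \<subseteq> D")
    case True
    then have "represents 1 (ind 1 D)" by (auto simp: represents_def ind_apply)
    then show ?thesis by blast
  next
    case False
    then have "represents 0 (ind 1 D)" using assms(2) by (auto simp: represents_def ind_apply)
    then show ?thesis by blast
  qed
  moreover have "supported m (ind 1 D)" using assms(1) by (auto simp: supported_def ind_apply)
  ultimately show ?thesis by (auto simp: order_vectors_def ind_apply)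
qed

text \<open>A field has no nontrivial idempotents. If \<open>f\<close> represents \<open>N\<close> times an indicator vector,
  then \<open>f (f - N)\<close> vanishes at all roots, so the prime polynomial \<open>split_poly k\<close> divides
  \<open>f\<close> or \<open>f - N\<close>.\<close>

lemma ind_order_vectors_imp:
  assumes "ind N D \<in> order_vectors" "N \<ge> 1" "i \<in> D" "i < k"
  shows "{..<k} \<subseteq> D"
proof -
  obtain f where f: "\<And>j. j < k \<Longrightarrow> ind N D j = poly (real_poly f) (\<theta> j)"
    using assms(1) unfolding order_vectors_def represents_def by blast
  have N: "poly (real_poly [:int N:]) x = real N" for x by (simp add: map_poly_pCons)
  have "split_poly k dvd f * (f - [:int N:])"
  proof (rule vanishing_dvd)
    fix j assume j: "j < k"
    have "poly (real_poly (f * (f - [:int N:]))) (\<theta> j) = ind N D j * (ind N D j - real N)"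
      unfolding real_poly_mult real_poly_diff poly_mult poly_diff N f[OF j] ..
    also have "\<dots> = 0" by (simp add: ind_apply)
    finally show "poly (real_poly (f * (f - [:int N:]))) (\<theta> j) = 0" .
  qed
  then consider "split_poly k dvd f" | "split_poly k dvd f - [:int N:]"
    using prime_elem_dvd_multD[OF prime_split_poly] by blast
  then show ?thesis
  proof cases
    case 1
    then obtain g where "f = split_poly k * g" by (auto elim: dvdE)
    then have "ind N D i = 0" using f[OF assms(4)] \<theta>_root[OF assms(4)] by (simp add: real_poly_mult)
    then show ?thesis using assms(2,3) by (simp add: ind_apply)
  next
    case 2
    then obtain g where g: "f - [:int N:] = split_poly k * g" by (auto elim: dvdE)
    have "ind N D j = real N" if j: "j < k" for j
    proof -
      have "ind N D j - real N = poly (real_poly (f - [:int N:])) (\<theta> j)"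
        unfolding real_poly_diff poly_diff N f[OF j] ..
      also have "\<dots> = 0" unfolding g real_poly_mult using \<theta>_root[OF j] by simp
      finally show ?thesis by simp
    qed
    then show ?thesis using assms(2) by (force simp: ind_apply split: if_splits)
  qed
qed

sublocale coordinate_ring m order_vectors
proof
  show "v \<in> order_vectors \<Longrightarrow> supported m v" for v by (simp add: order_vectors_def)
  show "ind 1 {..<m} \<in> order_vectors" using k(2) by (intro ind_order_vectors) auto
qed (fact order_vectors_subgroup order_vectors_mult order_vectors_rel_dense order_vectors_discrete)+

lemma max_block_eq: "max_block = k"
proof -
  have card: "card (block i) \<le> k" if i: "i < m" for i
  proof (cases "i < k")
    case True
    have "rational {..<k}" unfolding rational_iff using k(2) ind_order_vectors[of "{..<k}"] by auto
    then have "block i \<subseteq> {..<k}" using block(3)[OF i] True by blast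
    then have "card (block i) \<le> card {..<k}" by (intro card_mono) auto
    then show ?thesis by simp
  next
    case False
    have "rational {i}" unfolding rational_iff using False i ind_order_vectors[of "{i}"] by auto
    then have "block i \<subseteq> {i}" using block(3)[OF i] by blast
    then have "card (block i) \<le> card {i}" by (intro card_mono) auto
    then show ?thesis using k(1) by simp
  qed
  have 0: "0 < m" "0 < k" using k by auto
  obtain N where "N \<ge> 1" "ind N (block 0) \<in> order_vectors" using block(1)[OF 0(1)] unfolding rational_iff by blast
  then have "{..<k} \<subseteq> block 0" using ind_order_vectors_imp block(2)[OF 0(1)] 0(2) by blast
  then have "card {..<k} \<le> card (block 0)" using block(5)[OF 0(1)] by (rule card_mono[rotated])
  then have "k \<le> max_block" using card_block_le[OF 0(1)] by simp
  moreover have "1 \<le> m" using k by simp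
  then obtain i where i: "i < m" "card (block i) = max_block" using max_block_attained by blast
  then have "max_block \<le> k" using card[OF i(1)] by simp
  ultimately show ?thesis by simp
qed

end

theorem lattice_with_growth_exists:
  assumes "1 \<le> k" "k \<le> m"
  shows "\<exists>\<Gamma>. cocompact_lattice (heisenberg_power m) (heisenberg_power_topology m) \<Gamma> \<and>
    conjugator_length_growth (lattice_group m \<Gamma>) (\<lambda>n. real n ^ (k + 1))"
proof -
  obtain \<theta> where "inj_on \<theta> {..<k}" "\<forall>i<k. poly (real_poly (split_poly k)) (\<theta> i) = 0"
    using split_poly_real_roots by blast
  then interpret split_order k m \<theta> using assms by unfold_locales auto
  have "1 \<le> m" using assms by simp
  from conjugator_length_growth[OF this]
  have "conjugator_length_growth (lattice_group m ring_points) (\<lambda>n. real n ^ (k + 1))"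
    unfolding max_block_eq .
  then show ?thesis using cocompact_ring_points by blast
qed

section \<open>Growth types and the main theorem\<close>

lemma growth_le_trans:
  assumes fg: "f \<preceq>\<^sub>g g" and gh: "g \<preceq>\<^sub>g h" and h: "mono h" "\<And>n. h n \<ge> 0"
  shows "f \<preceq>\<^sub>g h"
proof -
  obtain A where A: "A \<ge> 1" "\<forall>n\<ge>1. f n \<le> real A * g (A * n + A) + real A"
    using fg unfolding growth_le_def by blast
  obtain B where B: "B \<ge> 1" "\<forall>n\<ge>1. g n \<le> real B * h (B * n + B) + real B"
    using gh unfolding growth_le_def by blast
  define D where "D = A * B + A + B"
  have "f n \<le> real D * h (D * n + D) + real D" if n: "n \<ge> 1" for n
  proof -
    have "A * n + A \<ge> 1" using A(1) by simp
    then have "g (A * n + A) \<le> real B * h (B * (A * n + A) + B) + real B" using B(2) by blast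
    also have "\<dots> \<le> real B * h (D * n + D) + real B"
    proof -
      have "B * (A * n + A) + B \<le> D * n + D" by (simp add: D_def algebra_simps)
      then show ?thesis using monoD[OF h(1)] by (intro add_right_mono mult_left_mono) auto
    qed
    finally have "real A * g (A * n + A) \<le> real A * (real B * h (D * n + D) + real B)"
      by (rule mult_left_mono) simp
    moreover have "f n \<le> real A * g (A * n + A) + real A" using A(2) n by blast
    ultimately have "f n \<le> real (A * B) * h (D * n + D) + real (A * B + A)"
      by (simp add: algebra_simps)
    also have "\<dots> \<le> real D * h (D * n + D) + real D"
      by (intro add_mono mult_right_mono of_nat_mono h(2)) (simp_all add: D_def)
    finally show ?thesis .
  qed
  moreover have "D \<ge> 1" using A(1) by (simp add: D_def)
  ultimately show ?thesis unfolding growth_le_def by blast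
qed

lemma cube_not_growth_le_square: "\<not> (\<lambda>n. real n ^ 3) \<preceq>\<^sub>g (\<lambda>n. real n ^ 2)"
proof
  assume "(\<lambda>n. real n ^ 3) \<preceq>\<^sub>g (\<lambda>n. real n ^ 2)"
  then obtain C :: nat where C: "C \<ge> 1" "\<forall>n\<ge>1. real n ^ 3 \<le> real C * real (C * n + C) ^ 2 + real C"
    unfolding growth_le_def by blast
  \<comment> \<open>as \<open>C + C n \<le> 2 C n\<close>, the right hand side is at most \<open>5 C\<^sup>3 n\<^sup>2\<close> for \<open>n \<ge> 1\<close>\<close>
  define n where "n = 5 * C ^ 3 + 1"
  have n1: "n \<ge> 1" by (simp add: n_def)
  have "C * 1 \<le> C * n" using n1 by (rule mult_le_mono2)
  then have "C * n + C \<le> 2 * C * n" by simp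
  then have "C * (C * n + C) ^ 2 \<le> C * (2 * C * n) ^ 2" by (intro mult_le_mono2 power_mono) auto
  also have "\<dots> = 4 * C ^ 3 * n ^ 2" by (simp add: power2_eq_square power3_eq_cube)
  finally have 1: "C * (C * n + C) ^ 2 \<le> 4 * C ^ 3 * n ^ 2" .
  have "C * 1 \<le> C ^ 3 * n ^ 2" using C(1) n1 by (intro mult_le_mono one_le_power) (simp_all add: power3_eq_cube)
  then have 2: "C * (C * n + C) ^ 2 + C \<le> 5 * C ^ 3 * n ^ 2" using 1 by linarith
  have "real n ^ 3 \<le> real C * real (C * n + C) ^ 2 + real C" using C(2) n1 by blast
  then have "real (n ^ 3) \<le> real (C * (C * n + C) ^ 2 + C)" by simp
  then have "n ^ 3 \<le> 5 * C ^ 3 * n ^ 2" using 2 by linarith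
  then have "n * n ^ 2 \<le> (5 * C ^ 3) * n ^ 2" by (simp add: power2_eq_square power3_eq_cube mult_ac)
  then have "n \<le> 5 * C ^ 3" using n1 by (intro mult_right_le_imp_le[of n "n ^ 2"]) auto
  then show False by (simp add: n_def)
qed

lemma square_cube_growth:
  assumes "f \<simeq>\<^sub>g (\<lambda>n. real n ^ 2)" "g \<simeq>\<^sub>g (\<lambda>n. real n ^ 3)"
  shows "\<not> f \<simeq>\<^sub>g g"
proof
  assume "f \<simeq>\<^sub>g g"
  have mono: "mono (\<lambda>n. real n ^ 2)" by (intro monoI power_mono) auto
  have "g \<preceq>\<^sub>g (\<lambda>n. real n ^ 2)"
    by (rule growth_le_trans[of g f]) (use \<open>f \<simeq>\<^sub>g g\<close> assms(1) mono in \<open>auto simp: growth_equiv_def\<close>)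
  then have "(\<lambda>n. real n ^ 3) \<preceq>\<^sub>g (\<lambda>n. real n ^ 2)"
    by (rule growth_le_trans[rotated]) (use assms(2) mono in \<open>auto simp: growth_equiv_def\<close>)
  then show False using cube_not_growth_le_square by contradiction
qed

theorem theoremC:
  shows "(\<forall>m\<ge>1.
            (\<forall>\<Gamma>. cocompact_lattice (heisenberg_power m) (heisenberg_power_topology m) \<Gamma> \<longrightarrow>
               (\<exists>j\<in>{2..m + 1}. conjugator_length_growth (lattice_group m \<Gamma>) (\<lambda>n. real n ^ j))) \<and>
            (\<forall>j\<in>{2..m + 1}. \<exists>\<Gamma>.
               cocompact_lattice (heisenberg_power m) (heisenberg_power_topology m) \<Gamma> \<and>
               conjugator_length_growth (lattice_group m \<Gamma>) (\<lambda>n. real n ^ j))) \<and>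
         (\<exists>(\<Gamma>\<^sub>1 :: (nat \<Rightarrow> heis) monoid) (\<Gamma>\<^sub>2 :: (nat \<Rightarrow> heis) monoid).
            finitely_generated_group \<Gamma>\<^sub>1 \<and> nilpotent_group \<Gamma>\<^sub>1 \<and>
            finitely_generated_group \<Gamma>\<^sub>2 \<and> nilpotent_group \<Gamma>\<^sub>2 \<and>
            quasi_isometric_groups \<Gamma>\<^sub>1 \<Gamma>\<^sub>2 \<and>
            (\<forall>S\<^sub>1 S\<^sub>2. finite_generating_set \<Gamma>\<^sub>1 S\<^sub>1 \<and> finite_generating_set \<Gamma>\<^sub>2 S\<^sub>2 \<longrightarrow>
               \<not> (\<lambda>n. real (conjugator_length_function \<Gamma>\<^sub>1 S\<^sub>1 n)) \<simeq>\<^sub>g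
                  (\<lambda>n. real (conjugator_length_function \<Gamma>\<^sub>2 S\<^sub>2 n))))"
proof (intro conjI allI impI ballI)
  fix m :: nat and \<Gamma>
  assume m: "1 \<le> m" and \<Gamma>: "cocompact_lattice (heisenberg_power m) (heisenberg_power_topology m) \<Gamma>"
  interpret heisenberg_lattice "lattice_group m \<Gamma>" m "coord_W m" "coord_Z m"
    using \<Gamma> by (rule cocompact_lattice_coordinates)
  show "\<exists>j\<in>{2..m + 1}. conjugator_length_growth (lattice_group m \<Gamma>) (\<lambda>n. real n ^ j)"
    using conjugator_length_growth[OF m] max_block_bounds[OF m]
    by (intro bexI[of _ "max_block + 1"]) auto
next
  fix m j :: nat assume "1 \<le> m" "j \<in> {2..m + 1}"
  then have "1 \<le> j - 1" "j - 1 \<le> m" "j - 1 + 1 = j" by auto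
  then show "\<exists>\<Gamma>. cocompact_lattice (heisenberg_power m) (heisenberg_power_topology m) \<Gamma> \<and>
      conjugator_length_growth (lattice_group m \<Gamma>) (\<lambda>n. real n ^ j)"
    using lattice_with_growth_exists[of "j - 1" m] by metis
next
  obtain \<Gamma>1 where \<Gamma>1: "cocompact_lattice (heisenberg_power 2) (heisenberg_power_topology 2) \<Gamma>1"
    "conjugator_length_growth (lattice_group 2 \<Gamma>1) (\<lambda>n. real n ^ (1 + 1))"
    using lattice_with_growth_exists[of 1 2] by auto
  obtain \<Gamma>2 where \<Gamma>2: "cocompact_lattice (heisenberg_power 2) (heisenberg_power_topology 2) \<Gamma>2"
    "conjugator_length_growth (lattice_group 2 \<Gamma>2) (\<lambda>n. real n ^ (2 + 1))"
    using lattice_with_growth_exists[of 2 2] by auto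
  note L1 = cocompact_lattice_coordinates[OF \<Gamma>1(1)]
  note L2 = cocompact_lattice_coordinates[OF \<Gamma>2(1)]
  show "\<exists>(\<Gamma>\<^sub>1 :: (nat \<Rightarrow> heis) monoid) (\<Gamma>\<^sub>2 :: (nat \<Rightarrow> heis) monoid).
            finitely_generated_group \<Gamma>\<^sub>1 \<and> nilpotent_group \<Gamma>\<^sub>1 \<and>
            finitely_generated_group \<Gamma>\<^sub>2 \<and> nilpotent_group \<Gamma>\<^sub>2 \<and>
            quasi_isometric_groups \<Gamma>\<^sub>1 \<Gamma>\<^sub>2 \<and>
            (\<forall>S\<^sub>1 S\<^sub>2. finite_generating_set \<Gamma>\<^sub>1 S\<^sub>1 \<and> finite_generating_set \<Gamma>\<^sub>2 S\<^sub>2 \<longrightarrow>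
               \<not> (\<lambda>n. real (conjugator_length_function \<Gamma>\<^sub>1 S\<^sub>1 n)) \<simeq>\<^sub>g
                  (\<lambda>n. real (conjugator_length_function \<Gamma>\<^sub>2 S\<^sub>2 n)))"
  proof (intro exI conjI allI impI)
    show "finitely_generated_group (lattice_group 2 \<Gamma>1)" "finitely_generated_group (lattice_group 2 \<Gamma>2)"
      using \<Gamma>1(2) \<Gamma>2(2) by (simp_all add: conjugator_length_growth_def)
    show "nilpotent_group (lattice_group 2 \<Gamma>1)" "nilpotent_group (lattice_group 2 \<Gamma>2)"
      by (rule heisenberg_lattice.nilpotent[OF L1] heisenberg_lattice.nilpotent[OF L2])+
    show "quasi_isometric_groups (lattice_group 2 \<Gamma>1) (lattice_group 2 \<Gamma>2)"
      using L1 L2 by (rule heisenberg_lattices_quasi_isometric)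
    fix S1 S2 assume "finite_generating_set (lattice_group 2 \<Gamma>1) S1 \<and> finite_generating_set (lattice_group 2 \<Gamma>2) S2"
    then show "\<not> (\<lambda>n. real (conjugator_length_function (lattice_group 2 \<Gamma>1) S1 n)) \<simeq>\<^sub>g
        (\<lambda>n. real (conjugator_length_function (lattice_group 2 \<Gamma>2) S2 n))"
      using \<Gamma>1(2) \<Gamma>2(2) by (intro square_cube_growth) (auto simp: conjugator_length_growth_def numeral_2_eq_2 numeral_3_eq_3)
  qed
qed

end
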